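(* Let $\Omega\subset\mathbb{R}^N$, $N\ge2$, be a bounded domain of class $C^2$. Let $\lambda\in\mathbb{R}$, $\mu\ge0$, and let $h:\Omega\times\mathbb{R}\to\mathbb{R}$ be a Carathéodory function such that for every $\varrho>0$ there exists $\alpha_\varrho\in L^\infty(\Omega)$ with $|h(x,s)|\le\alpha_\varrho(x)$ for a.e. $x\in\Omega$ and all $|s|\le\varrho$. Assume moreover that, for some $\xi>0$, $$ |h(x,s)|\le|s|\quad\text{for a.e. } x\in\Omega\text{ and for all }|s|\le\xi. $$ Let $K:=\frac12\operatorname{diam}(\Omega)$ and let $\alpha_K$ be the function $\alpha_\varrho$ above in correspondence of $\varrho=K$. If $$ \lambda+\mu\left(1+\frac{\|\alpha_K\|_{L^\infty(\Omega)}}{\xi}\right)\le\lambda_1, $$ then the problem $$ -\operatorname{div}\left(\frac{\nabla u}{\sqrt{1-|\nabla u|^2}}\right)=\lambda u+\mu h(x,u)\ \text{ in }\Omega,\qquad u=0\ \text{ on }\partial\Omega $$ admits only the trivial solution $u\equiv0$.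
   Context: $\lambda_1$ is the first eigenvalue of $-\Delta$ in $\Omega$ under homogeneous Dirichlet boundary conditions. A solution of the problem is a function $u\in W^{2,q}(\Omega)$ for some $q>N$ such that $\|\nabla u\|_{L^\infty(\Omega)}<1$, $u$ satisfies the equation a.e. in $\Omega$, and $u$ vanishes on $\partial\Omega$. *)

theory Defs
  imports "HOL-Analysis.Analysis" "HOL-Probability.Essential_Supremum"
begin

section \<open>Differentiability classes and test functions\<close>

abbreviation partial :: "'a::euclidean_space \<Rightarrow> ('a \<Rightarrow> real) \<Rightarrow> 'a \<Rightarrow> real"
  where "partial i f x \<equiv> frechet_derivative f (at x) i"

definition grad :: "('a::euclidean_space \<Rightarrow> real) \<Rightarrow> 'a \<Rightarrow> 'a"
  where "grad f x = (\<Sum>i\<in>Basis. partial i f x *\<^sub>R i)"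

primrec Ck :: "nat \<Rightarrow> ('a::euclidean_space \<Rightarrow> real) \<Rightarrow> bool"
  where
    "Ck 0 f \<longleftrightarrow> continuous_on UNIV f"
  | "Ck (Suc k) f \<longleftrightarrow> (\<forall>x. f differentiable (at x)) \<and> (\<forall>i\<in>Basis. Ck k (partial i f))"

definition test_functions :: "'a::euclidean_space set \<Rightarrow> ('a \<Rightarrow> real) set"
  where "test_functions \<Omega> =
    {\<phi>. (\<forall>k. Ck k \<phi>) \<and> compact (closure {x. \<phi> x \<noteq> 0}) \<and> closure {x. \<phi> x \<noteq> 0} \<subseteq> \<Omega>}"

section \<open>Domains\<close>

definition domain_set :: "'a::euclidean_space set \<Rightarrow> bool"
  where "domain_set \<Omega> \<longleftrightarrow> open \<Omega> \<and> connected \<Omega> \<and> \<Omega> \<noteq> {}"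

text \<open>
  Near every boundary point the set is, after a rigid motion, the region strictly above the
  graph of a \<open>C\<^sup>2\<close> function. Here \<open>e\<close> is the vertical direction, and a function on the
  hyperplane orthogonal to \<open>e\<close> is encoded as a function \<open>\<gamma>\<close> on the whole space that is
  constant along \<open>e\<close>.
\<close>

definition C2_boundary :: "'a::euclidean_space set \<Rightarrow> bool"
  where "C2_boundary \<Omega> \<longleftrightarrow>
    (\<forall>z\<in>frontier \<Omega>. \<exists>r>0. \<exists>e \<gamma>. norm e = 1 \<and> Ck 2 \<gamma> \<and> (\<forall>x t. \<gamma> (x + t *\<^sub>R e) = \<gamma> x) \<and>
       \<Omega> \<inter> ball z r = {x \<in> ball z r. \<gamma> x < x \<bullet> e})"

section \<open>Lebesgue and Sobolev spaces\<close>

definition in_Lp :: "real \<Rightarrow> 'a::euclidean_space set \<Rightarrow> ('a \<Rightarrow> real) \<Rightarrow> bool"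
  where "in_Lp p \<Omega> f \<longleftrightarrow> f \<in> borel_measurable (lebesgue_on \<Omega>) \<and>
    integrable (lebesgue_on \<Omega>) (\<lambda>x. \<bar>f x\<bar> powr p)"

definition esssup_abs :: "'a::euclidean_space set \<Rightarrow> ('a \<Rightarrow> real) \<Rightarrow> ereal"
  where "esssup_abs \<Omega> f = esssup (lebesgue_on \<Omega>) (\<lambda>x. ereal \<bar>f x\<bar>)"

definition in_Linf :: "'a::euclidean_space set \<Rightarrow> ('a \<Rightarrow> real) \<Rightarrow> bool"
  where "in_Linf \<Omega> f \<longleftrightarrow> f \<in> borel_measurable (lebesgue_on \<Omega>) \<and> esssup_abs \<Omega> f < \<infinity>"

definition Linf_norm :: "'a::euclidean_space set \<Rightarrow> ('a \<Rightarrow> real) \<Rightarrow> real"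
  where "Linf_norm \<Omega> f = real_of_ereal (esssup_abs \<Omega> f)"

definition locally_integrable :: "'a::euclidean_space set \<Rightarrow> ('a \<Rightarrow> real) \<Rightarrow> bool"
  where "locally_integrable \<Omega> f \<longleftrightarrow> f \<in> borel_measurable (lebesgue_on \<Omega>) \<and>
    (\<forall>C. compact C \<and> C \<subseteq> \<Omega> \<longrightarrow> integrable (lebesgue_on C) f)"

definition has_weak_partial ::
    "'a::euclidean_space set \<Rightarrow> 'a \<Rightarrow> ('a \<Rightarrow> real) \<Rightarrow> ('a \<Rightarrow> real) \<Rightarrow> bool"
  where "has_weak_partial \<Omega> i f g \<longleftrightarrow> locally_integrable \<Omega> f \<and> locally_integrable \<Omega> g \<and>
    (\<forall>\<phi>\<in>test_functions \<Omega>.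
       (LINT x|lebesgue_on \<Omega>. f x * partial i \<phi> x) = - (LINT x|lebesgue_on \<Omega>. g x * \<phi> x))"

definition has_weak_gradient :: "'a::euclidean_space set \<Rightarrow> ('a \<Rightarrow> real) \<Rightarrow> ('a \<Rightarrow> 'a) \<Rightarrow> bool"
  where "has_weak_gradient \<Omega> u G \<longleftrightarrow> (\<forall>i\<in>Basis. has_weak_partial \<Omega> i u (\<lambda>x. G x \<bullet> i))"

definition has_weak_divergence :: "'a::euclidean_space set \<Rightarrow> ('a \<Rightarrow> 'a) \<Rightarrow> ('a \<Rightarrow> real) \<Rightarrow> bool"
  where "has_weak_divergence \<Omega> F d \<longleftrightarrow>
    (\<exists>D. (\<forall>i\<in>Basis. has_weak_partial \<Omega> i (\<lambda>x. F x \<bullet> i) (D i)) \<and>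
         (AE x in lebesgue_on \<Omega>. d x = (\<Sum>i\<in>Basis. D i x)))"

text \<open>
  The space \<open>W\<^bsup>k,p\<^esup>\<close>; the weak derivatives of higher order are obtained as iterated
  first order ones.
\<close>

primrec in_sobolev :: "nat \<Rightarrow> real \<Rightarrow> 'a::euclidean_space set \<Rightarrow> ('a \<Rightarrow> real) \<Rightarrow> bool"
  where
    "in_sobolev 0 p \<Omega> u \<longleftrightarrow> in_Lp p \<Omega> u"
  | "in_sobolev (Suc k) p \<Omega> u \<longleftrightarrow> in_Lp p \<Omega> u \<and>
       (\<forall>i\<in>Basis. \<exists>g. has_weak_partial \<Omega> i u g \<and> in_sobolev k p \<Omega> g)"

section \<open>The first Dirichlet eigenvalue of the Laplacian\<close>

text \<open>
  \<open>in_H10 \<Omega> v G\<close>: \<open>v\<close> belongs to the closure of the test functions in \<open>W\<^bsup>1,2\<^esup>\<close>, and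
  \<open>G\<close> is its weak gradient.
\<close>

definition in_H10 :: "'a::euclidean_space set \<Rightarrow> ('a \<Rightarrow> real) \<Rightarrow> ('a \<Rightarrow> 'a) \<Rightarrow> bool"
  where "in_H10 \<Omega> v G \<longleftrightarrow> in_Lp 2 \<Omega> v \<and> has_weak_gradient \<Omega> v G \<and>
    (\<forall>i\<in>Basis. in_Lp 2 \<Omega> (\<lambda>x. G x \<bullet> i)) \<and>
    (\<exists>\<phi> :: nat \<Rightarrow> 'a \<Rightarrow> real. (\<forall>n. \<phi> n \<in> test_functions \<Omega>) \<and>
       (\<lambda>n. LINT x|lebesgue_on \<Omega>. (v x - \<phi> n x)\<^sup>2 + (norm (G x - grad (\<phi> n) x))\<^sup>2)
         \<longlonglongrightarrow> 0)"

definition dirichlet_eigenvalue :: "'a::euclidean_space set \<Rightarrow> real \<Rightarrow> bool"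
  where "dirichlet_eigenvalue \<Omega> l \<longleftrightarrow>
    (\<exists>v G. in_H10 \<Omega> v G \<and> \<not> (AE x in lebesgue_on \<Omega>. v x = 0) \<and>
       (\<forall>\<phi>\<in>test_functions \<Omega>.
          (LINT x|lebesgue_on \<Omega>. G x \<bullet> grad \<phi> x) = l * (LINT x|lebesgue_on \<Omega>. v x * \<phi> x)))"

definition first_dirichlet_eigenvalue :: "'a::euclidean_space set \<Rightarrow> real"
  where "first_dirichlet_eigenvalue \<Omega> = (LEAST l. dirichlet_eigenvalue \<Omega> l)"

section \<open>The mean curvature problem\<close>

definition caratheodory :: "'a::euclidean_space set \<Rightarrow> ('a \<Rightarrow> real \<Rightarrow> real) \<Rightarrow> bool"
  where "caratheodory \<Omega> h \<longleftrightarrow> (\<forall>s. (\<lambda>x. h x s) \<in> borel_measurable (lebesgue_on \<Omega>)) \<and>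
    (AE x in lebesgue_on \<Omega>. continuous_on UNIV (h x))"

text \<open>
  Solutions of \<open>- div (\<nabla>u / sqrt (1 - \<bar>\<nabla>u\<bar>\<^sup>2)) = f(x, u)\<close> in \<open>\<Omega>\<close>, \<open>u = 0\<close> on its boundary.
  As the integrability exponent exceeds the dimension, elements of \<open>W\<^bsup>2,q\<^esup>\<close> on a bounded
  \<open>C\<^sup>2\<close> domain have a representative continuous up to the boundary; \<open>u\<close> is that
  representative, so that its boundary values are meant pointwise. Values of \<open>u\<close> outside the
  closure of \<open>\<Omega>\<close> are irrelevant.
\<close>

definition mc_solution ::
    "'a::euclidean_space set \<Rightarrow> ('a \<Rightarrow> real \<Rightarrow> real) \<Rightarrow> ('a \<Rightarrow> real) \<Rightarrow> bool"
  where "mc_solution \<Omega> f u \<longleftrightarrow>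
    (\<exists>q > real DIM('a). in_sobolev 2 q \<Omega> u) \<and>
    continuous_on (closure \<Omega>) u \<and> (\<forall>x\<in>frontier \<Omega>. u x = 0) \<and>
    (\<exists>G d. has_weak_gradient \<Omega> u G \<and> esssup_abs \<Omega> (\<lambda>x. norm (G x)) < 1 \<and>
       has_weak_divergence \<Omega> (\<lambda>x. G x /\<^sub>R sqrt (1 - (norm (G x))\<^sup>2)) d \<and>
       (AE x in lebesgue_on \<Omega>. - d x = f x (u x)))"

end

theory Submission
  imports Defs "HOL-Complex_Analysis.Great_Picard" "HOL-Library.Diagonal_Subsequence"
begin

text \<open>
  Let \<open>u\<close> be a solution. Around every point of \<open>\<Omega>\<close> the largest ball inside \<open>\<Omega>\<close> touches the
  boundary; as \<open>u\<close> vanishes there and has Lipschitz constant at most 1 on the ball, \<open>\<bar>u\<bar>\<close> is at most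
  the radius, hence at most \<open>K\<close> (\<open>abs_le_half_diameter\<close>). Put \<open>A = \<parallel>\<alpha>\<^sub>K\<parallel>\<close> and \<open>c = 1 + A / \<xi>\<close>. Where \<open>\<bar>u\<bar> \<le> \<xi>\<close>
  the hypothesis near zero gives \<open>\<bar>h(x,u)\<bar> \<le> \<bar>u\<bar>\<close>, and elsewhere \<open>\<bar>h(x,u)\<bar> \<le> A \<le> A \<bar>u\<bar> / \<xi>\<close>; so
  \<open>\<bar>h(x,u)\<bar> \<le> c \<bar>u\<bar>\<close> throughout. Testing the equation with \<open>u\<close> itself yields, with all integrals
  over \<open>\<Omega>\<close>,
  \<open>\<integral> \<bar>\<nabla>u\<bar>\<^sup>2 / sqrt (1 - \<bar>\<nabla>u\<bar>\<^sup>2) \<le> (\<lambda> + \<mu> c) \<integral> u\<^sup>2 \<le> \<lambda>\<^sub>1 \<integral> u\<^sup>2 \<le> \<integral> \<bar>\<nabla>u\<bar>\<^sup>2\<close>.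
  The first integrand exceeds the last one wherever \<open>\<nabla>u \<noteq> 0\<close>, so \<open>\<nabla>u = 0\<close>, and then the last
  inequality with \<open>\<lambda>\<^sub>1 > 0\<close> leaves only \<open>u = 0\<close> (\<open>vanishes\<close>). Conversely, \<open>h(x,0) = 0\<close>, so that the zero
  function is a solution.

  Two classical facts carry this argument. The first is that \<open>\<lambda>\<^sub>1\<close>, introduced as the least
  eigenvalue, exists, is positive, and is the infimum of the Rayleigh quotient over test functions
  (\<open>first_eigenvalue_rayleigh\<close>). Positivity is the Poincare inequality. A minimising sequence has a
  subsequence that converges in the mean by Rellich's theorem (\<open>rellich\<close>), which follows from
  mollification and the Arzela-Ascoli theorem; the parallelogram identity makes the gradients
  converge as well; and the limit satisfies the eigenvalue equation because it minimises the
  quotient.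

  The second is that a solution may be used as a test function (\<open>admissible_self\<close>). The solution is
  only known to be continuous with a bounded weak gradient, and to vanish on the boundary. Its
  mollifications are smooth and uniformly close to it, so that a truncation which is zero near zero
  turns them into test functions of \<open>\<Omega>\<close>. Mollified gradients converge in the mean, and both the
  equation and the Rayleigh inequality survive bounded almost everywhere convergence.
\<close>

section \<open>Smooth functions\<close>

lemma partial_eq:
  assumes "(f has_derivative f') (at x)"
  shows "partial i f x = f' i"
  using frechet_derivative_at[OF assms] by metis

lemma Ck_has_derivative: "Ck (Suc k) f \<Longrightarrow> (f has_derivative frechet_derivative f (at x)) (at x)"
  by (simp add: frechet_derivative_works)

lemma Ck_partial: "Ck (Suc k) f \<Longrightarrow> i \<in> Basis \<Longrightarrow> Ck k (\<lambda>x. partial i f x)"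
  by simp

lemma Ck_SucD: "Ck (Suc k) f \<Longrightarrow> Ck k f"
proof (induction k arbitrary: f)
  case 0
  then show ?case
    by (auto intro!: differentiable_imp_continuous_on simp: differentiable_on_def
        intro: differentiable_at_withinI)
next
  case (Suc k)
  then show ?case by simp
qed

lemma Ck_SucI:
  fixes f :: "'a::euclidean_space \<Rightarrow> real"
  assumes "\<And>x. (f has_derivative f' x) (at x)" "\<And>i. i \<in> Basis \<Longrightarrow> Ck k (\<lambda>x. f' x i)"
  shows "Ck (Suc k) f"
proof -
  have "partial i f = (\<lambda>x. f' x i)" for i
    using partial_eq[OF assms(1)] by auto
  then show ?thesis
    using assms unfolding differentiable_def by (auto simp: differentiable_def)
qed

lemma Ck_const: "Ck k (\<lambda>x. c)"
proof (induction k arbitrary: c)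
  case (Suc k)
  show ?case by (rule Ck_SucI[where f' = "\<lambda>_ _. 0"]) (auto intro!: derivative_eq_intros Suc)
qed simp

lemma Ck_add: "Ck k f \<Longrightarrow> Ck k g \<Longrightarrow> Ck k (\<lambda>x. f x + g x)"
proof (induction k arbitrary: f g)
  case 0
  then show ?case by (auto intro: continuous_intros)
next
  case (Suc k)
  show ?case
    by (rule Ck_SucI[OF has_derivative_add[OF Ck_has_derivative[OF Suc.prems(1)]
          Ck_has_derivative[OF Suc.prems(2)]]]) (use Suc in auto)
qed

lemma Ck_mult: "Ck k f \<Longrightarrow> Ck k g \<Longrightarrow> Ck k (\<lambda>x. f x * g x)"
proof (induction k arbitrary: f g)
  case 0
  then show ?case by (auto intro: continuous_intros)
next
  case (Suc k)
  show ?case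
    by (rule Ck_SucI[OF has_derivative_mult[OF Ck_has_derivative[OF Suc.prems(1)]
          Ck_has_derivative[OF Suc.prems(2)]]])
       (intro Ck_add Suc.IH Ck_SucD[OF Suc.prems(1)] Ck_SucD[OF Suc.prems(2)]
          Ck_partial[OF Suc.prems(1)] Ck_partial[OF Suc.prems(2)])
qed

lemma Ck_sum: "finite A \<Longrightarrow> (\<And>a. a \<in> A \<Longrightarrow> Ck k (f a)) \<Longrightarrow> Ck k (\<lambda>x. \<Sum>a\<in>A. f a x)"
  by (induction A rule: finite_induct) (auto intro: Ck_const Ck_add)

lemma Ck_bounded_linear:
  assumes "bounded_linear f" shows "Ck k f"
proof (cases k)
  case 0
  then show ?thesis using assms by (simp add: linear_continuous_on)
next
  case (Suc k)
  show ?thesis unfolding Suc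
    by (rule Ck_SucI[where f' = "\<lambda>_. f"])
       (auto intro: bounded_linear_imp_has_derivative assms Ck_const)
qed

lemma Ck_compose:
  fixes g :: "real \<Rightarrow> real"
  shows "Ck k g \<Longrightarrow> Ck k f \<Longrightarrow> Ck k (\<lambda>x. g (f x))"
proof (induction k arbitrary: f g)
  case 0
  then show ?case by (auto intro: continuous_on_compose2)
next
  case (Suc k)
  have *: "((\<lambda>x. g (f x)) has_derivative (\<lambda>h. partial 1 g (f x) * frechet_derivative f (at x) h)) (at x)" for x
  proof -
    have "linear (frechet_derivative g (at (f x)))"
      using Ck_has_derivative[OF Suc.prems(1)] has_derivative_linear by blast
    then have "frechet_derivative g (at (f x)) (t *\<^sub>R 1) = t *\<^sub>R partial 1 g (f x)" for t
      by (rule linear_cmul)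
    then have "frechet_derivative g (at (f x)) t = partial 1 g (f x) * t" for t
      by (metis mult.commute mult.right_neutral real_scaleR_def)
    then have lin: "(\<lambda>h. frechet_derivative g (at (f x)) (frechet_derivative f (at x) h)) =
        (\<lambda>h. partial 1 g (f x) * frechet_derivative f (at x) h)"
      by blast
    have "((\<lambda>x. g (f x)) has_derivative
        (\<lambda>h. frechet_derivative g (at (f x)) (frechet_derivative f (at x) h))) (at x)"
      by (rule has_derivative_compose[OF Ck_has_derivative[OF Suc.prems(2)] Ck_has_derivative[OF Suc.prems(1)]])
    then show ?thesis by (rule lin[THEN subst])
  qed
  have "Ck k (\<lambda>x. partial 1 g (f x))"
    by (rule Suc.IH[OF Ck_partial[OF Suc.prems(1)] Ck_SucD[OF Suc.prems(2)]]) simp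
  then show ?case
    by (intro Ck_SucI[OF *] Ck_mult Ck_partial[OF Suc.prems(2)])
qed

definition smooth :: "('a::euclidean_space \<Rightarrow> real) \<Rightarrow> bool"
  where "smooth f \<longleftrightarrow> (\<forall>k. Ck k f)"

lemma smooth_const: "smooth (\<lambda>x. c)" by (simp add: smooth_def Ck_const)
lemma smooth_add: "smooth f \<Longrightarrow> smooth g \<Longrightarrow> smooth (\<lambda>x. f x + g x)" by (simp add: smooth_def Ck_add)
lemma smooth_mult: "smooth f \<Longrightarrow> smooth g \<Longrightarrow> smooth (\<lambda>x. f x * g x)" by (simp add: smooth_def Ck_mult)
lemma smooth_compose: "smooth (g :: real \<Rightarrow> real) \<Longrightarrow> smooth f \<Longrightarrow> smooth (\<lambda>x. g (f x))"
  by (simp add: smooth_def Ck_compose)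
lemma smooth_bounded_linear: "bounded_linear f \<Longrightarrow> smooth f"
  by (simp add: smooth_def Ck_bounded_linear)
lemma smooth_sum: "finite A \<Longrightarrow> (\<And>a. a \<in> A \<Longrightarrow> smooth (f a)) \<Longrightarrow> smooth (\<lambda>x. \<Sum>a\<in>A. f a x)"
  by (simp add: smooth_def Ck_sum)
lemma smooth_cmult: "smooth f \<Longrightarrow> smooth (\<lambda>x. c * f x)"
  by (simp add: smooth_const smooth_mult)
lemma smooth_uminus: "smooth f \<Longrightarrow> smooth (\<lambda>x. - f x)"
  using smooth_cmult[of f "-1"] by simp
lemma smooth_diff: "smooth f \<Longrightarrow> smooth g \<Longrightarrow> smooth (\<lambda>x. f x - g x)"
  using smooth_add[OF _ smooth_uminus[of g], of f] by simp

lemma smooth_partial: "smooth f \<Longrightarrow> i \<in> Basis \<Longrightarrow> smooth (partial i f)"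
  unfolding smooth_def by (metis Ck.simps(2))

lemma smooth_has_derivative: "smooth f \<Longrightarrow> (f has_derivative frechet_derivative f (at x)) (at x)"
  unfolding smooth_def by (metis Ck_has_derivative)

lemma smooth_continuous: "smooth f \<Longrightarrow> continuous_on UNIV f"
  unfolding smooth_def by (metis Ck.simps(1))

lemma smooth_measurable: "smooth f \<Longrightarrow> f \<in> borel_measurable borel"
  by (intro borel_measurable_continuous_onI smooth_continuous)

lemma frechet_eq_inner_grad:
  fixes f :: "'a::euclidean_space \<Rightarrow> real"
  assumes "(f has_derivative f') (at x)"
  shows "f' h = h \<bullet> grad f x"
proof -
  interpret linear f' using assms by (rule has_derivative_linear)
  have "f' h = f' (\<Sum>i\<in>Basis. (h \<bullet> i) *\<^sub>R i)" by (simp add: euclidean_representation)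
  also have "\<dots> = (\<Sum>i\<in>Basis. (h \<bullet> i) * partial i f x)"
    by (simp add: sum scale partial_eq[OF assms])
  also have "\<dots> = h \<bullet> grad f x"
    by (simp add: grad_def inner_sum_right mult.commute)
  finally show ?thesis .
qed

lemma smooth_has_derivative_grad: "smooth f \<Longrightarrow> (f has_derivative (\<lambda>h. h \<bullet> grad f x)) (at x)"
  using smooth_has_derivative[of f x] frechet_eq_inner_grad[OF smooth_has_derivative[of f x]]
  by (metis (no_types, lifting) has_derivative_eq_rhs ext)

lemma grad_inner_Basis: "i \<in> Basis \<Longrightarrow> grad f x \<bullet> i = partial i f x"
  by (simp add: grad_def inner_sum_left inner_Basis if_distrib sum.delta' cong: if_cong)

lemma continuous_on_grad: "smooth f \<Longrightarrow> continuous_on UNIV (grad f)"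
  unfolding grad_def[abs_def]
  by (intro continuous_intros smooth_continuous smooth_partial)

lemma grad_eqI: "(f has_derivative (\<lambda>h. h \<bullet> v)) (at x) \<Longrightarrow> grad f x = v"
  by (metis frechet_eq_inner_grad inner_commute vector_eq_rdot)

lemma smooth_reflect:
  assumes "smooth \<rho>" shows "smooth (\<lambda>y. \<rho> (a - y))"
    and "partial i (\<lambda>y. \<rho> (a - y)) y = - partial i \<rho> (a - y)"
proof -
  have der: "((\<lambda>y. \<rho> (a - y)) has_derivative (\<lambda>h. - (h \<bullet> grad \<rho> (a - y)))) (at y)" if "smooth \<rho>" for \<rho> :: "'a \<Rightarrow> real" and y
  proof -
    have "((\<lambda>y. a - y) has_derivative (\<lambda>h. - h)) (at y)" by (auto intro!: derivative_eq_intros)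
    from has_derivative_compose[OF this smooth_has_derivative_grad[OF that, of "a - y"]] show ?thesis by simp
  qed
  have p: "partial i (\<lambda>y. \<rho> (a - y)) y = - partial i \<rho> (a - y)" if "smooth \<rho>" for \<rho> :: "'a \<Rightarrow> real" and i y
    using partial_eq[OF der[OF that]] frechet_eq_inner_grad[OF smooth_has_derivative[OF that]] by simp
  then show "partial i (\<lambda>y. \<rho> (a - y)) y = - partial i \<rho> (a - y)" using assms .
  have "Ck k (\<lambda>y. \<rho> (a - y))" for k
    using assms
  proof (induction k arbitrary: \<rho>)
    case 0
    have "continuous_on UNIV (\<lambda>y. a - y)" by (intro continuous_intros)
    then have "continuous_on UNIV (\<lambda>y. \<rho> (a - y))"
      by (rule continuous_on_compose2[OF smooth_continuous[OF 0]]) simp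
    then show ?case by simp
  next
    case (Suc k)
    have "Ck k (\<lambda>y. (-1) * partial i \<rho> (a - y))" if "i \<in> Basis" for i
      using Suc that by (intro Ck_mult Ck_const Suc.IH smooth_partial)
    then have "Ck k (partial i (\<lambda>y. \<rho> (a - y)))" if "i \<in> Basis" for i
      using that by (simp add: p[OF Suc.prems])
    moreover have "(\<lambda>y. \<rho> (a - y)) differentiable (at y)" for y
      using der[OF Suc.prems] by (auto simp: differentiable_def)
    ultimately show ?case by simp
  qed
  then show "smooth (\<lambda>y. \<rho> (a - y))" by (simp add: smooth_def)
qed

lemma smooth_inner_self: "smooth (\<lambda>x. x \<bullet> x)"
  unfolding euclidean_inner[of x x for x]
  by (intro smooth_sum smooth_mult smooth_bounded_linear bounded_linear_inner_left finite_Basis)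

section \<open>A smooth function vanishing on a half line\<close>

text \<open>The factor \<open>1 / t ^ m\<close> makes the family closed under differentiation.\<close>

definition flat_exp :: "nat \<Rightarrow> real \<Rightarrow> real"
  where "flat_exp m t = (if t > 0 then exp (- 1 / t) / t ^ m else 0)"

text \<open>
  The exponential beats every power; this is what makes all derivatives below vanish at 0.
\<close>

lemma exp_inverse_div_power_tendsto_0: "((\<lambda>t::real. exp (- 1 / t) / t ^ m) \<longlongrightarrow> 0) (at_right 0)"
proof -
  have "((\<lambda>x::real. x ^ m / exp x) \<longlongrightarrow> 0) at_top"
    by (rule tendsto_power_div_exp_0)
  then have "((\<lambda>t::real. inverse t ^ m / exp (inverse t)) \<longlongrightarrow> 0) (at_right 0)"
    by (rule filterlim_compose[OF _ filterlim_inverse_at_top_right])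
  then show ?thesis
    by (simp add: exp_minus divide_simps mult.commute)
qed

lemma flat_exp_has_derivative:
  "(flat_exp m has_real_derivative (flat_exp (m + 2) t - m * flat_exp (m + 1) t)) (at t)"
proof (cases "t = 0")
  case True
  have "((\<lambda>h. flat_exp m h / h) \<longlongrightarrow> 0) (at 0)"
  proof (rule filterlim_split_at)
    show "((\<lambda>h. flat_exp m h / h) \<longlongrightarrow> 0) (at_left 0)"
      by (rule tendsto_eventually) (auto simp: flat_exp_def eventually_at_left_field intro!: exI[of _ "-1"])
    have "\<forall>\<^sub>F h in at_right 0. exp (- 1 / h) / h ^ (m + 1) = flat_exp m h / h"
      by (auto simp: flat_exp_def eventually_at_right_field intro!: exI[of _ 1])
    then show "((\<lambda>h. flat_exp m h / h) \<longlongrightarrow> 0) (at_right 0)"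
      using exp_inverse_div_power_tendsto_0[of "m + 1"] by (rule Lim_transform_eventually[rotated])
  qed
  then have "(flat_exp m has_real_derivative 0) (at 0)"
    unfolding DERIV_def by (simp add: flat_exp_def)
  then show ?thesis by (simp add: True flat_exp_def)
next
  case False
  show ?thesis
  proof (cases "t > 0")
    case True
    have "((\<lambda>t. exp (- 1 / t) / t ^ m) has_real_derivative (flat_exp (m + 2) t - m * flat_exp (m + 1) t)) (at t)"
      using True
      by (cases m) (auto intro!: derivative_eq_intros simp: flat_exp_def field_simps power2_eq_square,
          metis One_nat_def power_eq_if)
    then show ?thesis
      by (rule has_field_derivative_transform_within_open[where S = "{0<..}"])
         (use True in \<open>auto simp: flat_exp_def\<close>)
  next
    assume "\<not> t > 0"
    have "((\<lambda>t. 0) has_real_derivative (flat_exp (m + 2) t - m * flat_exp (m + 1) t)) (at t)"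
      using \<open>\<not> t > 0\<close> by (simp add: flat_exp_def)
    then show ?thesis
      by (rule has_field_derivative_transform_within_open[where S = "{..<0}"])
         (use \<open>\<not> t > 0\<close> False in \<open>auto simp: flat_exp_def\<close>)
  qed
qed

lemma smooth_flat_exp: "smooth (flat_exp m)"
proof -
  have "Ck k (flat_exp m)" for k m
  proof (induction k arbitrary: m)
    case 0
    show ?case
      using flat_exp_has_derivative[of m] DERIV_isCont
      by (auto simp: continuous_on_eq_continuous_at)
  next
    case (Suc k)
    show ?case
    proof (rule Ck_SucI)
      show "(flat_exp m has_derivative (\<lambda>h. (flat_exp (m + 2) t + (- real m) * flat_exp (m + 1) t) * h)) (at t)" for t
        using flat_exp_has_derivative[of m t] by (simp add: has_field_derivative_def)
      show "Ck k (\<lambda>t. (flat_exp (m + 2) t + (- real m) * flat_exp (m + 1) t) * i)" for i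
        by (intro Ck_mult Ck_add Suc Ck_const)
    qed
  qed
  then show ?thesis by (simp add: smooth_def)
qed

lemma flat_exp_0_bounds: "0 \<le> flat_exp 0 t" "flat_exp 0 t \<le> 1"
  by (auto simp: flat_exp_def)

section \<open>Test functions\<close>

lemma test_functionsI:
  assumes "smooth \<phi>" "compact K" "K \<subseteq> \<Omega>" "\<And>x. x \<notin> K \<Longrightarrow> \<phi> x = 0"
  shows "\<phi> \<in> test_functions \<Omega>"
proof -
  have "closure {x. \<phi> x \<noteq> 0} \<subseteq> K"
    using assms by (intro closure_minimal compact_imp_closed) auto
  then show ?thesis
    using assms closed_subset[of _ K] compact_Int_closed[OF \<open>compact K\<close>, of "closure {x. \<phi> x \<noteq> 0}"]
    by (auto simp: test_functions_def smooth_def Int_absorb1)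
qed

lemma test_functionsE:
  assumes "\<phi> \<in> test_functions \<Omega>"
  obtains K where "smooth \<phi>" "compact K" "K \<subseteq> \<Omega>" "\<And>x. x \<notin> K \<Longrightarrow> \<phi> x = 0"
    "\<And>x. x \<notin> K \<Longrightarrow> grad \<phi> x = 0" "\<And>i x. x \<notin> K \<Longrightarrow> partial i \<phi> x = 0"
proof
  let ?K = "closure {x. \<phi> x \<noteq> 0}"
  show "smooth \<phi>" "compact ?K" "?K \<subseteq> \<Omega>"
    using assms by (auto simp: test_functions_def smooth_def)
  show 0: "\<phi> x = 0" if "x \<notin> ?K" for x
    using that closure_subset[of "{x. \<phi> x \<noteq> 0}"] by blast
  show 1: "partial i \<phi> x = 0" if "x \<notin> ?K" for i x
  proof -
    have "(\<phi> has_derivative (\<lambda>_. 0)) (at x)"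
    proof (rule has_derivative_transform_within_open[OF has_derivative_const])
      show "open (- ?K)" "x \<in> - ?K" using that by auto
      show "0 = \<phi> y" if "y \<in> - ?K" for y
        by (rule 0[symmetric]) (rule that[THEN ComplD])
    qed
    then show ?thesis by (rule partial_eq)
  qed
  show "grad \<phi> x = 0" if "x \<notin> ?K" for x
    using 1[OF that] by (simp add: grad_def)
qed

lemma test_smooth: "\<phi> \<in> test_functions \<Omega> \<Longrightarrow> smooth \<phi>"
  by (auto simp: test_functions_def smooth_def)

lemma test_functions_mono: "\<phi> \<in> test_functions \<Omega> \<Longrightarrow> \<Omega> \<subseteq> \<Omega>' \<Longrightarrow> \<phi> \<in> test_functions \<Omega>'"
  by (auto simp: test_functions_def)

lemma test_outside: "\<phi> \<in> test_functions \<Omega> \<Longrightarrow> x \<notin> \<Omega> \<Longrightarrow> \<phi> x = 0"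
  by (auto elim: test_functionsE)

lemma grad_outside: "\<phi> \<in> test_functions \<Omega> \<Longrightarrow> x \<notin> \<Omega> \<Longrightarrow> grad \<phi> x = 0"
  by (erule test_functionsE) blast

lemma test_partial:
  assumes "\<phi> \<in> test_functions \<Omega>" "i \<in> Basis" shows "partial i \<phi> \<in> test_functions \<Omega>"
proof -
  obtain K where K: "smooth \<phi>" "compact K" "K \<subseteq> \<Omega>" "\<And>i x. x \<notin> K \<Longrightarrow> partial i \<phi> x = 0"
    using test_functionsE[OF assms(1)] by metis
  show ?thesis by (rule test_functionsI[OF smooth_partial[OF K(1) assms(2)] K(2,3,4)])
qed

lemma test_mult_right:
  assumes "\<phi> \<in> test_functions \<Omega>" "smooth f" shows "(\<lambda>x. f x * \<phi> x) \<in> test_functions \<Omega>"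
  using assms(1)
  by (rule test_functionsE) (rule test_functionsI, auto intro: smooth_mult assms)

lemma test_add:
  assumes "\<phi> \<in> test_functions \<Omega>" "\<psi> \<in> test_functions \<Omega>"
  shows "(\<lambda>x. \<phi> x + \<psi> x) \<in> test_functions \<Omega>"
proof -
  obtain K where K: "smooth \<phi>" "compact K" "K \<subseteq> \<Omega>" "\<And>x. x \<notin> K \<Longrightarrow> \<phi> x = 0"
    using test_functionsE[OF assms(1)] by metis
  obtain L where L: "smooth \<psi>" "compact L" "L \<subseteq> \<Omega>" "\<And>x. x \<notin> L \<Longrightarrow> \<psi> x = 0"
    using test_functionsE[OF assms(2)] by metis
  show ?thesis
    by (rule test_functionsI[of _ "K \<union> L"]) (use K L in \<open>auto intro: smooth_add\<close>)
qed

lemma test_cmult: "\<phi> \<in> test_functions \<Omega> \<Longrightarrow> (\<lambda>x. c * \<phi> x) \<in> test_functions \<Omega>"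
  using test_mult_right[OF _ smooth_const] .

lemma test_diff:
  assumes "\<phi> \<in> test_functions \<Omega>" "\<psi> \<in> test_functions \<Omega>"
  shows "(\<lambda>x. \<phi> x - \<psi> x) \<in> test_functions \<Omega>"
  using test_add[OF assms(1) test_cmult[OF assms(2), of "-1"]] by simp

lemma partial_mult:
  assumes "smooth f" "smooth g"
  shows "partial i (\<lambda>x. f x * g x) x = f x * partial i g x + partial i f x * g x"
  by (rule partial_eq[OF has_derivative_mult[OF smooth_has_derivative smooth_has_derivative]]) fact+

lemma grad_add:
  assumes "smooth f" "smooth g" shows "grad (\<lambda>x. f x + g x) x = grad f x + grad g x"
  by (rule grad_eqI, rule has_derivative_eq_rhs,
      rule has_derivative_add[OF smooth_has_derivative_grad smooth_has_derivative_grad])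
     (use assms in \<open>auto simp: inner_add_right\<close>)

lemma grad_cmult:
  assumes "smooth f" shows "grad (\<lambda>x. c * f x) x = c *\<^sub>R grad f x"
  by (rule grad_eqI, rule has_derivative_eq_rhs,
      rule has_derivative_mult_right[OF smooth_has_derivative_grad])
     (use assms in auto)

lemma grad_diff:
  assumes "smooth f" "smooth g" shows "grad (\<lambda>x. f x - g x) x = grad f x - grad g x"
  by (rule grad_eqI, rule has_derivative_eq_rhs,
      rule has_derivative_diff[OF smooth_has_derivative_grad smooth_has_derivative_grad])
     (use assms in \<open>auto simp: inner_diff_right\<close>)

lemma integrable_compact_support:
  fixes f :: "'a::euclidean_space \<Rightarrow> 'b::{banach, second_countable_topology}"
  assumes "continuous_on UNIV f" "compact K" "\<And>x. x \<notin> K \<Longrightarrow> f x = 0"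
  shows "integrable lborel f"
proof -
  have "integrable lborel (\<lambda>x. indicator K x *\<^sub>R f x)"
    using assms by (intro borel_integrable_compact) (auto intro: continuous_on_subset)
  then show ?thesis
    by (rule Bochner_Integration.integrable_cong[OF refl, THEN iffD1, rotated])
       (use assms(3) in \<open>auto split: split_indicator\<close>)
qed

lemma bounded_compact_support:
  fixes f :: "'a::euclidean_space \<Rightarrow> 'b::real_normed_vector"
  assumes "continuous_on UNIV f" "compact K" "\<And>x. x \<notin> K \<Longrightarrow> f x = 0"
  obtains B where "0 \<le> B" "\<And>x. norm (f x) \<le> B"
proof -
  have "compact (f ` K)"
    using assms by (auto intro: compact_continuous_image continuous_on_subset)
  then obtain B where B: "\<And>x. x \<in> K \<Longrightarrow> norm (f x) \<le> B"
    by (force dest!: compact_imp_bounded simp: bounded_iff)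
  show thesis
  proof (rule that[of "\<bar>B\<bar>"])
    show "norm (f x) \<le> \<bar>B\<bar>" for x
      by (cases "x \<in> K") (use B[of x] assms(3)[of x] in auto)
  qed simp
qed

lemma compact_subset_cball:
  fixes K :: "'a::real_normed_vector set"
  assumes "compact K" obtains r where "0 < r" "K \<subseteq> cball 0 r"
  using bounded_subset_ballD[OF compact_imp_bounded[OF assms], of 0] ball_subset_cball by blast

lemma uniformly_continuous_compact_support:
  fixes f :: "'a::euclidean_space \<Rightarrow> 'b::real_normed_vector"
  assumes "continuous_on UNIV f" "compact K" "\<And>x. x \<notin> K \<Longrightarrow> f x = 0"
  shows "uniformly_continuous_on UNIV f"
proof -
  obtain r where r: "0 < r" "K \<subseteq> cball 0 r"
    using compact_subset_cball[OF assms(2)] by metis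
  have uc: "uniformly_continuous_on (cball 0 (r + 2)) f"
    using assms by (intro compact_uniformly_continuous) (auto intro: continuous_on_subset)
  show ?thesis
    unfolding uniformly_continuous_on_def
  proof (intro allI impI)
    fix e :: real assume "e > 0"
    then obtain d where d: "d > 0"
      "\<And>x y. x \<in> cball 0 (r + 2) \<Longrightarrow> y \<in> cball 0 (r + 2) \<Longrightarrow> dist y x < d \<Longrightarrow> dist (f y) (f x) < e"
      using uc unfolding uniformly_continuous_on_def by meson
    have "dist (f y) (f x) < e" if "dist y x < min d 1" for x y
    proof (cases "x \<in> cball 0 (r + 2) \<and> y \<in> cball 0 (r + 2)")
      case True then show ?thesis using d that by auto
    next
      case False
      have "norm x \<le> norm y + 1" "norm y \<le> norm x + 1"
        using that norm_triangle_ineq2[of x y] norm_triangle_ineq2[of y x]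
        by (auto simp: dist_norm norm_minus_commute)
      then have "x \<notin> K" "y \<notin> K" using False r by auto
      then show ?thesis using assms(3) \<open>e > 0\<close> by simp
    qed
    then show "\<exists>d>0. \<forall>x\<in>UNIV. \<forall>x'\<in>UNIV. dist x' x < d \<longrightarrow> dist (f x') (f x) < e"
      using \<open>d > 0\<close> by (intro exI[of _ "min d 1"]) auto
  qed
qed

lemma test_bounded:
  assumes "\<phi> \<in> test_functions \<Omega>"
  obtains B where "0 \<le> B" "\<And>x. \<bar>\<phi> x\<bar> \<le> B"
  using assms by (rule test_functionsE) (metis bounded_compact_support smooth_continuous real_norm_def)

lemma grad_bounded:
  assumes "\<phi> \<in> test_functions \<Omega>"
  obtains B where "0 \<le> B" "\<And>x. norm (grad \<phi> x) \<le> B"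
  using assms by (rule test_functionsE) (metis bounded_compact_support continuous_on_grad)

lemma test_integrable: "\<phi> \<in> test_functions \<Omega> \<Longrightarrow> integrable lborel \<phi>"
  by (erule test_functionsE) (auto intro: integrable_compact_support smooth_continuous)

lemma test_integrable_squares:
  assumes "\<phi> \<in> test_functions \<Omega>"
  shows "integrable lborel (\<lambda>x. (\<phi> x)\<^sup>2)" "integrable lborel (\<lambda>x. (norm (grad \<phi> x))\<^sup>2)"
proof -
  obtain K where K: "smooth \<phi>" "compact K" "\<And>x. x \<notin> K \<Longrightarrow> \<phi> x = 0" "\<And>x. x \<notin> K \<Longrightarrow> grad \<phi> x = 0"
    using test_functionsE[OF assms] by metis
  show "integrable lborel (\<lambda>x. (\<phi> x)\<^sup>2)" "integrable lborel (\<lambda>x. (norm (grad \<phi> x))\<^sup>2)"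
    by (rule integrable_compact_support[OF continuous_on_power[OF smooth_continuous[OF K(1)]] K(2)],
        simp add: K(3),
        rule integrable_compact_support[OF continuous_on_power[OF continuous_on_norm[OF continuous_on_grad[OF K(1)]]] K(2)],
        simp add: K(4))
qed

lemma grad_measurable: "smooth f \<Longrightarrow> grad f \<in> borel_measurable borel"
  by (intro borel_measurable_continuous_onI continuous_on_grad)

lemma lipschitz_if_grad_bounded:
  assumes "smooth f" "convex S" "\<And>x. x \<in> S \<Longrightarrow> norm (grad f x) \<le> B" "x \<in> S" "y \<in> S"
  shows "\<bar>f x - f y\<bar> \<le> B * norm (x - y)"
proof -
  have "norm (f x - f y) \<le> B * norm (x - y)"
  proof (rule differentiable_bound[OF assms(2) _ _ assms(4,5)])
    show "(f has_derivative (\<lambda>h. h \<bullet> grad f z)) (at z within S)" for z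
      using smooth_has_derivative_grad[OF assms(1)] has_derivative_at_withinI by blast
    show "onorm (\<lambda>h. h \<bullet> grad f z) \<le> B" if "z \<in> S" for z
    proof (rule onorm_le)
      fix h
      have "norm (h \<bullet> grad f z) \<le> norm h * norm (grad f z)" by (simp add: Cauchy_Schwarz_ineq2)
      also have "\<dots> \<le> norm h * B" using assms(3)[OF that] by (intro mult_left_mono) auto
      finally show "norm (h \<bullet> grad f z) \<le> B * norm h" by (simp add: mult.commute)
    qed
  qed
  then show ?thesis by simp
qed

section \<open>Translations and difference quotients\<close>

lemma integral_lborel_shift:
  fixes f :: "'a::euclidean_space \<Rightarrow> 'b::{banach, second_countable_topology}"
  shows "(\<integral>x. f (c + x) \<partial>lborel) = (\<integral>x. f x \<partial>lborel)"
proof (cases "f \<in> borel_measurable borel")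
  case True
  then show ?thesis
    by (subst (2) lborel_distr_plus[of c, symmetric]) (auto simp: integral_distr)
next
  case False
  have "(\<lambda>x. f (c + x)) \<notin> borel_measurable borel"
  proof
    assume "(\<lambda>x. f (c + x)) \<in> borel_measurable borel"
    then have "(\<lambda>x. f (c + (x - c))) \<in> borel_measurable borel"
      by (rule measurable_compose[rotated]) simp
    then show False using False by simp
  qed
  then show ?thesis
    using False by (simp add: not_integrable_integral_eq borel_measurable_integrable integrable_iff_bounded)
qed

lemma nn_integral_lborel_shift:
  assumes [measurable]: "f \<in> borel_measurable borel"
  shows "(\<integral>\<^sup>+x. f (c + x) \<partial>lborel) = (\<integral>\<^sup>+x. f x \<partial>(lborel :: 'a::euclidean_space measure))"
  by (subst (2) lborel_distr_plus[of c, symmetric]) (auto simp: nn_integral_distr)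

lemma integrable_lborel_shift:
  fixes f :: "'a::euclidean_space \<Rightarrow> 'b::{banach, second_countable_topology}"
  assumes "integrable lborel f"
  shows "integrable lborel (\<lambda>x. f (c + x))"
proof -
  have "integrable (distr lborel borel ((+) c)) f" using assms by (simp add: lborel_distr_plus)
  then show ?thesis by (subst (asm) integrable_distr_eq) (use assms in auto)
qed

lemma test_shift: "\<phi> \<in> test_functions UNIV \<Longrightarrow> integrable lborel (\<lambda>x. \<phi> (x + c))"
  using integrable_lborel_shift[OF test_integrable, of \<phi> UNIV c] by (simp add: add.commute)

definition diff_quot :: "('a::euclidean_space \<Rightarrow> real) \<Rightarrow> 'a \<Rightarrow> nat \<Rightarrow> 'a \<Rightarrow> real"
  where "diff_quot \<phi> z n x = real (Suc n) * (\<phi> (x + z /\<^sub>R real (Suc n)) - \<phi> x)"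

lemma diff_quot_tendsto:
  assumes "smooth \<phi>" shows "(\<lambda>n. diff_quot \<phi> z n x) \<longlonglongrightarrow> z \<bullet> grad \<phi> x"
proof -
  have "((\<lambda>t. \<phi> (x + t *\<^sub>R z)) has_derivative (\<lambda>t. (t *\<^sub>R z) \<bullet> grad \<phi> (x + 0 *\<^sub>R z))) (at 0)"
    by (rule has_derivative_compose[OF _ smooth_has_derivative_grad[OF assms]])
       (auto intro!: derivative_eq_intros)
  then have "((\<lambda>t. \<phi> (x + t *\<^sub>R z)) has_real_derivative (z \<bullet> grad \<phi> x)) (at 0)"
    by (auto simp: has_field_derivative_def mult.commute elim!: has_derivative_eq_rhs)
  then have "((\<lambda>h. (\<phi> (x + h *\<^sub>R z) - \<phi> x) / h) \<longlongrightarrow> z \<bullet> grad \<phi> x) (at 0)"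
    by (simp add: DERIV_def)
  moreover have "filterlim (\<lambda>n. inverse (real (Suc n))) (at 0) sequentially"
    using LIMSEQ_inverse_real_of_nat by (auto simp: filterlim_at simp del: of_nat_Suc)
  ultimately have "(\<lambda>n. (\<phi> (x + inverse (real (Suc n)) *\<^sub>R z) - \<phi> x) / inverse (real (Suc n))) \<longlonglongrightarrow> z \<bullet> grad \<phi> x"
    by (rule filterlim_compose)
  then show ?thesis by (simp add: diff_quot_def[abs_def] field_simps del: of_nat_Suc)
qed

text \<open>
  The bound is uniform in the step, which allows passing to the limit under the integral; increments
  of at most \<open>norm z\<close> enlarge the support by a bounded amount only.
\<close>

lemma diff_quot_dominated:
  assumes "\<phi> \<in> test_functions UNIV"
  obtains B r where "0 \<le> B" "\<And>n x. \<bar>diff_quot \<phi> z n x\<bar> \<le> B * indicator (cball 0 r) x"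
proof -
  obtain K where K: "smooth \<phi>" "compact K" "\<And>x. x \<notin> K \<Longrightarrow> \<phi> x = 0"
    using test_functionsE[OF assms] by metis
  obtain r where r: "0 < r" "K \<subseteq> cball 0 r"
    using compact_subset_cball[OF K(2)] by metis
  obtain B where B: "0 \<le> B" "\<And>x. norm (grad \<phi> x) \<le> B" using grad_bounded[OF assms] by blast
  have "\<bar>diff_quot \<phi> z n x\<bar> \<le> B * norm z * indicator (cball 0 (r + norm z)) x" for n x
  proof (cases "x \<in> cball 0 (r + norm z)")
    case True
    have "\<bar>\<phi> (x + z /\<^sub>R real (Suc n)) - \<phi> x\<bar> \<le> B * norm (z /\<^sub>R real (Suc n))"
      using lipschitz_if_grad_bounded[OF K(1) convex_UNIV, of B "x + z /\<^sub>R real (Suc n)" x] B by simp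
    then have "real (Suc n) * \<bar>\<phi> (x + z /\<^sub>R real (Suc n)) - \<phi> x\<bar> \<le> real (Suc n) * (B * norm (z /\<^sub>R real (Suc n)))"
      by (rule mult_left_mono) simp
    also have "\<dots> = B * norm z" by (simp del: of_nat_Suc)
    finally show ?thesis using True by (simp add: diff_quot_def abs_mult del: of_nat_Suc)
  next
    case False
    have "norm (z /\<^sub>R real (Suc n)) \<le> norm z"
      by (auto simp: field_simps intro!: mult_right_mono)
    then have "norm (x + z /\<^sub>R real (Suc n)) > r"
      using False norm_triangle_ineq2[of x "- (z /\<^sub>R real (Suc n))"] by auto
    moreover have "norm x > r" using False norm_ge_zero[of z] by (simp del: norm_ge_zero)
    ultimately have "x \<notin> K" "x + z /\<^sub>R real (Suc n) \<notin> K" using r by auto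
    then show ?thesis using K False by (simp add: diff_quot_def)
  qed
  then show thesis using that[of "B * norm z" "r + norm z"] B by simp
qed

lemma integrable_indicator_cball: "integrable lborel (indicator (cball 0 r) :: 'a::euclidean_space \<Rightarrow> real)"
  by (intro integrable_real_indicator)
     (use emeasure_bounded_finite[OF bounded_cball] in auto)

text \<open>
  By translation invariance the integral of every difference quotient is zero.
\<close>

lemma integral_directional_zero:
  assumes "\<phi> \<in> test_functions UNIV"
  shows "(\<integral>x. z \<bullet> grad \<phi> x \<partial>lborel) = 0"
proof -
  obtain B r where B: "\<And>n x. \<bar>diff_quot \<phi> z n x\<bar> \<le> B * indicator (cball 0 r) x"
    using diff_quot_dominated[OF assms] by metis
  have sm: "smooth \<phi>" using test_smooth assms by blast
  note [measurable] = smooth_measurable[OF sm] grad_measurable[OF sm]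
  have meas: "diff_quot \<phi> z n \<in> borel_measurable borel" for n
    unfolding diff_quot_def[abs_def] by measurable
  have "(\<lambda>n. \<integral>x. diff_quot \<phi> z n x \<partial>lborel) \<longlonglongrightarrow> (\<integral>x. z \<bullet> grad \<phi> x \<partial>lborel)"
    by (rule integral_dominated_convergence[where w = "\<lambda>x. B * indicator (cball 0 r) x"])
       (use B meas in \<open>auto intro!: integrable_indicator_cball diff_quot_tendsto[OF sm]\<close>)
  moreover have "(\<integral>x. diff_quot \<phi> z n x \<partial>lborel) = 0" for n
    unfolding diff_quot_def
    using Bochner_Integration.integral_diff[OF test_shift[OF assms] test_integrable[OF assms], of "z /\<^sub>R real (Suc n)"]
      integral_lborel_shift[of \<phi> "z /\<^sub>R real (Suc n)"]
    by (simp add: add.commute)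
  ultimately show ?thesis by (simp add: LIMSEQ_const_iff)
qed

lemma integral_partial_zero:
  assumes "\<phi> \<in> test_functions UNIV" "i \<in> Basis"
  shows "(\<integral>x. partial i \<phi> x \<partial>lborel) = 0"
  using integral_directional_zero[OF assms(1), of i] grad_inner_Basis[OF assms(2), of \<phi>]
  by (simp add: inner_commute)

text \<open>
  The derivative of the product \<open>f \<phi>\<close>, again a test function, has integral zero.
\<close>

lemma integration_by_parts:
  assumes "\<phi> \<in> test_functions UNIV" "smooth f" "i \<in> Basis"
  shows "(\<integral>x. f x * partial i \<phi> x \<partial>lborel) = - (\<integral>x. partial i f x * \<phi> x \<partial>lborel)"
proof -
  have "(\<integral>x. f x * partial i \<phi> x + partial i f x * \<phi> x \<partial>lborel) = 0"
    using integral_partial_zero[OF test_mult_right[OF assms(1,2)] assms(3)]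
    by (simp add: partial_mult[OF assms(2) test_smooth[OF assms(1)]])
  moreover have "integrable lborel (\<lambda>x. f x * partial i \<phi> x)" "integrable lborel (\<lambda>x. partial i f x * \<phi> x)"
    using assms by (intro test_integrable[of _ UNIV] test_mult_right test_partial smooth_partial; simp)+
  ultimately show ?thesis by simp
qed

text \<open>
  The increment over \<open>z\<close> is the sum of \<open>n\<close> increments over \<open>z / n\<close>, whose square is at most
  \<open>n\<close> times the sum of the squares; after integration all summands agree, and \<open>n \<rightarrow> \<infinity>\<close>
  turns the difference quotient into the derivative.
\<close>

lemma integral_square_increment_le:
  assumes "\<phi> \<in> test_functions UNIV"
  shows "(\<integral>x. (\<phi> (x + z) - \<phi> x)\<^sup>2 \<partial>lborel) \<le> (norm z)\<^sup>2 * (\<integral>x. (norm (grad \<phi> x))\<^sup>2 \<partial>lborel)"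
proof -
  obtain B r where B: "0 \<le> B" "\<And>n x. \<bar>diff_quot \<phi> z n x\<bar> \<le> B * indicator (cball 0 r) x"
    using diff_quot_dominated[OF assms] by metis
  have sm: "smooth \<phi>" using test_smooth assms by blast
  note [measurable] = smooth_measurable[OF sm] grad_measurable[OF sm]
  have B2: "(diff_quot \<phi> z n x)\<^sup>2 \<le> B\<^sup>2 * indicator (cball 0 r) x" for n x
    using power_mono[OF B(2)[of n x], of 2] by (auto simp: power_mult_distrib split: split_indicator)
  have meas: "diff_quot \<phi> z n \<in> borel_measurable borel" for n
    unfolding diff_quot_def[abs_def] by measurable
  have int: "integrable lborel (\<lambda>x. (diff_quot \<phi> z n x)\<^sup>2)" for n
    by (rule Bochner_Integration.integrable_bound[OF integrable_mult_right[OF integrable_indicator_cball[of r], of "B\<^sup>2"]])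
       (use B2[of n] meas[of n] in \<open>auto\<close>)
  have lim: "(\<lambda>n. \<integral>x. (diff_quot \<phi> z n x)\<^sup>2 \<partial>lborel) \<longlonglongrightarrow> (\<integral>x. (z \<bullet> grad \<phi> x)\<^sup>2 \<partial>lborel)"
    by (rule integral_dominated_convergence[where w = "\<lambda>x. B\<^sup>2 * indicator (cball 0 r) x"])
       (use meas in \<open>auto intro!: integrable_indicator_cball tendsto_power diff_quot_tendsto[OF sm] B2\<close>)
  have le: "(\<integral>x. (\<phi> (x + z) - \<phi> x)\<^sup>2 \<partial>lborel) \<le> (\<integral>x. (diff_quot \<phi> z n x)\<^sup>2 \<partial>lborel)" for n
  proof -
    define N where "N = real (Suc n)"
    have N: "N > 0" by (simp add: N_def)
    have pw: "(\<phi> (x + z) - \<phi> x)\<^sup>2 \<le> (\<Sum>j<Suc n. (diff_quot \<phi> z n ((j / N) *\<^sub>R z + x))\<^sup>2) / N" for x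
    proof -
      have "\<phi> (x + z) - \<phi> x = (\<Sum>j<Suc n. \<phi> (x + (real (Suc j) / N) *\<^sub>R z) - \<phi> (x + (real j / N) *\<^sub>R z))"
        by (subst sum_lessThan_telescope) (simp add: N_def)
      also have "\<dots> = (\<Sum>j<Suc n. diff_quot \<phi> z n ((j / N) *\<^sub>R z + x)) / N"
        unfolding sum_divide_distrib
      proof (intro sum.cong refl)
        fix j
        have eq: "x + (real (Suc j) / N) *\<^sub>R z = (j / N) *\<^sub>R z + x + z /\<^sub>R N"
          by (simp add: add_divide_distrib scaleR_left_distrib divide_inverse distrib_right)
        show "\<phi> (x + (real (Suc j) / N) *\<^sub>R z) - \<phi> (x + (real j / N) *\<^sub>R z) =
            diff_quot \<phi> z n ((j / N) *\<^sub>R z + x) / N"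
          unfolding diff_quot_def N_def[symmetric] eq using N
          by (simp only: nonzero_mult_div_cancel_left less_imp_neq[symmetric] not_False_eq_True) (simp add: add.commute)
      qed
      finally have "(\<phi> (x + z) - \<phi> x)\<^sup>2 = (\<Sum>j<Suc n. diff_quot \<phi> z n ((j / N) *\<^sub>R z + x))\<^sup>2 / N\<^sup>2"
        by (simp add: power_divide)
      also have "\<dots> \<le> (\<Sum>j<Suc n. (diff_quot \<phi> z n ((j / N) *\<^sub>R z + x))\<^sup>2) * real (card {..<Suc n}) / N\<^sup>2"
        by (intro divide_right_mono sum_squared_le_sum_of_squares) auto
      also have "\<dots> = (\<Sum>j<Suc n. (diff_quot \<phi> z n ((j / N) *\<^sub>R z + x))\<^sup>2) / N"
        using N by (simp add: N_def[symmetric] power2_eq_square del: of_nat_Suc)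
      finally show ?thesis .
    qed
    have "(\<integral>x. (\<phi> (x + z) - \<phi> x)\<^sup>2 \<partial>lborel)
        \<le> (\<integral>x. (\<Sum>j<Suc n. (diff_quot \<phi> z n ((j / N) *\<^sub>R z + x))\<^sup>2) / N \<partial>lborel)"
    proof (rule integral_mono')
      show "integrable lborel (\<lambda>x. (\<Sum>j<Suc n. (diff_quot \<phi> z n ((j / N) *\<^sub>R z + x))\<^sup>2) / N)"
        by (intro integrable_divide Bochner_Integration.integrable_sum integrable_lborel_shift[OF int])
    qed (use pw order_trans[OF zero_le_power2 pw] in auto)
    also have "\<dots> = (\<integral>x. (diff_quot \<phi> z n x)\<^sup>2 \<partial>lborel)"
      using N by (subst integral_divide_zero, subst Bochner_Integration.integral_sum)
        (auto intro!: integrable_lborel_shift[OF int] simp: integral_lborel_shift[where f = "\<lambda>x. (diff_quot \<phi> z n x)\<^sup>2"] N_def)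
    finally show ?thesis .
  qed
  have "(\<integral>x. (\<phi> (x + z) - \<phi> x)\<^sup>2 \<partial>lborel) \<le> (\<integral>x. (z \<bullet> grad \<phi> x)\<^sup>2 \<partial>lborel)"
    by (rule LIMSEQ_le_const[OF lim]) (use le in auto)
  also have "\<dots> \<le> (\<integral>x. (norm z)\<^sup>2 * (norm (grad \<phi> x))\<^sup>2 \<partial>lborel)"
    by (rule integral_mono')
       (use test_integrable_squares[OF assms] in \<open>auto simp: power2_norm_eq_inner Cauchy_Schwarz_ineq\<close>)
  finally show ?thesis by simp
qed

text \<open>Integrating \<open>\<partial>\<^sub>i (x\<^sub>i \<phi>\<^sup>2)\<close> bounds the integral of \<open>\<phi>\<^sup>2\<close> by that of \<open>2 \<bar>x\<^sub>i \<phi> \<partial>\<^sub>i \<phi>\<bar>\<close>.\<close>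

lemma poincare_inequality:
  fixes \<phi> :: "'a::euclidean_space \<Rightarrow> real"
  assumes \<phi>: "\<phi> \<in> test_functions \<Omega>" and r: "\<Omega> \<subseteq> cball 0 r"
  shows "(\<integral>x. (\<phi> x)\<^sup>2 \<partial>lborel) \<le> 4 * r\<^sup>2 * (\<integral>x. (norm (grad \<phi> x))\<^sup>2 \<partial>lborel)"
proof -
  obtain i :: 'a where i: "i \<in> Basis" using nonempty_Basis by blast
  have t: "\<phi> \<in> test_functions UNIV" using test_functions_mono[OF \<phi>] by simp
  have sm: "smooth \<phi>" using test_smooth t by blast
  have si: "smooth (\<lambda>x. x \<bullet> i)" by (intro smooth_bounded_linear bounded_linear_inner_left)
  have ti: "(\<lambda>x. \<phi> x * \<phi> x) \<in> test_functions UNIV" using test_mult_right[OF t sm] .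
  have pi: "partial i (\<lambda>x. x \<bullet> i) x = 1" for x
    using i by (subst partial_eq[of _ "\<lambda>h. h \<bullet> i"]) (auto intro!: derivative_eq_intros simp: inner_same_Basis)
  have eq: "(\<integral>x. (\<phi> x)\<^sup>2 \<partial>lborel) = - (\<integral>x. (x \<bullet> i) * (2 * \<phi> x * partial i \<phi> x) \<partial>lborel)"
    using integration_by_parts[OF ti si i] by (simp add: partial_mult[OF sm sm] pi power2_eq_square algebra_simps)
  also have "\<dots> = (\<integral>x. - ((x \<bullet> i) * (2 * \<phi> x * partial i \<phi> x)) \<partial>lborel)" by simp
  also have "\<dots> \<le> (\<integral>x. (\<phi> x)\<^sup>2 / 2 + 2 * r\<^sup>2 * (norm (grad \<phi> x))\<^sup>2 \<partial>lborel)"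
  proof (rule integral_mono')
    show "integrable lborel (\<lambda>x. (\<phi> x)\<^sup>2 / 2 + 2 * r\<^sup>2 * (norm (grad \<phi> x))\<^sup>2)"
      using test_integrable_squares[OF t] by auto
    fix x
    show "- ((x \<bullet> i) * (2 * \<phi> x * partial i \<phi> x)) \<le> (\<phi> x)\<^sup>2 / 2 + 2 * r\<^sup>2 * (norm (grad \<phi> x))\<^sup>2"
    proof (cases "x \<in> \<Omega>")
      case True
      have "\<bar>(x \<bullet> i) * partial i \<phi> x\<bar> \<le> r * norm (grad \<phi> x)"
        unfolding abs_mult
        using True r Basis_le_norm[OF i, of x] Basis_le_norm[OF i, of "grad \<phi> x"] grad_inner_Basis[OF i, of \<phi> x]
        by (intro mult_mono) (auto simp: subset_iff intro: order_trans)
      then have "((x \<bullet> i) * partial i \<phi> x)\<^sup>2 \<le> (r * norm (grad \<phi> x))\<^sup>2"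
        by (metis abs_ge_zero power2_abs power_mono)
      moreover have "0 \<le> (\<phi> x / 2 + (x \<bullet> i) * partial i \<phi> x)\<^sup>2" by simp
      ultimately show ?thesis by (simp add: power2_eq_square algebra_simps)
    next
      case False then show ?thesis by (simp add: test_outside[OF \<phi>])
    qed
  qed simp
  also have "\<dots> = (\<integral>x. (\<phi> x)\<^sup>2 \<partial>lborel) / 2 + 2 * r\<^sup>2 * (\<integral>x. (norm (grad \<phi> x))\<^sup>2 \<partial>lborel)"
    using test_integrable_squares[OF t] by simp
  finally show ?thesis by simp
qed

section \<open>Convolution with a test function\<close>

lemma integrable_mult_bounded:
  fixes f g :: "'a \<Rightarrow> real"
  assumes "integrable M g" "f \<in> borel_measurable M" "\<And>x. \<bar>f x\<bar> \<le> B"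
  shows "integrable M (\<lambda>x. g x * f x)"
proof (rule Bochner_Integration.integrable_bound[OF integrable_mult_right[OF assms(1), of B]])
  show "AE x in M. norm (g x * f x) \<le> norm (B * g x)"
  proof (intro AE_I2)
    fix x
    have "\<bar>g x\<bar> * \<bar>f x\<bar> \<le> \<bar>g x\<bar> * \<bar>B\<bar>" using assms(3)[of x] by (intro mult_left_mono) auto
    then show "norm (g x * f x) \<le> norm (B * g x)" by (simp add: abs_mult mult.commute)
  qed
qed (use assms in auto)

definition conv :: "('a::euclidean_space \<Rightarrow> real) \<Rightarrow> ('a \<Rightarrow> real) \<Rightarrow> 'a \<Rightarrow> real"
  where "conv g \<rho> x = (\<integral>y. g y * \<rho> (x - y) \<partial>lborel)"

lemma conv_integrable:
  assumes "integrable lborel g" "\<rho> \<in> test_functions UNIV"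
  shows "integrable lborel (\<lambda>y. g y * \<rho> (x - y))"
proof -
  obtain B where "\<And>x. \<bar>\<rho> x\<bar> \<le> B" using test_bounded[OF assms(2)] by blast
  moreover have [measurable]: "\<rho> \<in> borel_measurable borel" by (rule smooth_measurable[OF test_smooth[OF assms(2)]])
  ultimately show ?thesis
    by (intro integrable_mult_bounded[OF assms(1)]) auto
qed

text \<open>
  The mean value inequality for \<open>f\<close> minus its linearization at \<open>a\<close>.
\<close>

lemma linearization_error:
  assumes "smooth f" "\<And>x. norm (x - a) < d \<Longrightarrow> norm (grad f x - grad f a) \<le> e" "norm (b - a) < d"
  shows "\<bar>f b - f a - (b - a) \<bullet> grad f a\<bar> \<le> e * norm (b - a)"
proof -
  let ?v = "grad f a"
  have sl: "smooth (\<lambda>x. x \<bullet> ?v)" by (intro smooth_bounded_linear bounded_linear_inner_left)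
  have gl: "grad (\<lambda>x. x \<bullet> ?v) x = ?v" for x
    by (rule grad_eqI) (auto intro!: derivative_eq_intros)
  have "\<bar>(f b - b \<bullet> ?v) - (f a - a \<bullet> ?v)\<bar> \<le> e * norm (b - a)"
    by (rule lipschitz_if_grad_bounded[where S = "ball a d"])
       (use assms sl in \<open>auto simp: smooth_diff grad_diff gl dist_norm norm_minus_commute intro: le_less_trans[OF norm_ge_zero]\<close>)
  then show ?thesis by (simp add: inner_diff_left algebra_simps)
qed

text \<open>
  The gradient of \<open>\<rho>\<close> is uniformly continuous, so that the error of linearizing \<open>\<rho>\<close> at \<open>x - y\<close> is
  small uniformly in the integration variable \<open>y\<close>.
\<close>

lemma conv_has_derivative:
  fixes g :: "'a::euclidean_space \<Rightarrow> real"
  assumes g: "integrable lborel g" and \<rho>: "\<rho> \<in> test_functions UNIV"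
  shows "(conv g \<rho> has_derivative (\<lambda>h. h \<bullet> (\<Sum>i\<in>Basis. conv g (partial i \<rho>) x *\<^sub>R i))) (at x)"
  unfolding has_derivative_at_alt
proof (intro conjI allI impI)
  show "bounded_linear (\<lambda>h. h \<bullet> (\<Sum>i\<in>Basis. conv g (partial i \<rho>) x *\<^sub>R i))"
    by (rule bounded_linear_inner_left)
  fix e :: real assume "e > 0"
  define I where "I = (\<integral>y. \<bar>g y\<bar> \<partial>lborel)"
  have I: "I \<ge> 0" by (simp add: I_def)
  define e' where "e' = e / (1 + I)"
  have e': "e' > 0" "e' * I \<le> e" using \<open>e > 0\<close> I by (auto simp: e'_def field_simps)
  obtain K where K: "smooth \<rho>" "compact K" "\<And>x. x \<notin> K \<Longrightarrow> grad \<rho> x = 0"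
    using test_functionsE[OF \<rho>] by metis
  have "uniformly_continuous_on UNIV (grad \<rho>)"
    by (rule uniformly_continuous_compact_support[OF continuous_on_grad[OF K(1)] K(2,3)])
  then obtain d where d: "d > 0" "\<And>x y. dist y x < d \<Longrightarrow> dist (grad \<rho> y) (grad \<rho> x) < e'"
    unfolding uniformly_continuous_on_def using e'(1) by (metis UNIV_I)
  have "norm (conv g \<rho> y - conv g \<rho> x - (y - x) \<bullet> (\<Sum>i\<in>Basis. conv g (partial i \<rho>) x *\<^sub>R i)) \<le> e * norm (y - x)"
    if y: "norm (y - x) < d" for y
  proof -
    have int: "integrable lborel (\<lambda>w. g w * ((y - x) \<bullet> grad \<rho> (x - w)))"
      unfolding grad_def inner_sum_right inner_scaleR_right sum_distrib_left
      by (intro Bochner_Integration.integrable_sum)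
         (use conv_integrable[OF g test_partial[OF \<rho>]] in \<open>auto simp: mult.assoc[symmetric] intro!: integrable_mult_left\<close>)
    have eq: "(y - x) \<bullet> (\<Sum>i\<in>Basis. conv g (partial i \<rho>) x *\<^sub>R i) = (\<integral>w. g w * ((y - x) \<bullet> grad \<rho> (x - w)) \<partial>lborel)"
    proof -
      have "(\<integral>w. g w * ((y - x) \<bullet> grad \<rho> (x - w)) \<partial>lborel)
          = (\<integral>w. (\<Sum>i\<in>Basis. ((y - x) \<bullet> i) * (g w * partial i \<rho> (x - w))) \<partial>lborel)"
        by (simp add: grad_def inner_sum_right sum_distrib_left mult_ac)
      also have "\<dots> = (\<Sum>i\<in>Basis. ((y - x) \<bullet> i) * conv g (partial i \<rho>) x)"
        by (subst Bochner_Integration.integral_sum)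
           (use conv_integrable[OF g test_partial[OF \<rho>]] in \<open>auto simp: conv_def\<close>)
      finally show ?thesis by (simp add: inner_sum_right mult.commute)
    qed
    have "conv g \<rho> y - conv g \<rho> x - (y - x) \<bullet> (\<Sum>i\<in>Basis. conv g (partial i \<rho>) x *\<^sub>R i)
        = (\<integral>w. g w * (\<rho> (y - w) - \<rho> (x - w) - (y - x) \<bullet> grad \<rho> (x - w)) \<partial>lborel)"
      unfolding eq unfolding conv_def right_diff_distrib using conv_integrable[OF g \<rho>] int by simp
    also have "norm \<dots> \<le> (\<integral>w. \<bar>g w\<bar> * (e' * norm (y - x)) \<partial>lborel)"
    proof (rule order_trans[OF integral_norm_bound], rule integral_mono')
      show "integrable lborel (\<lambda>w. \<bar>g w\<bar> * (e' * norm (y - x)))" using g by auto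
      fix w
      have "\<bar>\<rho> (y - w) - \<rho> (x - w) - ((y - w) - (x - w)) \<bullet> grad \<rho> (x - w)\<bar> \<le> e' * norm ((y - w) - (x - w))"
      proof (rule linearization_error[OF K(1)])
        show "norm (grad \<rho> z - grad \<rho> (x - w)) \<le> e'" if "norm (z - (x - w)) < d" for z
          using d(2)[of z "x - w"] that by (simp add: dist_norm)
        show "norm (y - w - (x - w)) < d" using y by simp
      qed
      then show "norm (g w * (\<rho> (y - w) - \<rho> (x - w) - (y - x) \<bullet> grad \<rho> (x - w))) \<le> \<bar>g w\<bar> * (e' * norm (y - x))"
        by (simp add: abs_mult mult_left_mono)
    qed (use e' in auto)
    also have "\<dots> = (e' * I) * norm (y - x)" by (simp add: I_def)
    also have "\<dots> \<le> e * norm (y - x)" using e' by (intro mult_right_mono) auto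
    finally show ?thesis .
  qed
  then show "\<exists>d>0. \<forall>y. norm (y - x) < d \<longrightarrow>
      norm (conv g \<rho> y - conv g \<rho> x - (y - x) \<bullet> (\<Sum>i\<in>Basis. conv g (partial i \<rho>) x *\<^sub>R i)) \<le> e * norm (y - x)"
    using d(1) by blast
qed

lemma partial_conv:
  assumes "integrable lborel g" "\<rho> \<in> test_functions UNIV" "i \<in> Basis"
  shows "partial i (conv g \<rho>) x = conv g (partial i \<rho>) x"
proof -
  have "partial i (conv g \<rho>) x = i \<bullet> (\<Sum>j\<in>Basis. conv g (partial j \<rho>) x *\<^sub>R j)"
    by (rule partial_eq[OF conv_has_derivative[OF assms(1,2)]])
  then show ?thesis using assms(3)
    by (simp add: inner_sum_right inner_Basis if_distrib sum.delta' cong: if_cong)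
qed

lemma smooth_conv:
  assumes "integrable lborel g" "\<rho> \<in> test_functions UNIV"
  shows "smooth (conv g \<rho>)"
proof -
  have "Ck k (conv g \<rho>)" for k
    using assms(2)
  proof (induction k arbitrary: \<rho>)
    case 0
    have "continuous (at x) (conv g \<rho>)" for x
      by (rule has_derivative_continuous[OF conv_has_derivative[OF assms(1) 0]])
    then show ?case by (simp add: continuous_on_eq_continuous_at)
  next
    case (Suc k)
    have "conv g \<rho> differentiable (at x)" for x
      using conv_has_derivative[OF assms(1) Suc.prems] by (auto simp: differentiable_def)
    moreover have "partial i (conv g \<rho>) = conv g (partial i \<rho>)" if "i \<in> Basis" for i
      using partial_conv[OF assms(1) Suc.prems that] by (rule ext)
    ultimately show ?case using Suc.IH[OF test_partial[OF Suc.prems]] by simp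
  qed
  then show ?thesis by (simp add: smooth_def)
qed

section \<open>Mollifiers\<close>

text \<open>
  Turns almost everywhere identities between continuous functions into identities.
\<close>

lemma open_AE_ex:
  fixes S :: "'a::euclidean_space set"
  assumes "open S" "S \<noteq> {}" "AE x in lborel. x \<in> S \<longrightarrow> P x"
  shows "\<exists>x\<in>S. P x"
proof (rule ccontr)
  assume "\<not> (\<exists>x\<in>S. P x)"
  then have "AE x in lborel. x \<notin> S" using assms(3) by (auto elim: eventually_mono)
  then have "S \<in> null_sets lborel" using assms(1)
    by (subst (asm) AE_iff_null_sets[symmetric]) auto
  then have "negligible S" using negligible_iff_null_sets null_sets_completionI by blast
  then show False using open_not_negligible assms by blast
qed

definition bump :: "real \<Rightarrow> 'a::euclidean_space \<Rightarrow> real"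
  where "bump \<delta> x = flat_exp 0 (1 - (x \<bullet> x) / \<delta>\<^sup>2)"

definition moll :: "real \<Rightarrow> 'a::euclidean_space \<Rightarrow> real"
  where "moll \<delta> x = inverse (\<integral>y. bump \<delta> (y::'a) \<partial>lborel) * bump \<delta> x"

lemma bump_zero: "\<delta> > 0 \<Longrightarrow> norm x \<ge> \<delta> \<Longrightarrow> bump \<delta> x = 0"
  using power_mono[of \<delta> "norm x" 2] by (simp add: bump_def flat_exp_def power2_norm_eq_inner field_simps)

lemma bump_pos: "\<delta> > 0 \<Longrightarrow> norm x < \<delta> \<Longrightarrow> bump \<delta> x > 0"
  using power_strict_mono[of "norm x" \<delta> 2] by (simp add: bump_def flat_exp_def power2_norm_eq_inner field_simps)

lemma bump_test: assumes "\<delta> > 0" shows "bump \<delta> \<in> test_functions UNIV"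
proof (rule test_functionsI[of _ "cball 0 \<delta>"])
  have "smooth (\<lambda>x. flat_exp 0 (1 - (inverse (\<delta>\<^sup>2)) * (x \<bullet> x)))"
    by (intro smooth_compose[OF smooth_flat_exp] smooth_diff smooth_const smooth_cmult smooth_inner_self)
  then show "smooth (bump \<delta>)" by (simp add: bump_def[abs_def] divide_inverse mult.commute)
  show "bump \<delta> x = 0" if "x \<notin> cball 0 \<delta>" for x
    using that by (intro bump_zero assms) simp
qed auto

lemma bump_integral_pos:
  assumes "\<delta> > 0" shows "(\<integral>y. bump \<delta> (y::'a::euclidean_space) \<partial>lborel) > 0"
proof -
  have nn: "bump \<delta> (y::'a) \<ge> 0" for y by (simp add: bump_def flat_exp_0_bounds)
  have "(\<integral>y. bump \<delta> (y::'a) \<partial>lborel) \<noteq> 0"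
  proof
    assume "(\<integral>y. bump \<delta> (y::'a) \<partial>lborel) = 0"
    then have "AE y in lborel. bump \<delta> (y::'a) = 0"
      by (subst (asm) integral_nonneg_eq_0_iff_AE) (use test_integrable[OF bump_test[OF assms]] nn in auto)
    then have "\<exists>y\<in>ball (0::'a) \<delta>. bump \<delta> y = 0"
      using assms by (intro open_AE_ex) auto
    then show False using bump_pos[OF assms] by force
  qed
  moreover have "(\<integral>y. bump \<delta> (y::'a) \<partial>lborel) \<ge> 0" using nn by simp
  ultimately show ?thesis by linarith
qed

context
  fixes \<delta> :: real assumes \<delta>: "\<delta> > 0"
begin

lemma moll_test: "moll \<delta> \<in> test_functions UNIV"
  unfolding moll_def[abs_def] by (rule test_cmult[OF bump_test[OF \<delta>]])

lemma moll_nonneg: "moll \<delta> x \<ge> 0"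
  using bump_integral_pos[OF \<delta>] by (auto simp: moll_def bump_def flat_exp_0_bounds less_imp_le intro!: mult_nonneg_nonneg)

lemma moll_minus: "moll \<delta> (- x) = moll \<delta> x" by (simp add: moll_def bump_def)

lemma moll_zero: "norm x \<ge> \<delta> \<Longrightarrow> moll \<delta> x = 0" by (simp add: moll_def bump_zero[OF \<delta>])

lemma moll_integral: "(\<integral>x. moll \<delta> (x::'a::euclidean_space) \<partial>lborel) = 1"
  using bump_integral_pos[OF \<delta>, where 'a = 'a] by (simp add: moll_def)

lemma moll_integrable: "integrable lborel (moll \<delta>)" by (rule test_integrable[OF moll_test])

lemma moll_measurable [measurable]: "moll \<delta> \<in> borel_measurable borel"
  by (rule smooth_measurable[OF test_smooth[OF moll_test]])

lemma moll_nn_integral: "(\<integral>\<^sup>+x. ennreal (moll \<delta> (x::'a::euclidean_space)) \<partial>lborel) = 1"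
  using moll_integrable[where 'a = 'a] moll_integral[where 'a = 'a]
  by (simp add: nn_integral_eq_integral moll_nonneg)

lemma conv_moll_shift: "conv g (moll \<delta>) x = (\<integral>z. g (x + z) * moll \<delta> z \<partial>lborel)"
  unfolding conv_def
  by (subst integral_lborel_shift[of _ x, symmetric]) (simp add: moll_minus)

lemma conv_moll_integrable:
  "integrable lborel g \<Longrightarrow> integrable lborel (\<lambda>z. g (x + z) * moll \<delta> z)"
  using integrable_lborel_shift[OF conv_integrable[OF _ moll_test], of g x x] by (simp add: moll_minus)

lemma conv_moll_diff:
  fixes g :: "'a::euclidean_space \<Rightarrow> real"
  assumes "integrable lborel g"
  shows "conv g (moll \<delta>) x - g x = (\<integral>z. (g (x + z) - g x) * moll \<delta> z \<partial>lborel)"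
proof -
  have "(\<integral>z. (g (x + z) - g x) * moll \<delta> z \<partial>lborel)
      = (\<integral>z. g (x + z) * moll \<delta> z \<partial>lborel) - (\<integral>z. g x * moll \<delta> (z::'a) \<partial>lborel)"
    by (subst Bochner_Integration.integral_diff[symmetric])
       (use conv_moll_integrable[OF assms] moll_integrable in \<open>auto simp: left_diff_distrib\<close>)
  then show ?thesis by (simp add: conv_moll_shift moll_integral)
qed

lemma conv_moll_diff_bound:
  fixes g :: "'a::euclidean_space \<Rightarrow> real"
  assumes "integrable lborel g" "\<And>z. norm z < \<delta> \<Longrightarrow> \<bar>g (x + z) - g x\<bar> \<le> e" "0 \<le> e"
  shows "\<bar>conv g (moll \<delta>) x - g x\<bar> \<le> e"
proof -
  have "\<bar>conv g (moll \<delta>) x - g x\<bar> \<le> (\<integral>z. e * moll \<delta> (z::'a) \<partial>lborel)"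
    unfolding conv_moll_diff[OF assms(1)] real_norm_def[symmetric]
  proof (rule order_trans[OF integral_norm_bound], rule integral_mono')
    show "norm ((g (x + z) - g x) * moll \<delta> z) \<le> e * moll \<delta> z" for z
      using assms(2)[of z] moll_zero[of z] moll_nonneg[of z]
      by (cases "norm z < \<delta>") (auto simp: abs_mult intro: mult_right_mono)
  qed (use moll_integrable assms(3) in \<open>auto intro!: mult_nonneg_nonneg moll_nonneg\<close>)
  then show ?thesis by (simp add: moll_integral)
qed

text \<open>By Tonelli's theorem the integral over \<open>x\<close> may be taken first, separately for each shift \<open>z\<close>.\<close>

lemma nn_integral_moll_average:
  fixes k :: "'a::euclidean_space \<Rightarrow> 'a \<Rightarrow> ennreal"
  assumes [measurable]: "(\<lambda>(x, z). k x z) \<in> borel_measurable (borel \<Otimes>\<^sub>M borel)"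
    and C: "\<And>z. norm z < \<delta> \<Longrightarrow> (\<integral>\<^sup>+x. k x z \<partial>lborel) \<le> C"
  shows "(\<integral>\<^sup>+x. (\<integral>\<^sup>+z. k x z * ennreal (moll \<delta> z) \<partial>lborel) \<partial>lborel) \<le> C"
proof -
  have "(\<integral>\<^sup>+x. (\<integral>\<^sup>+z. k x z * ennreal (moll \<delta> z) \<partial>lborel) \<partial>lborel)
      = (\<integral>\<^sup>+z. (\<integral>\<^sup>+x. k x z * ennreal (moll \<delta> z) \<partial>lborel) \<partial>lborel)"
    by (rule lborel_pair.Fubini') measurable
  also have "\<dots> = (\<integral>\<^sup>+z. (\<integral>\<^sup>+x. k x z \<partial>lborel) * ennreal (moll \<delta> z) \<partial>lborel)"
    by (intro nn_integral_cong nn_integral_multc) measurable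
  also have "\<dots> \<le> (\<integral>\<^sup>+z. C * ennreal (moll \<delta> (z::'a)) \<partial>lborel)"
  proof (intro nn_integral_mono)
    fix z :: 'a
    show "(\<integral>\<^sup>+x. k x z \<partial>lborel) * ennreal (moll \<delta> z) \<le> C * ennreal (moll \<delta> z)"
      using C[of z] moll_zero[of z] by (cases "norm z < \<delta>") (auto intro: mult_right_mono)
  qed
  also have "\<dots> = C" by (simp add: nn_integral_cmult moll_nn_integral)
  finally show ?thesis .
qed

text \<open>
  Tonelli's theorem: translations preserve the integral of \<open>\<bar>g\<bar>\<close>, and the mollifier has mass one.
\<close>

lemma conv_moll_L1_le:
  assumes g: "integrable lborel g"
  shows "integrable lborel (conv g (moll \<delta>))"
    "(\<integral>x. \<bar>conv g (moll \<delta>) x\<bar> \<partial>lborel) \<le> (\<integral>x. \<bar>g x\<bar> \<partial>lborel)"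
proof -
  have [measurable]: "g \<in> borel_measurable borel" using g by simp
  have [measurable]: "conv g (moll \<delta>) \<in> borel_measurable borel"
    by (rule smooth_measurable[OF smooth_conv[OF g moll_test]])
  have fin: "(\<integral>\<^sup>+x. ennreal \<bar>g x\<bar> \<partial>lborel) = ennreal (\<integral>x. \<bar>g x\<bar> \<partial>lborel)"
    using g by (intro nn_integral_eq_integral) auto
  have "(\<integral>\<^sup>+x. ennreal \<bar>conv g (moll \<delta>) x\<bar> \<partial>lborel)
      \<le> (\<integral>\<^sup>+x. (\<integral>\<^sup>+z. ennreal \<bar>g (x + z)\<bar> * ennreal (moll \<delta> z) \<partial>lborel) \<partial>lborel)"
  proof (intro nn_integral_mono)
    fix x
    have "ennreal \<bar>conv g (moll \<delta>) x\<bar> \<le> (\<integral>\<^sup>+z. ennreal (norm (g (x + z) * moll \<delta> z)) \<partial>lborel)"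
      unfolding conv_moll_shift real_norm_def[symmetric]
      by (rule integral_norm_bound_ennreal[OF conv_moll_integrable[OF g]])
    then show "ennreal \<bar>conv g (moll \<delta>) x\<bar> \<le> (\<integral>\<^sup>+z. ennreal \<bar>g (x + z)\<bar> * ennreal (moll \<delta> z) \<partial>lborel)"
      by (simp add: abs_mult moll_nonneg ennreal_mult)
  qed
  also have "\<dots> \<le> ennreal (\<integral>x. \<bar>g x\<bar> \<partial>lborel)"
  proof (rule nn_integral_moll_average)
    show "(\<integral>\<^sup>+x. ennreal \<bar>g (x + z)\<bar> \<partial>lborel) \<le> ennreal (\<integral>x. \<bar>g x\<bar> \<partial>lborel)" for z
      using nn_integral_lborel_shift[of "\<lambda>x. ennreal \<bar>g x\<bar>" z] fin by (simp add: add.commute)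
  qed measurable
  finally have le: "(\<integral>\<^sup>+x. ennreal \<bar>conv g (moll \<delta>) x\<bar> \<partial>lborel) \<le> ennreal (\<integral>x. \<bar>g x\<bar> \<partial>lborel)" .
  then show i: "integrable lborel (conv g (moll \<delta>))"
    by (intro integrableI_bounded) (auto intro: le_less_trans)
  show "(\<integral>x. \<bar>conv g (moll \<delta>) x\<bar> \<partial>lborel) \<le> (\<integral>x. \<bar>g x\<bar> \<partial>lborel)"
    using le nn_integral_eq_integral[OF integrable_abs[OF i]] by simp
qed

text \<open>
  The squared average of the increments is at most the average of their squares, and an increment over
  \<open>z\<close> is controlled in the mean by \<open>norm z\<close> and the gradient.
\<close>

lemma conv_moll_L2_error:
  assumes \<phi>: "\<phi> \<in> test_functions UNIV"
  shows "integrable lborel (\<lambda>x. (conv \<phi> (moll \<delta>) x - \<phi> x)\<^sup>2)"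
    "(\<integral>x. (conv \<phi> (moll \<delta>) x - \<phi> x)\<^sup>2 \<partial>lborel) \<le> \<delta>\<^sup>2 * (\<integral>x. (norm (grad \<phi> x))\<^sup>2 \<partial>lborel)"
proof -
  have i\<phi>: "integrable lborel \<phi>" by (rule test_integrable[OF \<phi>])
  have [measurable]: "\<phi> \<in> borel_measurable borel" using i\<phi> by simp
  have [measurable]: "conv \<phi> (moll \<delta>) \<in> borel_measurable borel"
    by (rule smooth_measurable[OF smooth_conv[OF i\<phi> moll_test]])
  obtain B where B: "0 \<le> B" "\<And>x. \<bar>\<phi> x\<bar> \<le> B" using test_bounded[OF \<phi>] by blast
  let ?R = "\<delta>\<^sup>2 * (\<integral>x. (norm (grad \<phi> x))\<^sup>2 \<partial>lborel)"
  have sq: "integrable lborel (\<lambda>x. (\<phi> (x + z) - \<phi> x)\<^sup>2)" for z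
  proof -
    have "integrable lborel (\<lambda>x. (\<phi> (x + z) - \<phi> x) * (\<phi> (x + z) - \<phi> x))"
    proof (rule integrable_mult_bounded)
      show "integrable lborel (\<lambda>x. \<phi> (x + z) - \<phi> x)"
        using test_shift[OF \<phi>] i\<phi> by (rule Bochner_Integration.integrable_diff)
      show "\<bar>\<phi> (x + z) - \<phi> x\<bar> \<le> 2 * B" for x using B(2)[of x] B(2)[of "x + z"] by linarith
    qed measurable
    then show ?thesis by (simp add: power2_eq_square)
  qed
  have "(\<integral>\<^sup>+x. ennreal ((conv \<phi> (moll \<delta>) x - \<phi> x)\<^sup>2) \<partial>lborel)
      \<le> (\<integral>\<^sup>+x. (\<integral>\<^sup>+z. ennreal ((\<phi> (x + z) - \<phi> x)\<^sup>2) * ennreal (moll \<delta> z) \<partial>lborel) \<partial>lborel)"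
  proof (intro nn_integral_mono)
    fix x
    define X where "X z = \<phi> (x + z) - \<phi> x" for z
    define m where "m = conv \<phi> (moll \<delta>) x - \<phi> x"
    have Xb: "\<bar>X z\<bar> \<le> 2 * B" for z using B(2)[of x] B(2)[of "x + z"] unfolding X_def by linarith
    have [measurable]: "X \<in> borel_measurable borel" unfolding X_def[abs_def] by measurable
    have m: "m = (\<integral>z. X z * moll \<delta> z \<partial>lborel)" unfolding m_def X_def by (rule conv_moll_diff[OF i\<phi>])
    have i1: "integrable lborel (\<lambda>z. moll \<delta> z * X z)"
      by (rule integrable_mult_bounded[OF moll_integrable _ Xb]) measurable
    have i2: "integrable lborel (\<lambda>z. moll \<delta> z * (X z)\<^sup>2)"
    proof (rule integrable_mult_bounded[OF moll_integrable])
      show "\<bar>(X z)\<^sup>2\<bar> \<le> (2 * B)\<^sup>2" for z using power_mono[OF Xb[of z], of 2] by simp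
    qed measurable
    have m2: "(\<integral>z. moll \<delta> z * X z \<partial>lborel) = m" by (simp add: m mult.commute)
    \<comment> \<open>The variance of the increments is nonnegative.\<close>
    have "0 \<le> (\<integral>z. moll \<delta> z * (X z - m)\<^sup>2 \<partial>lborel)" by (simp add: moll_nonneg)
    also have "\<dots> = (\<integral>z. moll \<delta> z * (X z)\<^sup>2 - 2 * m * (moll \<delta> z * X z) + m\<^sup>2 * moll \<delta> z \<partial>lborel)"
      by (intro Bochner_Integration.integral_cong refl) (simp add: power2_eq_square algebra_simps)
    also have "\<dots> = (\<integral>z. moll \<delta> z * (X z)\<^sup>2 \<partial>lborel) - 2 * m * m + m\<^sup>2"
      using i1 i2 moll_integrable[where 'a = 'a] moll_integral[where 'a = 'a] m2 by simp
    finally have "m\<^sup>2 \<le> (\<integral>z. moll \<delta> z * (X z)\<^sup>2 \<partial>lborel)" by (simp add: power2_eq_square)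
    then have "ennreal (m\<^sup>2) \<le> (\<integral>\<^sup>+z. ennreal (moll \<delta> z * (X z)\<^sup>2) \<partial>lborel)"
      using i2 by (subst nn_integral_eq_integral) (auto simp: moll_nonneg)
    then show "ennreal ((conv \<phi> (moll \<delta>) x - \<phi> x)\<^sup>2)
        \<le> (\<integral>\<^sup>+z. ennreal ((\<phi> (x + z) - \<phi> x)\<^sup>2) * ennreal (moll \<delta> z) \<partial>lborel)"
      by (simp add: m_def X_def moll_nonneg ennreal_mult mult.commute)
  qed
  also have "\<dots> \<le> ennreal ?R"
  proof (rule nn_integral_moll_average)
    fix z :: 'a assume z: "norm z < \<delta>"
    have "(\<integral>\<^sup>+x. ennreal ((\<phi> (x + z) - \<phi> x)\<^sup>2) \<partial>lborel) = ennreal (\<integral>x. (\<phi> (x + z) - \<phi> x)\<^sup>2 \<partial>lborel)"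
      using sq by (intro nn_integral_eq_integral) auto
    also have "\<dots> \<le> ennreal ?R"
    proof (intro ennreal_leI order_trans[OF integral_square_increment_le[OF \<phi>]] mult_right_mono power_mono)
      show "norm z \<le> \<delta>" using z by simp
    qed auto
    finally show "(\<integral>\<^sup>+x. ennreal ((\<phi> (x + z) - \<phi> x)\<^sup>2) \<partial>lborel) \<le> ennreal ?R" .
  qed measurable
  finally have le: "(\<integral>\<^sup>+x. ennreal ((conv \<phi> (moll \<delta>) x - \<phi> x)\<^sup>2) \<partial>lborel) \<le> ennreal ?R" .
  then show i: "integrable lborel (\<lambda>x. (conv \<phi> (moll \<delta>) x - \<phi> x)\<^sup>2)"
    by (intro integrableI_bounded) (auto intro: le_less_trans)
  show "(\<integral>x. (conv \<phi> (moll \<delta>) x - \<phi> x)\<^sup>2 \<partial>lborel) \<le> ?R"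
    using le nn_integral_eq_integral[OF i] by (simp add: ennreal_le_iff mult_nonneg_nonneg)
qed

end

text \<open>
  A measurable function is almost everywhere a limit of continuous ones. Clamping these to \<open>[-B, B]\<close> and
  multiplying by a cutoff, which is 1 on the ball where \<open>g\<close> lives, makes the convergence dominated.
\<close>

lemma dense_continuous_L1:
  fixes g :: "'a::euclidean_space \<Rightarrow> real"
  assumes g: "g \<in> borel_measurable borel" "\<And>x. \<bar>g x\<bar> \<le> B" "\<And>x. x \<notin> cball 0 r \<Longrightarrow> g x = 0" and "e > 0"
  obtains h where "continuous_on UNIV h" "\<And>x. x \<notin> cball 0 (r + 1) \<Longrightarrow> h x = 0"
    "integrable lborel h" "(\<integral>x. \<bar>h x - g x\<bar> \<partial>lborel) < e"
proof -
  have "g \<in> borel_measurable lebesgue" using g(1) by (simp add: measurable_completion)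
  then have "g measurable_on UNIV" by (rule lebesgue_measurable_imp_measurable_on) auto
  then obtain N k where N: "negligible N" "\<And>n. continuous_on UNIV (k n)"
    "\<And>x. x \<notin> N \<Longrightarrow> (\<lambda>n. k n x) \<longlonglongrightarrow> g x"
    unfolding measurable_on_def by auto
  define h where "h n x = max 0 (min 1 (r + 1 - norm x)) * max (- B) (min B (k n x))" for n and x :: 'a
  have hc: "continuous_on UNIV (h n)" for n
    unfolding h_def[abs_def] by (intro continuous_intros N(2))
  have h0: "h n x = 0" if "x \<notin> cball 0 (r + 1)" for n x
    using that by (simp add: h_def)
  have hi: "integrable lborel (h n)" for n
    by (rule integrable_compact_support[OF hc compact_cball h0])
  have B: "B \<ge> 0" using g(2)[of 0] by linarith
  have hb: "\<bar>h n x\<bar> \<le> B * indicator (cball 0 (r + 1)) x" for n x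
  proof (cases "x \<in> cball 0 (r + 1)")
    case True
    have "\<bar>h n x\<bar> \<le> 1 * B" unfolding h_def abs_mult using B by (intro mult_mono) auto
    then show ?thesis using True by simp
  qed (simp add: h0)
  have gb: "\<bar>g x\<bar> \<le> B * indicator (cball 0 (r + 1)) x" for x
    using g(2)[of x] g(3)[of x] B by (cases "x \<in> cball 0 r") (auto split: split_indicator)
  have lim: "(\<lambda>n. \<integral>x. \<bar>h n x - g x\<bar> \<partial>lborel) \<longlonglongrightarrow> (\<integral>x. 0 \<partial>(lborel :: 'a measure))"
  proof (rule integral_dominated_convergence[where w = "\<lambda>x. 2 * B * indicator (cball 0 (r + 1)) x"])
    have "AE x in lebesgue. x \<notin> N" using N(1) by (intro AE_not_in) (simp add: negligible_iff_null_sets)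
    then have "AE x in lborel. x \<notin> N" by (simp add: AE_completion_iff)
    then show "AE x in lborel. (\<lambda>n. \<bar>h n x - g x\<bar>) \<longlonglongrightarrow> 0"
    proof (rule AE_mp, intro AE_I2 impI)
      fix x assume "x \<notin> N"
      have "(\<lambda>n. h n x) \<longlonglongrightarrow> max 0 (min 1 (r + 1 - norm x)) * max (- B) (min B (g x))"
        unfolding h_def by (intro tendsto_intros N(3)[OF \<open>x \<notin> N\<close>])
      moreover have "max 0 (min 1 (r + 1 - norm x)) * max (- B) (min B (g x)) = g x"
        using g(2)[of x] g(3)[of x] by (cases "x \<in> cball 0 r") (auto simp: abs_le_iff)
      ultimately have "(\<lambda>n. h n x - g x) \<longlonglongrightarrow> 0" by (simp add: LIM_zero_iff)
      then show "(\<lambda>n. \<bar>h n x - g x\<bar>) \<longlonglongrightarrow> 0" by (rule tendsto_rabs_zero)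
    qed
    show "integrable lborel (\<lambda>x. 2 * B * indicator (cball 0 (r + 1)) x :: real)"
      by (intro integrable_mult_right integrable_indicator_cball)
    show "AE x in lborel. norm \<bar>h n x - g x\<bar> \<le> 2 * B * indicator (cball 0 (r + 1)) x" for n
    proof (intro AE_I2)
      fix x show "norm \<bar>h n x - g x\<bar> \<le> 2 * B * indicator (cball 0 (r + 1)) x"
        using hb[of n x] gb[of x] by simp
    qed
  qed (use hi g(1) in \<open>auto intro!: borel_measurable_abs borel_measurable_diff borel_measurable_integrable\<close>)
  then obtain n where "(\<integral>x. \<bar>h n x - g x\<bar> \<partial>lborel) < e"
    using order_tendstoD(2)[OF lim, of e] \<open>e > 0\<close> by (auto simp: eventually_sequentially)
  then show thesis using that[of "h n"] hc h0 hi by blast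
qed

text \<open>
  For continuous functions of compact support mollification converges uniformly; the general case
  follows by approximation, since mollification does not increase the mean of the absolute value.
\<close>

lemma conv_moll_tendsto_L1:
  fixes g :: "'a::euclidean_space \<Rightarrow> real"
  assumes g: "g \<in> borel_measurable borel" "\<And>x. \<bar>g x\<bar> \<le> B" "\<And>x. x \<notin> cball 0 r \<Longrightarrow> g x = 0"
  shows "(\<lambda>n. \<integral>x. \<bar>conv g (moll (inverse (real (Suc n)))) x - g x\<bar> \<partial>lborel) \<longlonglongrightarrow> 0"
proof (rule LIMSEQ_I)
  fix e :: real assume "e > 0"
  define V where "V = measure lborel (cball (0::'a) (r + 2))"
  have V: "V \<ge> 0" by (simp add: V_def)
  have gi: "integrable lborel g"
  proof (rule Bochner_Integration.integrable_bound[OF integrable_mult_right[OF integrable_indicator_cball[of r], of B]])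
    show "AE x in lborel. norm (g x) \<le> norm (B * indicator (cball 0 r) x)"
    proof (intro AE_I2)
      fix x show "norm (g x) \<le> norm (B * indicator (cball 0 r) x)"
        using g(2)[of x] g(3)[of x] by (cases "x \<in> cball 0 r") auto
    qed
  qed (use g(1) in simp)
  have e3: "e / 3 > 0" using \<open>e > 0\<close> by simp
  obtain h where h: "continuous_on UNIV h" "\<And>x. x \<notin> cball 0 (r + 1) \<Longrightarrow> h x = 0"
    "integrable lborel h" "(\<integral>x. \<bar>h x - g x\<bar> \<partial>lborel) < e / 3"
    using dense_continuous_L1[OF g e3] by blast
  \<comment> \<open>Uniformly, the error of the continuous part may be \<open>e'\<close> on a ball of volume \<open>V\<close>; adding 1 avoids division by zero.\<close>
  define e' where "e' = e / (3 * (V + 1))"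
  have e': "e' > 0" "e' * V < e / 3" using \<open>e > 0\<close> V by (auto simp: e'_def field_simps)
  have "uniformly_continuous_on UNIV h"
    by (rule uniformly_continuous_compact_support[OF h(1) compact_cball h(2)])
  then obtain d where d: "d > 0" "\<And>x y. dist y x < d \<Longrightarrow> dist (h y) (h x) < e'"
    unfolding uniformly_continuous_on_def using e'(1) by (metis UNIV_I)
  obtain M where M: "inverse (real (Suc M)) < d" using reals_Archimedean[OF d(1)] by blast
  have "norm ((\<integral>x. \<bar>conv g (moll (inverse (real (Suc n)))) x - g x\<bar> \<partial>lborel) - 0) < e" if "n \<ge> M" for n
  proof -
    define \<delta> where "\<delta> = inverse (real (Suc n))"
    have \<delta>: "\<delta> > 0" "\<delta> < d" "\<delta> \<le> 1"
    proof -
      have "\<delta> \<le> inverse (real (Suc M))" unfolding \<delta>_def using that by (intro le_imp_inverse_le) auto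
      then show "\<delta> < d" using M by simp
      show "\<delta> > 0" "\<delta> \<le> 1" by (auto simp: \<delta>_def inverse_le_1_iff)
    qed
    let ?gh = "\<lambda>x. g x - h x"
    have ghi: "integrable lborel ?gh" using gi h(3) by simp
    have split: "conv g (moll \<delta>) x = conv ?gh (moll \<delta>) x + conv h (moll \<delta>) x" for x
      unfolding conv_def using conv_integrable[OF ghi moll_test[OF \<delta>(1)], of x] conv_integrable[OF h(3) moll_test[OF \<delta>(1)], of x]
      by (subst Bochner_Integration.integral_add[symmetric]) (auto simp: algebra_simps)
    have hd: "\<bar>conv h (moll \<delta>) x - h x\<bar> \<le> e' * indicator (cball 0 (r + 2)) x" for x
    proof (cases "x \<in> cball 0 (r + 2)")
      case True
      have "\<bar>conv h (moll \<delta>) x - h x\<bar> \<le> e'"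
      proof (rule conv_moll_diff_bound[OF \<delta>(1) h(3)])
        show "\<bar>h (x + z) - h x\<bar> \<le> e'" if "norm z < \<delta>" for z
          using d(2)[of "x + z" x] that \<delta>(2) by (simp add: dist_norm)
      qed (use e' in simp)
      then show ?thesis using True by simp
    next
      case False
      have "\<bar>conv h (moll \<delta>) x - h x\<bar> \<le> 0"
      proof (rule conv_moll_diff_bound[OF \<delta>(1) h(3)])
        fix z :: 'a assume "norm z < \<delta>"
        then have "norm (x + z) > r + 1" using False \<delta>(3) norm_triangle_ineq2[of x "- z"] by simp
        then show "\<bar>h (x + z) - h x\<bar> \<le> 0" using False by (simp add: h(2))
      qed simp
      then show ?thesis using False by simp
    qed
    have hdi: "integrable lborel (\<lambda>x. \<bar>conv h (moll \<delta>) x - h x\<bar>)"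
      using conv_moll_L1_le(1)[OF \<delta>(1) h(3)] h(3) by simp
    have "(\<integral>x. \<bar>conv g (moll \<delta>) x - g x\<bar> \<partial>lborel)
        \<le> (\<integral>x. \<bar>conv ?gh (moll \<delta>) x\<bar> + \<bar>conv h (moll \<delta>) x - h x\<bar> + \<bar>h x - g x\<bar> \<partial>lborel)"
    proof (rule integral_mono')
      show "integrable lborel (\<lambda>x. \<bar>conv ?gh (moll \<delta>) x\<bar> + \<bar>conv h (moll \<delta>) x - h x\<bar> + \<bar>h x - g x\<bar>)"
        using hdi h(3) gi conv_moll_L1_le(1)[OF \<delta>(1) ghi] by (intro Bochner_Integration.integrable_add) auto
    qed (auto simp: split)
    also have "\<dots> = (\<integral>x. \<bar>conv ?gh (moll \<delta>) x\<bar> \<partial>lborel) + (\<integral>x. \<bar>conv h (moll \<delta>) x - h x\<bar> \<partial>lborel)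
        + (\<integral>x. \<bar>h x - g x\<bar> \<partial>lborel)"
      using hdi h(3) gi conv_moll_L1_le(1)[OF \<delta>(1) ghi] by simp
    also have "\<dots> \<le> (\<integral>x. \<bar>g x - h x\<bar> \<partial>lborel) + (\<integral>x. e' * indicator (cball 0 (r + 2)) x \<partial>(lborel :: 'a measure))
        + (\<integral>x. \<bar>h x - g x\<bar> \<partial>lborel)"
      using hd e' by (intro add_mono conv_moll_L1_le(2)[OF \<delta>(1) ghi] integral_mono' order_refl
          integrable_mult_right integrable_indicator_cball) auto
    also have "\<dots> = 2 * (\<integral>x. \<bar>h x - g x\<bar> \<partial>lborel) + e' * V"
      by (simp add: V_def abs_minus_commute)
    also have "\<dots> < e" using h(4) e'(2) by simp
    finally show ?thesis by (simp add: \<delta>_def)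
  qed
  then show "\<exists>M. \<forall>n\<ge>M. norm ((\<integral>x. \<bar>conv g (moll (inverse (real (Suc n)))) x - g x\<bar> \<partial>lborel) - 0) < e" by blast
qed

section \<open>Square integrable functions\<close>

lemma norm_add_squared_le: "(norm (a + b :: 'a::real_normed_vector))\<^sup>2 \<le> 2 * (norm a)\<^sup>2 + 2 * (norm b)\<^sup>2"
proof -
  have "(norm (a + b))\<^sup>2 \<le> (norm a + norm b)\<^sup>2" by (intro power_mono norm_triangle_ineq) simp
  also have "\<dots> \<le> 2 * (norm a)\<^sup>2 + 2 * (norm b)\<^sup>2"
    using sum_squares_ge_zero[of "norm a - norm b" 0] by (simp add: power2_eq_square algebra_simps)
  finally show ?thesis .
qed

lemma L2_add:
  fixes f g :: "'a \<Rightarrow> 'b::{real_normed_vector, second_countable_topology}"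
  assumes [measurable]: "f \<in> borel_measurable M" "g \<in> borel_measurable M"
    and "integrable M (\<lambda>x. (norm (f x))\<^sup>2)" "integrable M (\<lambda>x. (norm (g x))\<^sup>2)"
  shows "integrable M (\<lambda>x. (norm (f x + g x))\<^sup>2)"
proof (rule Bochner_Integration.integrable_bound)
  show "integrable M (\<lambda>x. 2 * (norm (f x))\<^sup>2 + 2 * (norm (g x))\<^sup>2)" using assms by auto
  show "AE x in M. norm ((norm (f x + g x))\<^sup>2) \<le> norm (2 * (norm (f x))\<^sup>2 + 2 * (norm (g x))\<^sup>2)"
    using norm_add_squared_le by (intro AE_I2) auto
qed measurable

lemma L2_diff:
  fixes f g :: "'a \<Rightarrow> 'b::{real_normed_vector, second_countable_topology}"
  assumes "f \<in> borel_measurable M" "g \<in> borel_measurable M"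
    and "integrable M (\<lambda>x. (norm (f x))\<^sup>2)" "integrable M (\<lambda>x. (norm (g x))\<^sup>2)"
  shows "integrable M (\<lambda>x. (norm (f x - g x))\<^sup>2)"
  using L2_add[of f M "\<lambda>x. - g x"] assms by simp

text \<open>
  A weighted form of Young's inequality; with a small weight on one factor it replaces the
  Cauchy-Schwarz inequality for integrals.
\<close>

lemma abs_inner_le_squares: "0 < t \<Longrightarrow> \<bar>a \<bullet> b\<bar> \<le> t * (norm a)\<^sup>2 + (norm b)\<^sup>2 / t"
proof -
  assume t: "0 < t"
  have "0 \<le> (norm b - t * norm a)\<^sup>2 + (norm b)\<^sup>2 + (t * norm a)\<^sup>2" by simp
  then have "t * (norm a * norm b) \<le> t * (t * (norm a)\<^sup>2 + (norm b)\<^sup>2 / t)"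
    using t by (simp add: power2_eq_square algebra_simps)
  then have "norm a * norm b \<le> t * (norm a)\<^sup>2 + (norm b)\<^sup>2 / t" using t by simp
  then show ?thesis using Cauchy_Schwarz_ineq2[of a b] by linarith
qed

lemma L2_inner:
  fixes f g :: "'a \<Rightarrow> 'b::euclidean_space"
  assumes [measurable]: "f \<in> borel_measurable M" "g \<in> borel_measurable M"
    and "integrable M (\<lambda>x. (norm (f x))\<^sup>2)" "integrable M (\<lambda>x. (norm (g x))\<^sup>2)"
  shows "integrable M (\<lambda>x. f x \<bullet> g x)"
proof (rule Bochner_Integration.integrable_bound)
  show "integrable M (\<lambda>x. 1 * (norm (f x))\<^sup>2 + (norm (g x))\<^sup>2 / 1)" using assms by auto
  show "AE x in M. norm (f x \<bullet> g x) \<le> norm (1 * (norm (f x))\<^sup>2 + (norm (g x))\<^sup>2 / 1)"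
    using abs_inner_le_squares[of 1] by (intro AE_I2) auto
qed measurable

lemma L2_tendsto_inner:
  fixes f :: "nat \<Rightarrow> 'a \<Rightarrow> 'b::euclidean_space"
  assumes [measurable]: "\<And>n. f n \<in> borel_measurable M" "g \<in> borel_measurable M" "h \<in> borel_measurable M"
    and g: "integrable M (\<lambda>x. (norm (g x))\<^sup>2)" and h: "integrable M (\<lambda>x. (norm (h x))\<^sup>2)"
    and f: "\<And>n. integrable M (\<lambda>x. (norm (f n x - g x))\<^sup>2)"
    and lim: "(\<lambda>n. \<integral>x. (norm (f n x - g x))\<^sup>2 \<partial>M) \<longlonglongrightarrow> 0"
  shows "(\<lambda>n. \<integral>x. f n x \<bullet> h x \<partial>M) \<longlonglongrightarrow> (\<integral>x. g x \<bullet> h x \<partial>M)"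
proof (rule LIMSEQ_I)
  fix e :: real assume e: "e > 0"
  define H where "H = (\<integral>x. (norm (h x))\<^sup>2 \<partial>M)"
  have H: "H \<ge> 0" by (simp add: H_def)
  define t where "t = 2 * (H + 1) / e"
  have t: "t > 0" "H / t < e / 2"
  proof -
    show "t > 0" using e H by (simp add: t_def)
    have "H * e < (H + 1) * e" using e by simp
    then show "H / t < e / 2" using e H by (simp add: t_def field_simps)
  qed
  obtain N where N: "\<And>n. n \<ge> N \<Longrightarrow> (\<integral>x. (norm (f n x - g x))\<^sup>2 \<partial>M) < e / (2 * t)"
    using order_tendstoD(2)[OF lim, of "e / (2 * t)"] e t(1) by (auto simp: eventually_sequentially)
  have "norm ((\<integral>x. f n x \<bullet> h x \<partial>M) - (\<integral>x. g x \<bullet> h x \<partial>M)) < e" if "n \<ge> N" for n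
  proof -
    have i1: "integrable M (\<lambda>x. (f n x - g x) \<bullet> h x)" by (intro L2_inner f h) measurable
    have i2: "integrable M (\<lambda>x. g x \<bullet> h x)" by (intro L2_inner g h) measurable
    have "(\<integral>x. f n x \<bullet> h x \<partial>M) = (\<integral>x. (f n x - g x) \<bullet> h x + g x \<bullet> h x \<partial>M)"
      by (simp add: inner_diff_left)
    then have "norm ((\<integral>x. f n x \<bullet> h x \<partial>M) - (\<integral>x. g x \<bullet> h x \<partial>M)) = norm (\<integral>x. (f n x - g x) \<bullet> h x \<partial>M)"
      using i1 i2 by simp
    also have "\<dots> \<le> (\<integral>x. t * (norm (f n x - g x))\<^sup>2 + (norm (h x))\<^sup>2 / t \<partial>M)"
      by (rule order_trans[OF integral_norm_bound], rule integral_mono')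
         (use f h t abs_inner_le_squares[OF t(1)] in auto)
    also have "\<dots> = t * (\<integral>x. (norm (f n x - g x))\<^sup>2 \<partial>M) + H / t"
      using f h by (simp add: H_def)
    also have "\<dots> < t * (e / (2 * t)) + e / 2"
      using N[OF that] t by (intro add_strict_mono mult_strict_left_mono) auto
    also have "\<dots> = e" using t(1) by (simp add: field_simps)
    finally show ?thesis .
  qed
  then show "\<exists>N. \<forall>n\<ge>N. norm ((\<integral>x. f n x \<bullet> h x \<partial>M) - (\<integral>x. g x \<bullet> h x \<partial>M)) < e" by blast
qed

text \<open>
  Expand \<open>\<bar>f\<^sub>n\<bar>\<^sup>2\<close> around \<open>g\<close>; the mixed term converges by \<open>L2_tendsto_inner\<close>.
\<close>

lemma L2_tendsto_norm:
  fixes f :: "nat \<Rightarrow> 'a \<Rightarrow> 'b::euclidean_space"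
  assumes [measurable]: "\<And>n. f n \<in> borel_measurable M" "g \<in> borel_measurable M"
    and g: "integrable M (\<lambda>x. (norm (g x))\<^sup>2)"
    and f: "\<And>n. integrable M (\<lambda>x. (norm (f n x - g x))\<^sup>2)"
    and lim: "(\<lambda>n. \<integral>x. (norm (f n x - g x))\<^sup>2 \<partial>M) \<longlonglongrightarrow> 0"
  shows "(\<lambda>n. \<integral>x. (norm (f n x))\<^sup>2 \<partial>M) \<longlonglongrightarrow> (\<integral>x. (norm (g x))\<^sup>2 \<partial>M)"
proof -
  let ?G = "\<integral>x. (norm (g x))\<^sup>2 \<partial>M"
  have fg: "integrable M (\<lambda>x. f n x \<bullet> g x)" for n
  proof -
    have "integrable M (\<lambda>x. (f n x - g x) \<bullet> g x + g x \<bullet> g x)"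
      by (intro Bochner_Integration.integrable_add L2_inner f g) measurable
    then show ?thesis by (simp add: inner_diff_left)
  qed
  have "(\<lambda>n. (\<integral>x. (norm (f n x - g x))\<^sup>2 \<partial>M) + 2 * (\<integral>x. f n x \<bullet> g x \<partial>M) - ?G)
      \<longlonglongrightarrow> 0 + 2 * (\<integral>x. g x \<bullet> g x \<partial>M) - ?G"
    by (intro tendsto_intros lim L2_tendsto_inner g f) measurable
  moreover have "(\<integral>x. (norm (f n x - g x))\<^sup>2 \<partial>M) + 2 * (\<integral>x. f n x \<bullet> g x \<partial>M) - ?G = (\<integral>x. (norm (f n x))\<^sup>2 \<partial>M)" for n
  proof -
    have "(\<integral>x. (norm (f n x))\<^sup>2 \<partial>M) = (\<integral>x. (norm (f n x - g x))\<^sup>2 + 2 * (f n x \<bullet> g x) - (norm (g x))\<^sup>2 \<partial>M)"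
      by (intro Bochner_Integration.integral_cong refl)
         (simp add: power2_norm_eq_inner inner_diff_left inner_diff_right inner_commute)
    then show ?thesis using f g fg by simp
  qed
  ultimately show ?thesis by (simp add: power2_norm_eq_inner)
qed

text \<open>
  Along a subsequence the squared distances of consecutive terms are at most \<open>4\<^sup>-\<^sup>k\<close>;
  as \<open>\<bar>d\<bar> \<le> 2\<^sup>-\<^sup>k + 2\<^sup>k d\<^sup>2\<close>, the increments are then almost everywhere summable.
\<close>

lemma L2_complete:
  fixes f :: "nat \<Rightarrow> 'a \<Rightarrow> 'b::euclidean_space"
  assumes meas [measurable]: "\<And>n. f n \<in> borel_measurable M"
    and sq: "\<And>n. integrable M (\<lambda>x. (norm (f n x))\<^sup>2)"
    and Cauchy: "\<And>e. e > 0 \<Longrightarrow> \<exists>N. \<forall>m\<ge>N. \<forall>n\<ge>N. (\<integral>x. (norm (f m x - f n x))\<^sup>2 \<partial>M) < e"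
  obtains g where "g \<in> borel_measurable M" "integrable M (\<lambda>x. (norm (g x))\<^sup>2)"
    "\<And>n. integrable M (\<lambda>x. (norm (f n x - g x))\<^sup>2)"
    "(\<lambda>n. \<integral>x. (norm (f n x - g x))\<^sup>2 \<partial>M) \<longlonglongrightarrow> 0"
proof -
  have int: "integrable M (\<lambda>x. (norm (f m x - f n x))\<^sup>2)" for m n
    by (intro L2_diff sq meas)
  have "\<exists>N. \<forall>m\<ge>N. \<forall>n\<ge>N. (\<integral>x. (norm (f m x - f n x))\<^sup>2 \<partial>M) < (1/4)^k" for k
    by (rule Cauchy) simp
  then obtain N where N: "\<And>k m n. m \<ge> N k \<Longrightarrow> n \<ge> N k \<Longrightarrow> (\<integral>x. (norm (f m x - f n x))\<^sup>2 \<partial>M) < (1/4)^k"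
    by metis
  \<comment> \<open>The partial sums make both \<open>r k\<close> and \<open>r (k + 1)\<close> at least \<open>N k\<close>, and the summand \<open>k\<close> makes \<open>r\<close> unbounded.\<close>
  define r where "r k = k + (\<Sum>j\<le>k. N j)" for k
  have r: "r k \<ge> N k" "r (Suc k) \<ge> N k" "r k \<ge> k" for k
    using member_le_sum[of k "{..k}" N] by (auto simp: r_def)
  define d where "d k x = f (r (Suc k)) x - f (r k) x" for k x
  have [measurable]: "d k \<in> borel_measurable M" for k unfolding d_def[abs_def] by measurable
  have "(\<integral>\<^sup>+x. (\<Sum>k. ennreal (2^k * (norm (d k x))\<^sup>2)) \<partial>M) = (\<Sum>k. \<integral>\<^sup>+x. ennreal (2^k * (norm (d k x))\<^sup>2) \<partial>M)"
    by (rule nn_integral_suminf) measurable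
  also have "\<dots> \<le> (\<Sum>k. ennreal ((1/2)^k))"
  proof (intro suminf_le)
    fix k
    have "(\<integral>\<^sup>+x. ennreal (2^k * (norm (d k x))\<^sup>2) \<partial>M) = ennreal (\<integral>x. 2^k * (norm (d k x))\<^sup>2 \<partial>M)"
      using int by (intro nn_integral_eq_integral) (auto simp: d_def)
    also have "(\<integral>x. 2^k * (norm (d k x))\<^sup>2 \<partial>M) \<le> 2^k * (1/4)^k"
      using N[OF r(2) r(1)] by (simp add: d_def less_imp_le)
    also have "2^k * (1/4)^k = ((1/2)^k :: real)" by (simp add: power_mult_distrib[symmetric])
    finally show "(\<integral>\<^sup>+x. ennreal (2^k * (norm (d k x))\<^sup>2) \<partial>M) \<le> ennreal ((1/2)^k)"
      by (auto intro: ennreal_leI)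
  qed auto
  also have "\<dots> < \<infinity>"
    by (subst suminf_ennreal2) (auto intro: summable_geometric)
  finally have "AE x in M. (\<Sum>k. ennreal (2^k * (norm (d k x))\<^sup>2)) \<noteq> \<infinity>"
    by (intro nn_integral_PInf_AE) auto
  then have conv: "AE x in M. convergent (\<lambda>k. f (r k) x)"
  proof (rule AE_mp, intro AE_I2 impI)
    fix x assume fin: "(\<Sum>k. ennreal (2^k * (norm (d k x))\<^sup>2)) \<noteq> \<infinity>"
    have s: "summable (\<lambda>k. 2^k * (norm (d k x))\<^sup>2)"
      using fin by (intro summable_suminf_not_top) auto
    have "summable (\<lambda>k. norm (d k x))"
    proof (rule summable_comparison_test)
      show "summable (\<lambda>k. (1/2::real)^k + 2^k * (norm (d k x))\<^sup>2)"
        by (intro summable_add s summable_geometric) simp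
      have "norm (norm (d k x)) \<le> (1/2)^k + 2^k * (norm (d k x))\<^sup>2" for k
        using abs_inner_le_squares[of "2^k" "norm (d k x)" "1::real"] by (simp add: power_divide)
      then show "\<exists>N. \<forall>n\<ge>N. norm (norm (d n x)) \<le> (1/2)^n + 2^n * (norm (d n x))\<^sup>2" by blast
    qed
    then have "summable (\<lambda>k. d k x)" by (rule summable_norm_cancel)
    then have "convergent (\<lambda>n. \<Sum>k<n. d k x)" by (simp add: summable_iff_convergent)
    then have "convergent (\<lambda>n. (\<Sum>k<n. d k x) + f (r 0) x)"
      by (intro convergent_add convergent_const)
    then show "convergent (\<lambda>k. f (r k) x)"
      unfolding d_def by (simp add: sum_lessThan_telescope[where f = "\<lambda>k. f (r k) x"])
  qed
  define g where "g x = lim (\<lambda>k. f (r k) x)" for x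
  have gm [measurable]: "g \<in> borel_measurable M"
    unfolding g_def[abs_def] by (rule borel_measurable_lim_metric) measurable
  have lim: "AE x in M. (\<lambda>k. f (r k) x) \<longlonglongrightarrow> g x"
    using conv by (auto simp: g_def convergent_LIMSEQ_iff elim: eventually_mono)
  have bound: "(\<integral>\<^sup>+x. ennreal ((norm (f n x - g x))\<^sup>2) \<partial>M) \<le> ennreal e"
    if n: "\<forall>m\<ge>K. (\<integral>x. (norm (f n x - f m x))\<^sup>2 \<partial>M) < e" for n K e
  proof -
    have "(\<integral>\<^sup>+x. ennreal ((norm (f n x - g x))\<^sup>2) \<partial>M)
        = (\<integral>\<^sup>+x. liminf (\<lambda>k. ennreal ((norm (f n x - f (r k) x))\<^sup>2)) \<partial>M)"
    proof (rule nn_integral_cong_AE, use lim in \<open>rule AE_mp\<close>, intro AE_I2 impI)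
      fix x assume "(\<lambda>k. f (r k) x) \<longlonglongrightarrow> g x"
      then have "(\<lambda>k. ennreal ((norm (f n x - f (r k) x))\<^sup>2)) \<longlonglongrightarrow> ennreal ((norm (f n x - g x))\<^sup>2)"
        by (intro tendsto_intros)
      then show "ennreal ((norm (f n x - g x))\<^sup>2) = liminf (\<lambda>k. ennreal ((norm (f n x - f (r k) x))\<^sup>2))"
        by (intro lim_imp_Liminf[symmetric]) auto
    qed
    also have "\<dots> \<le> liminf (\<lambda>k. \<integral>\<^sup>+x. ennreal ((norm (f n x - f (r k) x))\<^sup>2) \<partial>M)"
      by (rule nn_integral_liminf) measurable
    also have "\<dots> \<le> ennreal e"
    proof (rule Liminf_le)
      show "\<forall>\<^sub>F k in sequentially. (\<integral>\<^sup>+x. ennreal ((norm (f n x - f (r k) x))\<^sup>2) \<partial>M) \<le> ennreal e"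
      proof (rule eventually_sequentiallyI[of K])
        fix k assume "k \<ge> K"
        then have "(\<integral>x. (norm (f n x - f (r k) x))\<^sup>2 \<partial>M) < e" using n r(3)[of k] by auto
        then show "(\<integral>\<^sup>+x. ennreal ((norm (f n x - f (r k) x))\<^sup>2) \<partial>M) \<le> ennreal e"
          using int by (subst nn_integral_eq_integral) (auto intro: ennreal_leI)
      qed
    qed simp
    finally show ?thesis .
  qed
  obtain N1 where N1: "\<forall>m\<ge>N1. \<forall>n\<ge>N1. (\<integral>x. (norm (f m x - f n x))\<^sup>2 \<partial>M) < 1" using Cauchy[of 1] by auto
  have "integrable M (\<lambda>x. (norm (f N1 x - g x))\<^sup>2)"
    using bound[of N1 N1 1] N1 by (intro integrableI_bounded) (auto intro: le_less_trans)
  from L2_diff[OF _ _ sq[of N1] this] have gi: "integrable M (\<lambda>x. (norm (g x))\<^sup>2)" by simp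
  have fi: "integrable M (\<lambda>x. (norm (f n x - g x))\<^sup>2)" for n by (intro L2_diff sq gi) measurable
  have "(\<lambda>n. \<integral>x. (norm (f n x - g x))\<^sup>2 \<partial>M) \<longlonglongrightarrow> 0"
  proof (rule LIMSEQ_I)
    fix e :: real assume e: "e > 0"
    then obtain K where K: "\<forall>m\<ge>K. \<forall>n\<ge>K. (\<integral>x. (norm (f m x - f n x))\<^sup>2 \<partial>M) < e / 2"
      using Cauchy[of "e / 2"] by auto
    have "norm ((\<integral>x. (norm (f n x - g x))\<^sup>2 \<partial>M) - 0) < e" if "n \<ge> K" for n
    proof -
      have "ennreal (\<integral>x. (norm (f n x - g x))\<^sup>2 \<partial>M) \<le> ennreal (e / 2)"
        using bound[of K n "e / 2"] K that fi by (subst nn_integral_eq_integral[symmetric]) auto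
      then have "(\<integral>x. (norm (f n x - g x))\<^sup>2 \<partial>M) \<le> e / 2" using e by (simp add: ennreal_le_iff)
      then show ?thesis using e by simp
    qed
    then show "\<exists>N. \<forall>n\<ge>N. norm ((\<integral>x. (norm (f n x - g x))\<^sup>2 \<partial>M) - 0) < e" by blast
  qed
  with gm gi fi show thesis by (rule that)
qed

section \<open>Compactness of sets of test functions with bounded energy\<close>

definition sq_norm :: "('a::euclidean_space \<Rightarrow> real) \<Rightarrow> real"
  where "sq_norm \<phi> = (\<integral>x. (\<phi> x)\<^sup>2 \<partial>lborel)"

definition energy :: "('a::euclidean_space \<Rightarrow> real) \<Rightarrow> real"
  where "energy \<phi> = (\<integral>x. (norm (grad \<phi> x))\<^sup>2 \<partial>lborel)"

lemma sq_norm_nonneg: "sq_norm \<phi> \<ge> 0" by (simp add: sq_norm_def)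
lemma energy_nonneg: "energy \<phi> \<ge> 0" by (simp add: energy_def)

lemma sq_norm_cmult: "sq_norm (\<lambda>x. c * \<phi> x) = c\<^sup>2 * sq_norm \<phi>"
  by (simp add: sq_norm_def power_mult_distrib)

lemma energy_cmult: "smooth \<phi> \<Longrightarrow> energy (\<lambda>x. c * \<phi> x) = c\<^sup>2 * energy \<phi>"
  by (simp add: energy_def power_mult_distrib grad_cmult)

text \<open>
  The mollifications inherit a common bound and a common Lipschitz constant from the kernel, so
  that the Arzela-Ascoli theorem applies.
\<close>

lemma mollified_subsequence:
  fixes \<phi> :: "nat \<Rightarrow> 'a::euclidean_space \<Rightarrow> real"
  assumes \<phi>: "\<And>n. \<phi> n \<in> test_functions \<Omega>" and r: "\<Omega> \<subseteq> cball 0 r"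
    and S: "\<And>n. sq_norm (\<phi> n) \<le> C" and \<delta>: "0 < \<delta>" "\<delta> \<le> 1" and e: "0 < e"
  obtains k N where "strict_mono (k :: nat \<Rightarrow> nat)"
    "\<And>m n x. m \<ge> N \<Longrightarrow> n \<ge> N \<Longrightarrow> \<bar>conv (\<phi> (k m)) (moll \<delta>) x - conv (\<phi> (k n)) (moll \<delta>) x\<bar> \<le> e * indicator (cball 0 (r + 1)) x"
proof -
  let ?w = "\<lambda>n. conv (\<phi> n) (moll \<delta>)"
  have \<phi>i: "integrable lborel (\<phi> n)" for n by (rule test_integrable[OF \<phi>])
  note \<phi>sq = test_integrable_squares(1)[OF \<phi>]
  define V where "V = measure lborel (cball (0::'a) r)"
  define J where "J = V + C"
  have J: "(\<integral>x. \<bar>\<phi> n x\<bar> \<partial>lborel) \<le> J" for n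
  proof -
    have "(\<integral>x. \<bar>\<phi> n x\<bar> \<partial>lborel) \<le> (\<integral>x. indicator (cball 0 r) x + (\<phi> n x)\<^sup>2 \<partial>lborel)"
    proof (rule integral_mono')
      show "\<bar>\<phi> n x\<bar> \<le> indicator (cball 0 r) x + (\<phi> n x)\<^sup>2" for x
      proof (cases "x \<in> \<Omega>")
        case True
        then have "x \<in> cball 0 r" using r by blast
        then show ?thesis using abs_inner_le_squares[of 1 "\<phi> n x" "1::real"] by simp
      next
        case False
        then show ?thesis using test_outside[OF \<phi>[of n], of x] by simp
      qed
    qed (use \<phi>sq integrable_indicator_cball[where 'a = 'a] in auto)
    also have "\<dots> = V + sq_norm (\<phi> n)"
      using \<phi>sq integrable_indicator_cball[where 'a = 'a] by (simp add: V_def sq_norm_def)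
    finally show ?thesis using S[of n] by (simp add: J_def)
  qed
  have J0: "J \<ge> 0" using J[of 0] by (rule order_trans[rotated]) simp
  have mt: "moll \<delta> \<in> test_functions (UNIV :: 'a set)" by (rule moll_test[OF \<delta>(1)])
  obtain B where B: "\<And>x. \<bar>moll \<delta> (x::'a)\<bar> \<le> B" using test_bounded[OF mt] by blast
  obtain L where L: "0 \<le> L" "\<And>x. norm (grad (moll \<delta>) (x::'a)) \<le> L" using grad_bounded[OF mt] by blast
  have bd: "norm (?w n x) \<le> B * J" for n x
  proof -
    have "norm (?w n x) \<le> (\<integral>y. \<bar>\<phi> n y\<bar> * B \<partial>lborel)"
      unfolding conv_def
      by (rule order_trans[OF integral_norm_bound], rule integral_mono')
         (use \<phi>i B order_trans[OF abs_ge_zero B] in \<open>auto simp: abs_mult intro: mult_left_mono\<close>)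
    also have "\<dots> = B * (\<integral>y. \<bar>\<phi> n y\<bar> \<partial>lborel)" by simp
    also have "\<dots> \<le> B * J" by (rule mult_left_mono[OF J order_trans[OF abs_ge_zero B]])
    finally show ?thesis .
  qed
  have lip: "norm (?w n x - ?w n y) \<le> (L * J) * norm (x - y)" for n x y
  proof -
    have "?w n x - ?w n y = (\<integral>z. \<phi> n z * (moll \<delta> (x - z) - moll \<delta> (y - z)) \<partial>lborel)"
      unfolding conv_def right_diff_distrib using conv_integrable[OF \<phi>i mt] by simp
    also have "norm \<dots> \<le> (\<integral>z. \<bar>\<phi> n z\<bar> * (L * norm (x - y)) \<partial>lborel)"
    proof (rule order_trans[OF integral_norm_bound], rule integral_mono')
      show "norm (\<phi> n z * (moll \<delta> (x - z) - moll \<delta> (y - z))) \<le> \<bar>\<phi> n z\<bar> * (L * norm (x - y))" for z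
        using lipschitz_if_grad_bounded[OF test_smooth[OF mt] convex_UNIV L(2), of "x - z" "y - z"]
        by (auto simp: abs_mult intro: mult_left_mono)
    qed (use \<phi>i L in auto)
    also have "\<dots> = (L * norm (x - y)) * (\<integral>z. \<bar>\<phi> n z\<bar> \<partial>lborel)" by simp
    also have "\<dots> \<le> (L * norm (x - y)) * J" by (rule mult_left_mono[OF J]) (use L in auto)
    finally show ?thesis by (simp add: mult_ac)
  qed
  have zero: "?w n x = 0" if "x \<notin> cball 0 (r + 1)" for n x
  proof -
    have "\<phi> n y * moll \<delta> (x - y) = 0" for y
    proof (cases "y \<in> \<Omega>")
      case True
      then have "norm y \<le> r" using r by auto
      then have "norm (x - y) \<ge> \<delta>" using that \<delta>(2) norm_triangle_ineq2[of x y] by simp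
      then show ?thesis by (simp add: moll_zero[OF \<delta>(1)])
    qed (simp add: test_outside[OF \<phi>])
    then show ?thesis unfolding conv_def by (simp only: Bochner_Integration.integral_zero)
  qed
  obtain g k where gk: "strict_mono (k :: nat \<Rightarrow> nat)"
    "\<And>e. 0 < e \<Longrightarrow> \<exists>N. \<forall>n x. n \<ge> N \<and> x \<in> cball 0 (r + 1) \<longrightarrow> norm (?w (k n) x - g x) < e"
  proof (rule Arzela_Ascoli[of "cball 0 (r + 1)" ?w "B * J"])
    fix x :: 'a and e :: real assume "0 < e"
    have "norm (?w n x - ?w n y) < e" if "norm (x - y) < e / (L * J + 1)" for n y
    proof -
      have LJ: "L * J \<ge> 0" using L J0 by simp
      have "norm (?w n x - ?w n y) \<le> (L * J) * norm (x - y)" by (rule lip)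
      also have "\<dots> \<le> (L * J + 1) * norm (x - y)" by (intro mult_right_mono) auto
      also have "\<dots> < e" using that LJ by (simp add: pos_less_divide_eq mult.commute)
      finally show ?thesis .
    qed
    moreover have "e / (L * J + 1) > 0" using \<open>0 < e\<close> L J0 by (simp add: add_nonneg_pos)
    ultimately show "\<exists>d>0. \<forall>n y. y \<in> cball 0 (r + 1) \<and> norm (x - y) < d \<longrightarrow> norm (?w n x - ?w n y) < e"
      by blast
  qed (use bd that in auto)
  obtain N where N: "\<And>n x. n \<ge> N \<Longrightarrow> x \<in> cball 0 (r + 1) \<Longrightarrow> norm (?w (k n) x - g x) < e / 2"
    using gk(2)[of "e / 2"] e by auto
  have "\<bar>?w (k m) x - ?w (k n) x\<bar> \<le> e * indicator (cball 0 (r + 1)) x" if "m \<ge> N" "n \<ge> N" for m n x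
  proof (cases "x \<in> cball 0 (r + 1)")
    case True
    then show ?thesis using N[OF that(1) True] N[OF that(2) True] by (simp add: abs_if split: if_splits)
  next
    case False
    then show ?thesis by (simp add: zero)
  qed
  with gk(1) show thesis by (rule that)
qed

text \<open>
  For a small \<open>\<delta>\<close> all functions are close to their mollifications, of which a subsequence
  converges uniformly.
\<close>

lemma rellich_approximate:
  fixes \<phi> :: "nat \<Rightarrow> 'a::euclidean_space \<Rightarrow> real"
  assumes \<phi>: "\<And>n. \<phi> n \<in> test_functions \<Omega>" and r: "\<Omega> \<subseteq> cball 0 r"
    and S: "\<And>n. sq_norm (\<phi> n) \<le> C" and D: "\<And>n. energy (\<phi> n) \<le> C" and e: "0 < e"
  shows "\<exists>k. strict_mono (k :: nat \<Rightarrow> nat) \<and> (\<exists>N. \<forall>m\<ge>N. \<forall>n\<ge>N. sq_norm (\<lambda>x. \<phi> (k m) x - \<phi> (k n) x) < e)"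
proof -
  have C: "C \<ge> 0" using S[of 0] sq_norm_nonneg[of "\<phi> 0"] by linarith
  \<comment> \<open>Three squared errors enter with factor 3: \<open>e / 18\<close> twice for mollifying and \<open>e / 9\<close> for the uniform distance, \<open>2 e / 3\<close> in total.\<close>
  define \<delta> where "\<delta> = min 1 (e / (18 * (C + 1)))"
  have \<delta>: "0 < \<delta>" "\<delta> \<le> 1" using e C by (auto simp: \<delta>_def)
  have \<delta>C: "\<delta>\<^sup>2 * C \<le> e / 18"
  proof -
    have "\<delta>\<^sup>2 * C \<le> \<delta> * (C + 1)"
      using \<delta> C mult_left_mono[OF \<delta>(2), of \<delta>] by (intro mult_mono) (auto simp: power2_eq_square)
    also have "\<dots> \<le> e / (18 * (C + 1)) * (C + 1)" using C by (intro mult_right_mono) (auto simp: \<delta>_def)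
    also have "\<dots> = e / 18" using C by (simp add: field_simps)
    finally show ?thesis .
  qed
  define V where "V = measure lborel (cball (0::'a) (r + 1))"
  have V: "V \<ge> 0" by (simp add: V_def)
  define e' where "e' = min 1 (e / (9 * (V + 1)))"
  have e': "0 < e'" "e' \<le> 1" using e V by (auto simp: e'_def)
  have eV: "e'\<^sup>2 * V \<le> e / 9"
  proof -
    have "e'\<^sup>2 * V \<le> e' * (V + 1)"
      using e' V mult_left_mono[OF e'(2), of e'] by (intro mult_mono) (auto simp: power2_eq_square)
    also have "\<dots> \<le> e / (9 * (V + 1)) * (V + 1)" using V by (intro mult_right_mono) (auto simp: e'_def)
    also have "\<dots> = e / 9" using V by (simp add: field_simps)
    finally show ?thesis .
  qed
  let ?w = "\<lambda>n. conv (\<phi> n) (moll \<delta>)"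
  obtain k N where k: "strict_mono (k :: nat \<Rightarrow> nat)"
    "\<And>m n x. m \<ge> N \<Longrightarrow> n \<ge> N \<Longrightarrow> \<bar>?w (k m) x - ?w (k n) x\<bar> \<le> e' * indicator (cball 0 (r + 1)) x"
    by (rule mollified_subsequence[of \<phi>, OF \<phi> r S \<delta> e'(1)]) (rule that)
  have \<phi>U: "\<phi> n \<in> test_functions UNIV" for n using test_functions_mono[OF \<phi>] by simp
  note err = conv_moll_L2_error[OF \<delta>(1) \<phi>U]
  have err2: "(\<integral>x. (?w n x - \<phi> n x)\<^sup>2 \<partial>lborel) \<le> e / 18" for n
    using order_trans[OF err(2)[of n] mult_left_mono[OF D[of n, unfolded energy_def]]] \<delta>C by auto
  have "sq_norm (\<lambda>x. \<phi> (k m) x - \<phi> (k n) x) < e" if "m \<ge> N" "n \<ge> N" for m n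
  proof -
    \<comment> \<open>\<open>a - b = (c - d) - (c - a) + (d - b)\<close>, with \<open>c\<close> and \<open>d\<close> the mollifications of \<open>a\<close> and \<open>b\<close>.\<close>
    have three: "(a - b)\<^sup>2 \<le> 3 * (c - a)\<^sup>2 + 3 * (d - b)\<^sup>2 + 3 * (c - d)\<^sup>2" for a b c d :: real
    proof -
      have "0 \<le> ((c - a) + (d - b))\<^sup>2 + ((c - a) + (c - d))\<^sup>2 + ((d - b) - (c - d))\<^sup>2" by simp
      then show ?thesis by (simp add: power2_eq_square algebra_simps)
    qed
    have sq: "(?w (k m) x - ?w (k n) x)\<^sup>2 \<le> e'\<^sup>2 * indicator (cball 0 (r + 1)) x" for x
      using power_mono[OF k(2)[OF that, of x], of 2] by (auto split: split_indicator)
    have "sq_norm (\<lambda>x. \<phi> (k m) x - \<phi> (k n) x) \<le> (\<integral>x. 3 * (?w (k m) x - \<phi> (k m) x)\<^sup>2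
        + 3 * (?w (k n) x - \<phi> (k n) x)\<^sup>2 + 3 * (e'\<^sup>2 * indicator (cball 0 (r + 1)) x) \<partial>lborel)"
      unfolding sq_norm_def
    proof (rule integral_mono')
      show "(\<phi> (k m) x - \<phi> (k n) x)\<^sup>2 \<le> 3 * (?w (k m) x - \<phi> (k m) x)\<^sup>2
          + 3 * (?w (k n) x - \<phi> (k n) x)\<^sup>2 + 3 * (e'\<^sup>2 * indicator (cball 0 (r + 1)) x)" for x
        using three[of "\<phi> (k m) x" "\<phi> (k n) x" "?w (k m) x" "?w (k n) x"] sq[of x] by linarith
    qed (intro Bochner_Integration.integrable_add integrable_mult_right err(1) integrable_indicator_cball,
        intro add_nonneg_nonneg mult_nonneg_nonneg, auto)
    also have "\<dots> = 3 * (\<integral>x. (?w (k m) x - \<phi> (k m) x)\<^sup>2 \<partial>lborel)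
        + 3 * (\<integral>x. (?w (k n) x - \<phi> (k n) x)\<^sup>2 \<partial>lborel) + 3 * (e'\<^sup>2 * V)"
      using err(1) integrable_indicator_cball[where 'a = 'a] by (simp add: V_def)
    also have "\<dots> \<le> 3 * (e / 18) + 3 * (e / 18) + 3 * (e / 9)"
      using err2 eV by (intro add_mono mult_left_mono) auto
    also have "\<dots> < e" using e by simp
    finally show ?thesis .
  qed
  with k(1) show ?thesis by blast
qed

text \<open>
  The subsequences belonging to the tolerances \<open>1 / (k + 1)\<close> are combined by a diagonal argument.
\<close>

lemma rellich:
  fixes \<phi> :: "nat \<Rightarrow> 'a::euclidean_space \<Rightarrow> real"
  assumes \<phi>: "\<And>n. \<phi> n \<in> test_functions \<Omega>" and r: "\<Omega> \<subseteq> cball 0 r"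
    and S: "\<And>n. sq_norm (\<phi> n) \<le> C" and D: "\<And>n. energy (\<phi> n) \<le> C"
  obtains s where "strict_mono (s :: nat \<Rightarrow> nat)"
    "\<And>e. e > 0 \<Longrightarrow> \<exists>N. \<forall>m\<ge>N. \<forall>n\<ge>N. sq_norm (\<lambda>x. \<phi> (s m) x - \<phi> (s n) x) < e"
proof -
  define P where "P k s \<longleftrightarrow> (\<exists>N. \<forall>m\<ge>N. \<forall>n\<ge>N. sq_norm (\<lambda>x. \<phi> (s m) x - \<phi> (s n) x) < inverse (real (Suc k)))"
    for k and s :: "nat \<Rightarrow> nat"
  interpret subseqs P
  proof
    fix n :: nat and s :: "nat \<Rightarrow> nat"
    show "\<exists>r'. strict_mono r' \<and> P n (s \<circ> r')"
      using rellich_approximate[of "\<lambda>j. \<phi> (s j)", OF \<phi> r S D, of "inverse (real (Suc n))"] by (auto simp: P_def)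
  qed
  have stable: "P n (s \<circ> r)" if "strict_mono r" "P n s" for r s :: "nat \<Rightarrow> nat" and n
  proof -
    obtain N where "\<forall>m\<ge>N. \<forall>k\<ge>N. sq_norm (\<lambda>x. \<phi> (s m) x - \<phi> (s k) x) < inverse (real (Suc n))"
      using \<open>P n s\<close> unfolding P_def by blast
    then show ?thesis unfolding P_def
      using order_trans[OF _ seq_suble[OF \<open>strict_mono r\<close>]] by (intro exI[of _ N]) auto
  qed
  have "\<exists>N. \<forall>m\<ge>N. \<forall>n\<ge>N. sq_norm (\<lambda>x. \<phi> (diagseq m) x - \<phi> (diagseq n) x) < e" if e: "e > 0" for e
  proof -
    obtain k where k: "inverse (real (Suc k)) < e" using reals_Archimedean[OF e] by blast
    obtain N where N: "\<forall>m\<ge>N. \<forall>n\<ge>N. sq_norm (\<lambda>x. \<phi> (diagseq (Suc k + m)) x - \<phi> (diagseq (Suc k + n)) x) < inverse (real (Suc k))"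
      using diagseq_holds[of k, OF stable] unfolding P_def comp_def by blast
    have "sq_norm (\<lambda>x. \<phi> (diagseq m) x - \<phi> (diagseq n) x) < e" if "m \<ge> Suc k + N" "n \<ge> Suc k + N" for m n
    proof -
      have "m - Suc k \<ge> N" "n - Suc k \<ge> N" using that by auto
      then have "sq_norm (\<lambda>x. \<phi> (diagseq (Suc k + (m - Suc k))) x - \<phi> (diagseq (Suc k + (n - Suc k))) x) < inverse (real (Suc k))"
        using N by blast
      then show ?thesis using that k by simp
    qed
    then show ?thesis by blast
  qed
  with subseq_diagseq show thesis by (rule that)
qed

section \<open>Integrals over an open set\<close>

lemma lebesgue_on_measurable:
  "f \<in> borel_measurable borel \<Longrightarrow> f \<in> borel_measurable (lebesgue_on \<Omega>)"
  by (intro measurable_restrict_space1 measurable_completion) simp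

lemma integral_lebesgue_on:
  fixes f :: "'a::euclidean_space \<Rightarrow> real"
  assumes "open \<Omega>" "f \<in> borel_measurable borel" "\<And>x. x \<notin> \<Omega> \<Longrightarrow> f x = 0"
  shows "(LINT x|lebesgue_on \<Omega>. f x) = (\<integral>x. f x \<partial>lborel)"
    "integrable (lebesgue_on \<Omega>) f \<longleftrightarrow> integrable lborel f"
proof -
  have "(\<lambda>x. indicator \<Omega> x *\<^sub>R f x) = f"
  proof
    fix x show "indicator \<Omega> x *\<^sub>R f x = f x"
      using assms(3)[of x] by (cases "x \<in> \<Omega>") auto
  qed
  then show "(LINT x|lebesgue_on \<Omega>. f x) = (\<integral>x. f x \<partial>lborel)"
    "integrable (lebesgue_on \<Omega>) f \<longleftrightarrow> integrable lborel f"
    using assms(1,2)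
    by (simp_all add: integral_restrict_space integrable_restrict_space integral_completion integrable_completion)
qed

lemma integrable_lebesgue_on_if_L2:
  fixes f :: "'a::euclidean_space \<Rightarrow> real"
  assumes "open \<Omega>" "bounded \<Omega>" and [measurable]: "f \<in> borel_measurable (lebesgue_on \<Omega>)"
    and "integrable (lebesgue_on \<Omega>) (\<lambda>x. (f x)\<^sup>2)"
  shows "integrable (lebesgue_on \<Omega>) f"
proof (rule Bochner_Integration.integrable_bound)
  interpret finite_measure "lebesgue_on \<Omega>"
    using assms by (intro finite_measure_lebesgue_on bounded_set_imp_lmeasurable) auto
  show "integrable (lebesgue_on \<Omega>) (\<lambda>x. (f x)\<^sup>2 + 1)" using assms(4) by simp
  show "AE x in lebesgue_on \<Omega>. norm (f x) \<le> norm ((f x)\<^sup>2 + 1)"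
    using abs_inner_le_squares[of 1 "f x" "1::real" for x] by (intro AE_I2) simp
qed fact

lemma locally_integrable_if_integrable:
  fixes f :: "'a::euclidean_space \<Rightarrow> real"
  assumes "open \<Omega>" "integrable (lebesgue_on \<Omega>) f"
  shows "locally_integrable \<Omega> f"
  unfolding locally_integrable_def
proof (intro conjI allI impI)
  show "f \<in> borel_measurable (lebesgue_on \<Omega>)" using assms by simp
  fix C assume C: "compact C \<and> C \<subseteq> \<Omega>"
  have Cm: "C \<in> sets lebesgue" using C by (simp add: borel_compact)
  have "\<Omega> \<inter> space lebesgue \<in> sets lebesgue" using assms(1) by simp
  then have "integrable lebesgue (\<lambda>x. indicator \<Omega> x *\<^sub>R f x)"
    using assms(2) by (rule integrable_restrict_space[THEN iffD1])
  then have "integrable lebesgue (\<lambda>x. indicator C x *\<^sub>R (indicator \<Omega> x *\<^sub>R f x))"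
    by (rule integrable_mult_indicator[OF Cm])
  moreover have "(\<lambda>x. indicator C x *\<^sub>R (indicator \<Omega> x *\<^sub>R f x)) = (\<lambda>x. indicator C x *\<^sub>R f x)"
    using C by (auto simp: fun_eq_iff indicator_def)
  ultimately have "integrable lebesgue (\<lambda>x. indicator C x *\<^sub>R f x)" by simp
  then show "integrable (lebesgue_on C) f"
    by (rule integrable_restrict_space[THEN iffD2, rotated]) (use Cm in simp)
qed

lemma in_Lp_2_iff: "in_Lp 2 \<Omega> f \<longleftrightarrow> f \<in> borel_measurable (lebesgue_on \<Omega>) \<and>
    integrable (lebesgue_on \<Omega>) (\<lambda>x. (f x)\<^sup>2)"
proof -
  have "\<bar>f x\<bar> powr 2 = (f x)\<^sup>2" for x by (cases "f x = 0") (simp_all add: powr_numeral)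
  then show ?thesis by (simp add: in_Lp_def)
qed

section \<open>The first eigenvalue minimises the Rayleigh quotient\<close>

lemma energy_add_scaled:
  assumes "\<phi> \<in> test_functions \<Omega>" "\<psi> \<in> test_functions \<Omega>"
  shows "energy (\<lambda>x. \<phi> x + t * \<psi> x) = energy \<phi> + 2 * t * (\<integral>x. grad \<phi> x \<bullet> grad \<psi> x \<partial>lborel) + t\<^sup>2 * energy \<psi>"
    and "sq_norm (\<lambda>x. \<phi> x + t * \<psi> x) = sq_norm \<phi> + 2 * t * (\<integral>x. \<phi> x * \<psi> x \<partial>lborel) + t\<^sup>2 * sq_norm \<psi>"
proof -
  note sm = test_smooth[OF assms(1)] test_smooth[OF assms(2)]
  note [measurable] = smooth_measurable[OF sm(1)] smooth_measurable[OF sm(2)]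
    grad_measurable[OF sm(1)] grad_measurable[OF sm(2)]
  note sq = test_integrable_squares[OF assms(1)] test_integrable_squares[OF assms(2)]
  have i: "integrable lborel (\<lambda>x. grad \<phi> x \<bullet> grad \<psi> x)" by (rule L2_inner) (use sq in auto)
  have j: "integrable lborel (\<lambda>x. \<phi> x * \<psi> x)"
    using L2_inner[of \<phi> lborel \<psi>] sq by simp
  have expand: "(norm (a + t *\<^sub>R b))\<^sup>2 = (norm a)\<^sup>2 + 2 * t * (a \<bullet> b) + t\<^sup>2 * (norm b)\<^sup>2" for a b :: 'a
    unfolding power2_norm_eq_inner
    by (simp add: inner_add_left inner_add_right inner_commute power2_eq_square algebra_simps)
  have "energy (\<lambda>x. \<phi> x + t * \<psi> x)
      = (\<integral>x. (norm (grad \<phi> x))\<^sup>2 + 2 * t * (grad \<phi> x \<bullet> grad \<psi> x) + t\<^sup>2 * (norm (grad \<psi> x))\<^sup>2 \<partial>lborel)"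
    unfolding energy_def grad_add[OF sm(1) smooth_cmult[OF sm(2)]] grad_cmult[OF sm(2)] expand ..
  then show "energy (\<lambda>x. \<phi> x + t * \<psi> x) = energy \<phi> + 2 * t * (\<integral>x. grad \<phi> x \<bullet> grad \<psi> x \<partial>lborel) + t\<^sup>2 * energy \<psi>"
    using i sq by (simp add: energy_def)
  have "sq_norm (\<lambda>x. \<phi> x + t * \<psi> x)
      = (\<integral>x. (\<phi> x)\<^sup>2 + 2 * t * (\<phi> x * \<psi> x) + t\<^sup>2 * (\<psi> x)\<^sup>2 \<partial>lborel)"
    unfolding sq_norm_def
    by (intro Bochner_Integration.integral_cong refl) (simp add: power2_eq_square algebra_simps)
  then show "sq_norm (\<lambda>x. \<phi> x + t * \<psi> x) = sq_norm \<phi> + 2 * t * (\<integral>x. \<phi> x * \<psi> x \<partial>lborel) + t\<^sup>2 * sq_norm \<psi>"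
    using j sq by (simp add: sq_norm_def)
qed

lemma parallelogram:
  assumes "\<phi> \<in> test_functions \<Omega>" "\<psi> \<in> test_functions \<Omega>"
  shows "energy (\<lambda>x. \<phi> x - \<psi> x) = 2 * energy \<phi> + 2 * energy \<psi> - energy (\<lambda>x. \<phi> x + \<psi> x)"
    and "sq_norm (\<lambda>x. \<phi> x - \<psi> x) = 2 * sq_norm \<phi> + 2 * sq_norm \<psi> - sq_norm (\<lambda>x. \<phi> x + \<psi> x)"
  using energy_add_scaled[OF assms, of 1] energy_add_scaled[OF assms, of "-1"] by simp_all

lemma test_lebesgue_on:
  assumes "open \<Omega>" and \<phi>: "\<phi> \<in> test_functions \<Omega>"
  shows "\<phi> \<in> borel_measurable (lebesgue_on \<Omega>)" "grad \<phi> \<in> borel_measurable (lebesgue_on \<Omega>)"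
    "integrable (lebesgue_on \<Omega>) (\<lambda>x. (\<phi> x)\<^sup>2)" "integrable (lebesgue_on \<Omega>) (\<lambda>x. (norm (grad \<phi> x))\<^sup>2)"
    "(LINT x|lebesgue_on \<Omega>. (\<phi> x)\<^sup>2) = sq_norm \<phi>" "(LINT x|lebesgue_on \<Omega>. (norm (grad \<phi> x))\<^sup>2) = energy \<phi>"
proof -
  note [measurable] = smooth_measurable[OF test_smooth[OF \<phi>]] grad_measurable[OF test_smooth[OF \<phi>]]
  have 1: "(\<lambda>x. (\<phi> x)\<^sup>2) \<in> borel_measurable borel" "(\<lambda>x. (norm (grad \<phi> x))\<^sup>2) \<in> borel_measurable borel"
    by measurable
  show "\<phi> \<in> borel_measurable (lebesgue_on \<Omega>)" "grad \<phi> \<in> borel_measurable (lebesgue_on \<Omega>)"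
    by (intro lebesgue_on_measurable; measurable)+
  show "integrable (lebesgue_on \<Omega>) (\<lambda>x. (\<phi> x)\<^sup>2)" "integrable (lebesgue_on \<Omega>) (\<lambda>x. (norm (grad \<phi> x))\<^sup>2)"
    "(LINT x|lebesgue_on \<Omega>. (\<phi> x)\<^sup>2) = sq_norm \<phi>" "(LINT x|lebesgue_on \<Omega>. (norm (grad \<phi> x))\<^sup>2) = energy \<phi>"
    using integral_lebesgue_on[OF assms(1) 1(1)] integral_lebesgue_on[OF assms(1) 1(2)]
      test_integrable_squares[OF \<phi>] test_outside[OF \<phi>] grad_outside[OF \<phi>]
    by (auto simp: sq_norm_def energy_def)
qed

lemma exists_test_function:
  assumes "open \<Omega>" "\<Omega> \<noteq> {}"
  obtains \<phi> where "\<phi> \<in> test_functions \<Omega>" "sq_norm \<phi> > 0"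
proof -
  obtain a where "a \<in> \<Omega>" using assms by blast
  then obtain d where d: "d > 0" "cball a d \<subseteq> \<Omega>" using assms(1) open_contains_cball by blast
  define \<phi> where "\<phi> x = bump d (a - x)" for x
  have sm: "smooth \<phi>"
    unfolding \<phi>_def by (rule smooth_reflect(1)[OF test_smooth[OF bump_test[OF d(1)]]])
  have t: "\<phi> \<in> test_functions \<Omega>"
  proof (rule test_functionsI[OF sm compact_cball d(2)])
    show "\<phi> x = 0" if "x \<notin> cball a d" for x
      unfolding \<phi>_def using that by (intro bump_zero d) (simp add: dist_norm)
  qed
  have "sq_norm \<phi> \<noteq> 0"
  proof
    assume "sq_norm \<phi> = 0"
    then have "AE x in lborel. (\<phi> x)\<^sup>2 = 0"
      unfolding sq_norm_def
      by (subst (asm) integral_nonneg_eq_0_iff_AE) (use test_integrable_squares[OF t] in auto)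
    then have "\<exists>x\<in>ball a d. (\<phi> x)\<^sup>2 = 0" using d(1) by (intro open_AE_ex) auto
    then obtain x where "x \<in> ball a d" "\<phi> x = 0" by auto
    then show False using bump_pos[OF d(1), of "a - x"] by (simp add: \<phi>_def dist_norm)
  qed
  then show thesis using that[OF t] sq_norm_nonneg[of \<phi>] by simp
qed

text \<open>
  The Poincare inequality bounds the quotients from below by a positive constant; scaling normalises
  the denominator.
\<close>

lemma exists_minimising_sequence:
  fixes \<Omega> :: "'a::euclidean_space set"
  assumes "open \<Omega>" "\<Omega> \<noteq> {}" "bounded \<Omega>"
  obtains R \<phi> where "R > 0" "\<And>\<psi>. \<psi> \<in> test_functions \<Omega> \<Longrightarrow> R * sq_norm \<psi> \<le> energy \<psi>"
    "\<And>n. \<phi> n \<in> test_functions \<Omega>" "\<And>n. sq_norm (\<phi> n) = 1" "\<And>n. energy (\<phi> n) < R + inverse (real (Suc n))"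
proof -
  obtain r where r: "r > 0" "\<Omega> \<subseteq> cball 0 r"
    using bounded_subset_ballD[OF assms(3), of 0] ball_subset_cball by blast
  define Q where "Q = {energy \<phi> / sq_norm \<phi> | \<phi>. \<phi> \<in> test_functions \<Omega> \<and> sq_norm \<phi> > 0}"
  have ne: "Q \<noteq> {}" using exists_test_function[OF assms(1,2)] unfolding Q_def by blast
  have lb: "q \<ge> 1 / (4 * r\<^sup>2)" if q: "q \<in> Q" for q
  proof -
    obtain \<phi> where \<phi>: "\<phi> \<in> test_functions \<Omega>" "sq_norm \<phi> > 0" "q = energy \<phi> / sq_norm \<phi>"
      using q by (auto simp: Q_def)
    have "sq_norm \<phi> \<le> 4 * r\<^sup>2 * energy \<phi>"
      using poincare_inequality[OF \<phi>(1) r(2)] by (simp add: sq_norm_def energy_def)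
    then have "1 / (4 * r\<^sup>2) * sq_norm \<phi> \<le> energy \<phi>"
      using r(1) by (simp add: divide_le_eq mult.commute)
    then show ?thesis unfolding \<phi>(3) using \<phi>(2) by (subst pos_le_divide_eq)
  qed
  have bdd: "bdd_below Q" using lb by (rule bdd_belowI)
  define R where "R = Inf Q"
  have "R \<ge> 1 / (4 * r\<^sup>2)" unfolding R_def by (rule cInf_greatest[OF ne lb])
  moreover have "1 / (4 * r\<^sup>2) > 0" using r(1) by simp
  ultimately have R0: "R > 0" by linarith
  have R1: "R * sq_norm \<psi> \<le> energy \<psi>" if "\<psi> \<in> test_functions \<Omega>" for \<psi>
  proof (cases "sq_norm \<psi> > 0")
    case True
    then have "R \<le> energy \<psi> / sq_norm \<psi>"
      unfolding R_def using that by (intro cInf_lower[OF _ bdd]) (auto simp: Q_def)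
    then show ?thesis using True by (simp add: field_simps)
  next
    case False
    then show ?thesis using sq_norm_nonneg[of \<psi>] energy_nonneg[of \<psi>] by simp
  qed
  have "\<exists>\<phi>. \<phi> \<in> test_functions \<Omega> \<and> sq_norm \<phi> = 1 \<and> energy \<phi> < R + inverse (real (Suc n))" for n
  proof -
    have "Inf Q < R + inverse (real (Suc n))" by (simp add: R_def)
    then obtain q where "q \<in> Q" "q < R + inverse (real (Suc n))"
      using cInf_lessD[OF ne] by blast
    then obtain \<phi> where \<phi>: "\<phi> \<in> test_functions \<Omega>" "sq_norm \<phi> > 0"
      "energy \<phi> / sq_norm \<phi> < R + inverse (real (Suc n))" by (auto simp: Q_def)
    define c where "c = 1 / sqrt (sq_norm \<phi>)"
    have c: "c\<^sup>2 = 1 / sq_norm \<phi>" using \<phi>(2) by (simp add: c_def power_divide)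
    show ?thesis
      using \<phi>(2,3)
      by (intro exI[of _ "\<lambda>x. c * \<phi> x"] conjI test_cmult[OF \<phi>(1)])
         (simp_all add: sq_norm_cmult energy_cmult[OF test_smooth[OF \<phi>(1)]] c del: of_nat_Suc)
  qed
  then obtain \<phi> where "\<And>n. \<phi> n \<in> test_functions \<Omega>" "\<And>n. sq_norm (\<phi> n) = 1"
    "\<And>n. energy (\<phi> n) < R + inverse (real (Suc n))" by metis
  with R0 R1 show thesis by (rule that)
qed

text \<open>
  The parallelogram identity turns convergence of the quotients and of the functions in the mean
  into convergence of the gradients in the mean.
\<close>

lemma minimising_sequence_Cauchy:
  fixes \<Omega> :: "'a::euclidean_space set"
  assumes "open \<Omega>" "\<Omega> \<noteq> {}" "bounded \<Omega>"
  obtains R \<phi> where "R > 0" "\<And>\<psi>. \<psi> \<in> test_functions \<Omega> \<Longrightarrow> R * sq_norm \<psi> \<le> energy \<psi>"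
    "\<And>n. \<phi> n \<in> test_functions \<Omega>" "\<And>n. sq_norm (\<phi> n) = 1" "(\<lambda>n. energy (\<phi> n)) \<longlonglongrightarrow> R"
    "\<And>e. e > 0 \<Longrightarrow> \<exists>N. \<forall>m\<ge>N. \<forall>n\<ge>N. sq_norm (\<lambda>x. \<phi> m x - \<phi> n x) + energy (\<lambda>x. \<phi> m x - \<phi> n x) < e"
proof -
  obtain r where r: "r > 0" "\<Omega> \<subseteq> cball 0 r"
    using bounded_subset_ballD[OF assms(3), of 0] ball_subset_cball by blast
  obtain R \<phi>' where R: "R > 0" "\<And>\<psi>. \<psi> \<in> test_functions \<Omega> \<Longrightarrow> R * sq_norm \<psi> \<le> energy \<psi>"
    and \<phi>': "\<And>n. \<phi>' n \<in> test_functions \<Omega>" "\<And>n. sq_norm (\<phi>' n) = 1" "\<And>n. energy (\<phi>' n) < R + inverse (real (Suc n))"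
    using exists_minimising_sequence[OF assms] by metis
  have bd: "sq_norm (\<phi>' n) \<le> R + 1" "energy (\<phi>' n) \<le> R + 1" for n
  proof -
    have "inverse (real (Suc n)) \<le> 1" by (simp add: inverse_le_1_iff)
    then show "sq_norm (\<phi>' n) \<le> R + 1" "energy (\<phi>' n) \<le> R + 1"
      using R(1) \<phi>'(2)[of n] \<phi>'(3)[of n] by linarith+
  qed
  obtain s where s: "strict_mono (s :: nat \<Rightarrow> nat)"
    "\<And>e. e > 0 \<Longrightarrow> \<exists>N. \<forall>m\<ge>N. \<forall>n\<ge>N. sq_norm (\<lambda>x. \<phi>' (s m) x - \<phi>' (s n) x) < e"
    by (rule rellich[of \<phi>', OF \<phi>'(1) r(2) bd]) (rule that)
  define \<phi> where "\<phi> n = \<phi>' (s n)" for n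
  have t: "\<phi> n \<in> test_functions \<Omega>" for n using \<phi>'(1) by (simp add: \<phi>_def)
  have one: "sq_norm (\<phi> n) = 1" for n using \<phi>'(2) by (simp add: \<phi>_def)
  have lim: "(\<lambda>n. energy (\<phi> n)) \<longlonglongrightarrow> R"
  proof (rule tendsto_sandwich[of "\<lambda>_. R" _ _ "\<lambda>n. R + inverse (real (Suc n))"])
    show "\<forall>\<^sub>F n in sequentially. R \<le> energy (\<phi> n)"
      using R(2)[OF t] one by (intro always_eventually) simp
    have "energy (\<phi> n) \<le> R + inverse (real (Suc n))" for n
    proof -
      have "inverse (real (Suc (s n))) \<le> inverse (real (Suc n))"
        using seq_suble[OF s(1), of n] by (intro le_imp_inverse_le) auto
      then show ?thesis unfolding \<phi>_def using \<phi>'(3)[of "s n"] by linarith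
    qed
    then show "\<forall>\<^sub>F n in sequentially. energy (\<phi> n) \<le> R + inverse (real (Suc n))"
      by (intro always_eventually) simp
    show "(\<lambda>n. R + inverse (real (Suc n))) \<longlonglongrightarrow> R"
      using tendsto_add[OF tendsto_const LIMSEQ_inverse_real_of_nat, of R] by simp
  qed simp
  \<comment> \<open>\<open>R * sq_norm\<close> is a lower bound for the energy of the sum in the parallelogram identity.\<close>
  have par: "energy (\<lambda>x. \<phi> m x - \<phi> n x) \<le> 2 * (energy (\<phi> m) - R) + 2 * (energy (\<phi> n) - R)
      + R * sq_norm (\<lambda>x. \<phi> m x - \<phi> n x)" for m n
  proof -
    have "R * sq_norm (\<lambda>x. \<phi> m x + \<phi> n x) = 4 * R - R * sq_norm (\<lambda>x. \<phi> m x - \<phi> n x)"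
      unfolding parallelogram(2)[OF t t, of m n] one by (simp add: algebra_simps)
    then show ?thesis
      using parallelogram(1)[OF t t, of m n] R(2)[OF test_add[OF t t], of m n] by simp
  qed
  have "\<exists>N. \<forall>m\<ge>N. \<forall>n\<ge>N. sq_norm (\<lambda>x. \<phi> m x - \<phi> n x) + energy (\<lambda>x. \<phi> m x - \<phi> n x) < e" if e: "e > 0" for e
  proof -
    have "e / (2 * (1 + R)) > 0" using e R(1) by simp
    then obtain N1 where N1: "\<forall>m\<ge>N1. \<forall>n\<ge>N1. sq_norm (\<lambda>x. \<phi> m x - \<phi> n x) < e / (2 * (1 + R))"
      using s(2) unfolding \<phi>_def by blast
    obtain N2 where N2: "\<And>n. n \<ge> N2 \<Longrightarrow> energy (\<phi> n) < R + e / 8"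
      using order_tendstoD(2)[OF lim, of "R + e / 8"] e by (auto simp: eventually_sequentially)
    have "sq_norm (\<lambda>x. \<phi> m x - \<phi> n x) + energy (\<lambda>x. \<phi> m x - \<phi> n x) < e" if mn: "m \<ge> max N1 N2" "n \<ge> max N1 N2" for m n
    proof -
      have "sq_norm (\<lambda>x. \<phi> m x - \<phi> n x) < e / (2 * (1 + R))" using N1 mn by auto
      then have "(1 + R) * sq_norm (\<lambda>x. \<phi> m x - \<phi> n x) < e / 2" using R(1) by (simp add: field_simps)
      then show ?thesis using par[of m n] N2[of m] N2[of n] mn by (simp add: algebra_simps)
    qed
    then show ?thesis by blast
  qed
  with R t one lim show thesis by (rule that)
qed

text \<open>
  The pairs of a function and its gradient form a Cauchy sequence in the mean, which converges to a
  pair \<open>(v, G)\<close>. The limit of \<open>energy (\<phi>\<^sub>n + s \<psi>) - R * sq_norm (\<phi>\<^sub>n + s \<psi>)\<close> is a nonnegative quadratic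
  polynomial in \<open>s\<close> without constant term, so its linear coefficient is zero: this is the eigenvalue
  equation.
\<close>

lemma rayleigh_minimiser:
  fixes \<Omega> :: "'a::euclidean_space set"
  assumes \<Omega>: "open \<Omega>" "\<Omega> \<noteq> {}" "bounded \<Omega>"
  obtains R where "R > 0" "\<And>\<psi>. \<psi> \<in> test_functions \<Omega> \<Longrightarrow> R * sq_norm \<psi> \<le> energy \<psi>" "dirichlet_eigenvalue \<Omega> R"
proof -
  obtain R and \<phi> :: "nat \<Rightarrow> 'a \<Rightarrow> real" where
    R: "R > 0" "\<And>\<psi>. \<psi> \<in> test_functions \<Omega> \<Longrightarrow> R * sq_norm \<psi> \<le> energy \<psi>"
    and t: "\<And>n. \<phi> n \<in> test_functions \<Omega>" and one: "\<And>n. sq_norm (\<phi> n) = 1"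
    and lim: "(\<lambda>n. energy (\<phi> n)) \<longlonglongrightarrow> R"
    and Cauchy: "\<And>e. e > 0 \<Longrightarrow> \<exists>N. \<forall>m\<ge>N. \<forall>n\<ge>N. sq_norm (\<lambda>x. \<phi> m x - \<phi> n x) + energy (\<lambda>x. \<phi> m x - \<phi> n x) < e"
    by (rule minimising_sequence_Cauchy[OF \<Omega>]) (rule that)
  define M where "M = lebesgue_on \<Omega>"
  define f where "f n x = (\<phi> n x, grad (\<phi> n) x)" for n x
  have sm: "smooth \<psi>" "\<psi> \<in> borel_measurable borel" "grad \<psi> \<in> borel_measurable borel"
    if "\<psi> \<in> test_functions \<Omega>" for \<psi>
    using test_smooth[OF that] by (auto intro: smooth_measurable grad_measurable)
  note mM = test_lebesgue_on(1,2)[OF \<Omega>(1), folded M_def]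
  note sqM = test_lebesgue_on(3-6)[OF \<Omega>(1), folded M_def]
  have nP: "(norm (a, b))\<^sup>2 = a\<^sup>2 + (norm b)\<^sup>2" for a :: real and b :: 'a by (simp add: norm_Pair)
  have fm: "f n \<in> borel_measurable M" for n
    unfolding f_def[abs_def] using mM[OF t] by (intro borel_measurable_Pair)
  have f2: "integrable M (\<lambda>x. (norm (f n x))\<^sup>2)" for n
    unfolding f_def nP using sqM[OF t] by simp
  have fC: "\<exists>N. \<forall>m\<ge>N. \<forall>n\<ge>N. (\<integral>x. (norm (f m x - f n x))\<^sup>2 \<partial>M) < e" if "e > 0" for e
  proof -
    have "(\<integral>x. (norm (f m x - f n x))\<^sup>2 \<partial>M) = sq_norm (\<lambda>x. \<phi> m x - \<phi> n x) + energy (\<lambda>x. \<phi> m x - \<phi> n x)" for m n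
    proof -
      have "(norm (f m x - f n x))\<^sup>2 = (\<phi> m x - \<phi> n x)\<^sup>2 + (norm (grad (\<lambda>x. \<phi> m x - \<phi> n x) x))\<^sup>2" for x
        unfolding f_def diff_Pair nP grad_diff[OF sm(1)[OF t] sm(1)[OF t]] ..
      then show ?thesis using sqM[OF test_diff[OF t t], of m n] by simp
    qed
    then show ?thesis using Cauchy[OF that] by simp
  qed
  obtain g where g: "g \<in> borel_measurable M" "integrable M (\<lambda>x. (norm (g x))\<^sup>2)"
    "\<And>n. integrable M (\<lambda>x. (norm (f n x - g x))\<^sup>2)"
    "(\<lambda>n. \<integral>x. (norm (f n x - g x))\<^sup>2 \<partial>M) \<longlonglongrightarrow> 0"
    by (rule L2_complete[of f M, OF fm f2 fC]) (assumption, rule that)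
  define v where "v x = fst (g x)" for x
  define G where "G x = snd (g x)" for x
  have gv: "g x = (v x, G x)" for x by (simp add: v_def G_def)
  have vm [measurable]: "v \<in> borel_measurable M" "G \<in> borel_measurable M"
    unfolding v_def[abs_def] G_def[abs_def]
    using g(1) by (auto intro: measurable_compose[OF _ borel_measurable_continuous_onI[OF continuous_on_fst[OF continuous_on_id]]]
        measurable_compose[OF _ borel_measurable_continuous_onI[OF continuous_on_snd[OF continuous_on_id]]])
  have v2: "integrable M (\<lambda>x. (v x)\<^sup>2)"
    by (rule Bochner_Integration.integrable_bound[OF g(2)]) (auto simp: gv nP)
  have G2: "integrable M (\<lambda>x. (G x \<bullet> i)\<^sup>2)" if "i \<in> Basis" for i
  proof (rule Bochner_Integration.integrable_bound[OF g(2)])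
    have "(G x \<bullet> i)\<^sup>2 \<le> (norm (G x))\<^sup>2" for x
      using power_mono[OF Basis_le_norm[OF that, of "G x"], of 2] by simp
    then show "AE x in M. norm ((G x \<bullet> i)\<^sup>2) \<le> norm ((norm (g x))\<^sup>2)"
      by (intro AE_I2) (simp add: gv nP add_increasing)
  qed measurable
  have limv: "(\<lambda>n. \<integral>x. \<phi> n x * \<psi> x \<partial>M) \<longlonglongrightarrow> (\<integral>x. v x * \<psi> x \<partial>M)" if \<psi>: "\<psi> \<in> test_functions \<Omega>" for \<psi>
  proof -
    have "(\<lambda>n. \<integral>x. f n x \<bullet> (\<psi> x, 0) \<partial>M) \<longlonglongrightarrow> (\<integral>x. g x \<bullet> (\<psi> x, 0) \<partial>M)"
      by (rule L2_tendsto_inner[OF fm g(1) _ g(2) _ g(3,4)])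
         (use mM[OF \<psi>] sqM[OF \<psi>] in \<open>auto simp: nP intro: borel_measurable_Pair\<close>)
    then show ?thesis by (simp add: f_def gv)
  qed
  have limG: "(\<lambda>n. \<integral>x. grad (\<phi> n) x \<bullet> X x \<partial>M) \<longlonglongrightarrow> (\<integral>x. G x \<bullet> X x \<partial>M)"
    if "X \<in> borel_measurable M" "integrable M (\<lambda>x. (norm (X x))\<^sup>2)" for X
  proof -
    have "(\<lambda>n. \<integral>x. f n x \<bullet> (0, X x) \<partial>M) \<longlonglongrightarrow> (\<integral>x. g x \<bullet> (0, X x) \<partial>M)"
      by (rule L2_tendsto_inner[OF fm g(1) _ g(2) _ g(3,4)])
         (use that in \<open>auto simp: nP intro: borel_measurable_Pair\<close>)
    then show ?thesis by (simp add: f_def gv)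
  qed
  have wg: "has_weak_gradient \<Omega> v G"
    unfolding has_weak_gradient_def has_weak_partial_def
  proof (intro ballI conjI)
    fix i :: 'a assume i: "i \<in> Basis"
    show "locally_integrable \<Omega> v"
      by (rule locally_integrable_if_integrable[OF \<Omega>(1) integrable_lebesgue_on_if_L2[OF \<Omega>(1,3)
            vm(1)[unfolded M_def] v2[unfolded M_def]]])
    have Gi: "(\<lambda>x. G x \<bullet> i) \<in> borel_measurable M" by measurable
    show "locally_integrable \<Omega> (\<lambda>x. G x \<bullet> i)"
      by (rule locally_integrable_if_integrable[OF \<Omega>(1) integrable_lebesgue_on_if_L2[OF \<Omega>(1,3)
            Gi[unfolded M_def] G2[OF i, unfolded M_def]]])
    fix \<psi> assume \<psi>: "\<psi> \<in> test_functions \<Omega>"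
    have \<psi>U: "\<psi> \<in> test_functions UNIV" using test_functions_mono[OF \<psi>] by simp
    note [measurable] = sm[OF \<psi>] mM[OF \<psi>]
    have eq: "(\<integral>x. \<phi> n x * partial i \<psi> x \<partial>M) = - (\<integral>x. grad (\<phi> n) x \<bullet> (\<psi> x *\<^sub>R i) \<partial>M)" for n
    proof -
      note [measurable] = sm[OF t] sm(2)[OF test_partial[OF t i]] sm(2)[OF test_partial[OF \<psi> i]]
      have "(\<integral>x. \<phi> n x * partial i \<psi> x \<partial>M) = (\<integral>x. \<phi> n x * partial i \<psi> x \<partial>lborel)"
        unfolding M_def by (rule integral_lebesgue_on[OF \<Omega>(1)]) (auto simp: test_outside[OF t])
      also have "\<dots> = - (\<integral>x. partial i (\<phi> n) x * \<psi> x \<partial>lborel)"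
        by (rule integration_by_parts[OF \<psi>U sm(1)[OF t] i])
      also have "(\<integral>x. partial i (\<phi> n) x * \<psi> x \<partial>lborel) = (\<integral>x. partial i (\<phi> n) x * \<psi> x \<partial>M)"
        unfolding M_def by (rule integral_lebesgue_on(1)[symmetric, OF \<Omega>(1)]) (auto simp: test_outside[OF \<psi>])
      finally show ?thesis by (simp add: grad_inner_Basis[OF i] mult.commute)
    qed
    have "(\<lambda>n. \<integral>x. \<phi> n x * partial i \<psi> x \<partial>M) \<longlonglongrightarrow> (\<integral>x. v x * partial i \<psi> x \<partial>M)"
      by (rule limv[OF test_partial[OF \<psi> i]])
    moreover have "(\<lambda>n. - (\<integral>x. grad (\<phi> n) x \<bullet> (\<psi> x *\<^sub>R i) \<partial>M)) \<longlonglongrightarrow> - (\<integral>x. G x \<bullet> (\<psi> x *\<^sub>R i) \<partial>M)"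
      by (intro tendsto_minus limG) (use sqM[OF \<psi>] i in \<open>auto simp: power_mult_distrib\<close>)
    ultimately have "(\<integral>x. v x * partial i \<psi> x \<partial>M) = - (\<integral>x. G x \<bullet> (\<psi> x *\<^sub>R i) \<partial>M)"
      unfolding eq by (rule LIMSEQ_unique)
    then show "(LINT x|lebesgue_on \<Omega>. v x * partial i \<psi> x) = - (LINT x|lebesgue_on \<Omega>. (G x \<bullet> i) * \<psi> x)"
      by (simp add: M_def mult.commute)
  qed
  have "(\<lambda>n. \<integral>x. (v x - \<phi> n x)\<^sup>2 + (norm (G x - grad (\<phi> n) x))\<^sup>2 \<partial>M) \<longlonglongrightarrow> 0"
  proof -
    have "(norm (f n x - g x))\<^sup>2 = (v x - \<phi> n x)\<^sup>2 + (norm (G x - grad (\<phi> n) x))\<^sup>2" for n x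
      unfolding f_def gv diff_Pair nP by (simp add: norm_minus_commute power2_commute)
    then show ?thesis using g(4) by simp
  qed
  then have H10: "in_H10 \<Omega> v G"
    unfolding in_H10_def in_Lp_2_iff using wg vm v2 G2 t
    by (auto simp: M_def intro!: exI[of _ \<phi>])
  have nz: "\<not> (AE x in lebesgue_on \<Omega>. v x = 0)"
  proof
    assume "AE x in lebesgue_on \<Omega>. v x = 0"
    then have AE: "AE x in M. v x = 0" unfolding M_def .
    have "1 \<le> (\<integral>x. (norm (f n x - g x))\<^sup>2 \<partial>M)" for n
    proof -
      have "1 = (\<integral>x. (\<phi> n x)\<^sup>2 \<partial>M)" using sqM(3)[OF t] one by simp
      also have "\<dots> \<le> (\<integral>x. (norm (f n x - g x))\<^sup>2 \<partial>M)"
        by (rule integral_mono_AE[OF sqM(1)[OF t] g(3)]) (use AE in \<open>auto simp: f_def gv nP elim!: eventually_mono\<close>)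
      finally show ?thesis .
    qed
    then have "1 \<le> (0::real)" using LIMSEQ_le_const[OF g(4)] by blast
    then show False by simp
  qed
  have EL: "(\<integral>x. G x \<bullet> grad \<psi> x \<partial>M) = R * (\<integral>x. v x * \<psi> x \<partial>M)" if \<psi>: "\<psi> \<in> test_functions \<Omega>" for \<psi>
  proof -
    define A where "A = (\<integral>x. G x \<bullet> grad \<psi> x \<partial>M) - R * (\<integral>x. v x * \<psi> x \<partial>M)"
    define B where "B = energy \<psi> - R * sq_norm \<psi>"
    have ge: "0 \<le> 2 * s * A + s\<^sup>2 * B" for s
    proof -
      have trans: "(\<integral>x. grad (\<phi> n) x \<bullet> grad \<psi> x \<partial>lborel) = (\<integral>x. grad (\<phi> n) x \<bullet> grad \<psi> x \<partial>M)"
        "(\<integral>x. \<phi> n x * \<psi> x \<partial>lborel) = (\<integral>x. \<phi> n x * \<psi> x \<partial>M)" for n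
        unfolding M_def using sm[OF t] sm[OF \<psi>]
        by (auto intro!: integral_lebesgue_on(1)[symmetric, OF \<Omega>(1)] simp: test_outside[OF \<psi>] grad_outside[OF \<psi>])
      have "0 \<le> (energy (\<phi> n) - R) + 2 * s * ((\<integral>x. grad (\<phi> n) x \<bullet> grad \<psi> x \<partial>M) - R * (\<integral>x. \<phi> n x * \<psi> x \<partial>M)) + s\<^sup>2 * B" for n
        using R(2)[OF test_add[OF t[of n] test_cmult[OF \<psi>, of s]]]
        unfolding energy_add_scaled[OF t \<psi>] one trans B_def by (simp add: algebra_simps)
      moreover have "(\<lambda>n. (energy (\<phi> n) - R) + 2 * s * ((\<integral>x. grad (\<phi> n) x \<bullet> grad \<psi> x \<partial>M) - R * (\<integral>x. \<phi> n x * \<psi> x \<partial>M)) + s\<^sup>2 * B)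
          \<longlonglongrightarrow> (R - R) + 2 * s * A + s\<^sup>2 * B"
        unfolding A_def by (intro tendsto_intros lim limG limv \<psi> mM sqM)
      ultimately show ?thesis using LIMSEQ_le_const by fastforce
    qed
    have "A = 0"
    proof (rule ccontr)
      assume "A \<noteq> 0"
      define c where "c = \<bar>B\<bar> + 1"
      have c: "c > 0" "B \<le> c" by (auto simp: c_def)
      \<comment> \<open>This value makes the quadratic polynomial negative, as \<open>B \<le> c\<close>.\<close>
      define s where "s = - A / c"
      have "2 * s * A + s\<^sup>2 * B \<le> 2 * s * A + s\<^sup>2 * c" using c by (intro add_left_mono mult_left_mono) auto
      also have "\<dots> = - (A\<^sup>2 / c)"
        using c(1) by (simp add: s_def power2_eq_square field_simps)
      also have "\<dots> < 0" using \<open>A \<noteq> 0\<close> c(1) by simp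
      finally show False using ge[of s] by simp
    qed
    then show ?thesis by (simp add: A_def)
  qed
  have "dirichlet_eigenvalue \<Omega> R"
    unfolding dirichlet_eigenvalue_def using H10 nz EL by (auto simp: M_def)
  with R show thesis by (rule that)
qed

text \<open>Testing the eigenvalue equation with approximations of the eigenfunction itself.\<close>

lemma eigenvalue_ge_rayleigh:
  fixes \<Omega> :: "'a::euclidean_space set"
  assumes \<Omega>: "open \<Omega>" and R: "\<And>\<psi>. \<psi> \<in> test_functions \<Omega> \<Longrightarrow> R * sq_norm \<psi> \<le> energy \<psi>"
    and l: "dirichlet_eigenvalue \<Omega> l"
  shows "R \<le> l"
proof -
  define M where "M = lebesgue_on \<Omega>"
  obtain v G where H: "in_H10 \<Omega> v G" and nz: "\<not> (AE x in M. v x = 0)"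
    and EL: "\<And>\<psi>. \<psi> \<in> test_functions \<Omega> \<Longrightarrow> (\<integral>x. G x \<bullet> grad \<psi> x \<partial>M) = l * (\<integral>x. v x * \<psi> x \<partial>M)"
    using l unfolding dirichlet_eigenvalue_def M_def by blast
  obtain \<phi> where t: "\<And>n. \<phi> n \<in> test_functions \<Omega>"
    and lim: "(\<lambda>n. \<integral>x. (v x - \<phi> n x)\<^sup>2 + (norm (G x - grad (\<phi> n) x))\<^sup>2 \<partial>M) \<longlonglongrightarrow> 0"
    using H unfolding in_H10_def M_def by blast
  have vm [measurable]: "v \<in> borel_measurable M" and v2: "integrable M (\<lambda>x. (v x)\<^sup>2)"
    and Gi: "\<And>i. i \<in> Basis \<Longrightarrow> (\<lambda>x. G x \<bullet> i) \<in> borel_measurable M \<and> integrable M (\<lambda>x. (G x \<bullet> i)\<^sup>2)"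
    using H unfolding in_H10_def in_Lp_2_iff M_def by auto
  have Gm [measurable]: "G \<in> borel_measurable M"
    using Gi by (subst borel_measurable_euclidean_space) auto
  have G2: "integrable M (\<lambda>x. (norm (G x))\<^sup>2)"
  proof -
    have "integrable M (\<lambda>x. \<Sum>i\<in>Basis. (G x \<bullet> i)\<^sup>2)" using Gi by (intro Bochner_Integration.integrable_sum) auto
    moreover have "(norm (G x))\<^sup>2 = (\<Sum>i\<in>Basis. (G x \<bullet> i)\<^sup>2)" for x
      unfolding power2_norm_eq_inner by (subst euclidean_inner) (simp add: power2_eq_square)
    ultimately show ?thesis by simp
  qed
  note mM [measurable] = test_lebesgue_on(1,2)[OF \<Omega> t, folded M_def]
  note sqM = test_lebesgue_on(3-6)[OF \<Omega> t, folded M_def]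
  have dv: "integrable M (\<lambda>x. (norm (\<phi> n x - v x))\<^sup>2)" for n
    by (rule L2_diff) (use sqM v2 in auto)
  have dG: "integrable M (\<lambda>x. (norm (grad (\<phi> n) x - G x))\<^sup>2)" for n
    by (rule L2_diff) (use sqM G2 in auto)
  have sum: "(\<integral>x. (v x - \<phi> n x)\<^sup>2 + (norm (G x - grad (\<phi> n) x))\<^sup>2 \<partial>M)
      = (\<integral>x. (norm (\<phi> n x - v x))\<^sup>2 \<partial>M) + (\<integral>x. (norm (grad (\<phi> n) x - G x))\<^sup>2 \<partial>M)" for n
    using dv[of n] dG[of n] by (simp add: norm_minus_commute power2_commute)
  have limv: "(\<lambda>n. \<integral>x. (norm (\<phi> n x - v x))\<^sup>2 \<partial>M) \<longlonglongrightarrow> 0"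
    by (rule tendsto_sandwich[OF _ _ tendsto_const lim]) (auto simp: sum)
  have limG: "(\<lambda>n. \<integral>x. (norm (grad (\<phi> n) x - G x))\<^sup>2 \<partial>M) \<longlonglongrightarrow> 0"
    by (rule tendsto_sandwich[OF _ _ tendsto_const lim]) (auto simp: sum)
  have v2': "integrable M (\<lambda>x. (norm (v x))\<^sup>2)" using v2 by simp
  have a: "(\<lambda>n. \<integral>x. grad (\<phi> n) x \<bullet> G x \<partial>M) \<longlonglongrightarrow> (\<integral>x. G x \<bullet> G x \<partial>M)"
    by (rule L2_tendsto_inner[OF mM(2) Gm Gm G2 G2 dG limG])
  have "(\<lambda>n. \<integral>x. \<phi> n x \<bullet> v x \<partial>M) \<longlonglongrightarrow> (\<integral>x. v x \<bullet> v x \<partial>M)"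
    by (rule L2_tendsto_inner[OF mM(1) vm vm v2' v2' dv limv])
  then have b: "(\<lambda>n. l * (\<integral>x. \<phi> n x \<bullet> v x \<partial>M)) \<longlonglongrightarrow> l * (\<integral>x. v x \<bullet> v x \<partial>M)"
    by (rule tendsto_mult_left)
  have eq: "(\<integral>x. grad (\<phi> n) x \<bullet> G x \<partial>M) = l * (\<integral>x. \<phi> n x \<bullet> v x \<partial>M)" for n
    using EL[OF t] by (simp add: inner_commute mult.commute)
  have "(\<integral>x. G x \<bullet> G x \<partial>M) = l * (\<integral>x. v x \<bullet> v x \<partial>M)"
    by (rule LIMSEQ_unique[OF a[unfolded eq] b])
  then have GG: "(\<integral>x. (norm (G x))\<^sup>2 \<partial>M) = l * (\<integral>x. (v x)\<^sup>2 \<partial>M)"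
    unfolding power2_norm_eq_inner by (simp add: power2_eq_square)
  have "(\<lambda>n. energy (\<phi> n)) \<longlonglongrightarrow> (\<integral>x. (norm (G x))\<^sup>2 \<partial>M)"
    using L2_tendsto_norm[OF mM(2) Gm G2 dG limG] by (simp add: sqM)
  moreover have "(\<lambda>n. R * sq_norm (\<phi> n)) \<longlonglongrightarrow> R * (\<integral>x. (v x)\<^sup>2 \<partial>M)"
    using L2_tendsto_norm[OF mM(1) vm v2' dv limv] by (intro tendsto_intros) (simp add: sqM)
  ultimately have "R * (\<integral>x. (v x)\<^sup>2 \<partial>M) \<le> (\<integral>x. (norm (G x))\<^sup>2 \<partial>M)"
    using R[OF t] by (intro LIMSEQ_le) auto
  then have le: "R * (\<integral>x. (v x)\<^sup>2 \<partial>M) \<le> l * (\<integral>x. (v x)\<^sup>2 \<partial>M)" by (simp add: GG)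
  have "(\<integral>x. (v x)\<^sup>2 \<partial>M) \<noteq> 0"
    using nz v2 by (subst integral_nonneg_eq_0_iff_AE) auto
  moreover have "(\<integral>x. (v x)\<^sup>2 \<partial>M) \<ge> 0" by simp
  ultimately have "(\<integral>x. (v x)\<^sup>2 \<partial>M) > 0" by linarith
  then show ?thesis using le by simp
qed

lemma first_eigenvalue_rayleigh:
  fixes \<Omega> :: "'a::euclidean_space set"
  assumes \<Omega>: "open \<Omega>" "\<Omega> \<noteq> {}" "bounded \<Omega>"
  shows "first_dirichlet_eigenvalue \<Omega> > 0"
    "\<psi> \<in> test_functions \<Omega> \<Longrightarrow> first_dirichlet_eigenvalue \<Omega> * sq_norm \<psi> \<le> energy \<psi>"
proof -
  obtain R where R: "R > 0" "\<And>\<psi>. \<psi> \<in> test_functions \<Omega> \<Longrightarrow> R * sq_norm \<psi> \<le> energy \<psi>" "dirichlet_eigenvalue \<Omega> R"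
    using rayleigh_minimiser[OF \<Omega>] by metis
  have "first_dirichlet_eigenvalue \<Omega> = R"
    unfolding first_dirichlet_eigenvalue_def
    by (rule Least_equality[where P = "dirichlet_eigenvalue \<Omega>"])
       (rule R(3), rule eigenvalue_ge_rayleigh[of \<Omega> R, OF \<Omega>(1) R(2)])
  with R show "first_dirichlet_eigenvalue \<Omega> > 0"
    "\<psi> \<in> test_functions \<Omega> \<Longrightarrow> first_dirichlet_eigenvalue \<Omega> * sq_norm \<psi> \<le> energy \<psi>" by auto
qed

section \<open>Functions with bounded weak gradient vanishing at the boundary\<close>

lemma conv_moll_abs_le:
  fixes g :: "'a::euclidean_space \<Rightarrow> real"
  assumes \<delta>: "\<delta> > 0" and g: "integrable lborel g" "\<And>x. \<bar>g x\<bar> \<le> B"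
  shows "\<bar>conv g (moll \<delta>) x\<bar> \<le> B"
proof -
  have "\<bar>conv g (moll \<delta>) x\<bar> \<le> (\<integral>z. B * moll \<delta> (z::'a) \<partial>lborel)"
    unfolding conv_moll_shift[OF \<delta>] real_norm_def[symmetric]
  proof (rule order_trans[OF integral_norm_bound], rule integral_mono')
    show "norm (g (x + z) * moll \<delta> z) \<le> B * moll \<delta> z" for z
      using g(2)[of "x + z"] moll_nonneg[OF \<delta>, of z] by (auto simp: abs_mult intro: mult_right_mono)
    show "0 \<le> B * moll \<delta> (z::'a)" for z
      using order_trans[OF abs_ge_zero g(2)] moll_nonneg[OF \<delta>] by (intro mult_nonneg_nonneg)
  qed (use moll_integrable[OF \<delta>] in auto)
  then show ?thesis by (simp add: moll_integral[OF \<delta>])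
qed

definition conv_vec :: "('a::euclidean_space \<Rightarrow> 'a) \<Rightarrow> ('a \<Rightarrow> real) \<Rightarrow> 'a \<Rightarrow> 'a"
  where "conv_vec g \<rho> x = (\<Sum>i\<in>Basis. conv (\<lambda>y. g y \<bullet> i) \<rho> x *\<^sub>R i)"

text \<open>
  The inner product of the mollified field with a fixed vector is an average of inner products; taking
  the mollified field itself as that vector gives the bound with the sharp constant.
\<close>

lemma conv_vec_norm_le:
  fixes g :: "'a::euclidean_space \<Rightarrow> 'a"
  assumes \<delta>: "\<delta> > 0" and g: "\<And>i. i \<in> Basis \<Longrightarrow> integrable lborel (\<lambda>x. g x \<bullet> i)" "\<And>x. norm (g x) \<le> 1"
  shows "norm (conv_vec g (moll \<delta>) x) \<le> 1"
proof -
  let ?v = "conv_vec g (moll \<delta>) x"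
  have "?v \<bullet> ?v = (\<Sum>i\<in>Basis. (?v \<bullet> i) * conv (\<lambda>y. g y \<bullet> i) (moll \<delta>) x)"
    by (subst (2) conv_vec_def) (simp add: inner_sum_right mult.commute)
  also have "\<dots> = conv (\<lambda>y. \<Sum>i\<in>Basis. (?v \<bullet> i) * (g y \<bullet> i)) (moll \<delta>) x"
    unfolding conv_def sum_distrib_right
    using conv_integrable[OF g(1) moll_test[OF \<delta>]]
    by (subst Bochner_Integration.integral_sum) (auto simp: mult.assoc)
  also have "(\<lambda>y. \<Sum>i\<in>Basis. (?v \<bullet> i) * (g y \<bullet> i)) = (\<lambda>y. ?v \<bullet> g y)"
    by (simp add: euclidean_inner[of ?v "g y" for y])
  also have "conv (\<lambda>y. ?v \<bullet> g y) (moll \<delta>) x \<le> norm ?v"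
  proof (rule order_trans[OF abs_ge_self conv_moll_abs_le[OF \<delta>]])
    show "integrable lborel (\<lambda>y. ?v \<bullet> g y)"
      unfolding euclidean_inner[of ?v "g y" for y] using g(1) by (intro Bochner_Integration.integrable_sum) auto
    show "\<bar>?v \<bullet> g y\<bar> \<le> norm ?v" for y
      using order_trans[OF Cauchy_Schwarz_ineq2 mult_left_mono[OF g(2)[of y] norm_ge_zero]] by simp
  qed
  finally have "norm ?v * norm ?v \<le> norm ?v" by (simp add: power2_norm_eq_inner[symmetric] power2_eq_square)
  then show ?thesis by (cases "?v = 0") auto
qed

text \<open>
  A continuous function with weak gradient \<open>g\<close> that vanishes on the boundary, both extended by zero.
  Borel functions on the whole space are used so that convolutions with them are defined everywhere.
\<close>

locale zero_boundary_values =
  fixes \<Omega> :: "'a::euclidean_space set" and w :: "'a \<Rightarrow> real" and g :: "'a \<Rightarrow> 'a"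
  assumes open_domain: "open \<Omega>" and bounded_domain: "bounded \<Omega>"
    and continuous: "continuous_on UNIV w" and outside: "\<And>x. x \<notin> \<Omega> \<Longrightarrow> w x = 0"
    and gradient_measurable [measurable]: "g \<in> borel_measurable borel"
    and gradient_bound: "\<And>x. norm (g x) \<le> 1" and gradient_outside: "\<And>x. x \<notin> \<Omega> \<Longrightarrow> g x = 0"
    and weak: "\<And>\<phi> i. \<phi> \<in> test_functions \<Omega> \<Longrightarrow> i \<in> Basis \<Longrightarrow>
      (\<integral>x. w x * partial i \<phi> x \<partial>lborel) = - (\<integral>x. (g x \<bullet> i) * \<phi> x \<partial>lborel)"
begin

lemma w_measurable [measurable]: "w \<in> borel_measurable borel"
  using continuous by (rule borel_measurable_continuous_onI)

lemma closure_compact: "compact (closure \<Omega>)"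
  using bounded_domain by (simp add: compact_closure)

lemma outside_closure: "x \<notin> closure \<Omega> \<Longrightarrow> w x = 0"
  using outside closure_subset by blast

lemma w_integrable: "integrable lborel w"
  by (rule integrable_compact_support[OF continuous closure_compact outside_closure])

lemma w_bounded: obtains W where "0 \<le> W" "\<And>x. \<bar>w x\<bar> \<le> W"
  using bounded_compact_support[OF continuous closure_compact outside_closure] by (metis real_norm_def)

lemma indicator_integrable: "integrable lborel (\<lambda>x. C * indicator \<Omega> x :: real)"
  using open_domain emeasure_bounded_finite[OF bounded_domain]
  by (intro integrable_mult_right integrable_real_indicator) auto

lemma component_bound: "i \<in> Basis \<Longrightarrow> \<bar>g x \<bullet> i\<bar> \<le> 1"
  using order_trans[OF Basis_le_norm gradient_bound] .

lemma component_integrable: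
  assumes "i \<in> Basis" shows "integrable lborel (\<lambda>x. g x \<bullet> i)"
proof (rule Bochner_Integration.integrable_bound[OF indicator_integrable[of 1]])
  show "AE x in lborel. norm (g x \<bullet> i) \<le> norm (1 * indicator \<Omega> x :: real)"
    using component_bound[OF assms] gradient_outside by (intro AE_I2) (auto split: split_indicator)
qed measurable

text \<open>
  As long as the kernel is supported in \<open>\<Omega>\<close>, it is a test function in the integration variable,
  and mollification commutes with the weak derivative.
\<close>

lemma grad_conv:
  assumes \<delta>: "\<delta> > 0" and x: "cball x \<delta> \<subseteq> \<Omega>"
  shows "grad (conv w (moll \<delta>)) x = conv_vec g (moll \<delta>) x"
proof -
  have sm: "smooth (moll \<delta> :: 'a \<Rightarrow> real)" by (rule test_smooth[OF moll_test[OF \<delta>]])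
  have test: "(\<lambda>y. moll \<delta> (x - y)) \<in> test_functions \<Omega>"
    by (rule test_functionsI[OF smooth_reflect(1)[OF sm] compact_cball x])
       (auto intro!: moll_zero[OF \<delta>] simp: dist_norm)
  have "partial i (conv w (moll \<delta>)) x = conv (\<lambda>y. g y \<bullet> i) (moll \<delta>) x" if i: "i \<in> Basis" for i
  proof -
    have "partial i (conv w (moll \<delta>)) x = conv w (partial i (moll \<delta>)) x"
      by (rule partial_conv[OF w_integrable moll_test[OF \<delta>] i])
    also have "\<dots> = - (\<integral>y. w y * partial i (\<lambda>y. moll \<delta> (x - y)) y \<partial>lborel)"
      by (simp add: smooth_reflect(2)[OF sm] conv_def)
    also have "\<dots> = conv (\<lambda>y. g y \<bullet> i) (moll \<delta>) x"
      by (simp add: weak[OF test i] conv_def)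
    finally show ?thesis .
  qed
  then show ?thesis by (simp add: grad_def conv_vec_def)
qed

lemma conv_uniformly_close:
  assumes "e > 0"
  obtains d where "d > 0" "\<And>\<delta> x. 0 < \<delta> \<Longrightarrow> \<delta> \<le> d \<Longrightarrow> \<bar>conv w (moll \<delta>) x - w x\<bar> \<le> e"
proof -
  have "uniformly_continuous_on UNIV w"
    by (rule uniformly_continuous_compact_support[OF continuous closure_compact outside_closure])
  then obtain d where d: "d > 0" "\<And>x y. dist y x < d \<Longrightarrow> dist (w y) (w x) < e"
    unfolding uniformly_continuous_on_def using assms by (metis UNIV_I)
  show thesis
  proof (rule that[OF d(1)])
    fix \<delta> x assume \<delta>: "0 < \<delta>" "\<delta> \<le> d"
    show "\<bar>conv w (moll \<delta>) x - w x\<bar> \<le> e"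
    proof (rule conv_moll_diff_bound[OF \<delta>(1) w_integrable])
      show "\<bar>w (x + z) - w x\<bar> \<le> e" if "norm z < \<delta>" for z
        using d(2)[of "x + z" x] that \<delta>(2) by (simp add: dist_norm)
    qed (use assms in simp)
  qed
qed

text \<open>
  Mollifications whose kernel stays inside the ball have a gradient of norm at most 1 on the segment,
  and they converge to \<open>w\<close>.
\<close>

lemma lipschitz_on_balls:
  assumes "ball a r \<subseteq> \<Omega>" "y \<in> ball a r"
  shows "\<bar>w a - w y\<bar> \<le> norm (a - y)"
proof (rule field_le_epsilon)
  fix e :: real assume e: "e > 0"
  then have e2: "e / 2 > 0" by simp
  obtain d where d: "d > 0" "\<And>\<delta> x. 0 < \<delta> \<Longrightarrow> \<delta> \<le> d \<Longrightarrow> \<bar>conv w (moll \<delta>) x - w x\<bar> \<le> e / 2"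
    by (rule conv_uniformly_close[OF e2]) (rule that)
  define s where "s = norm (a - y)"
  have s: "s < r" "0 \<le> s" using assms(2) by (auto simp: s_def dist_norm)
  define \<delta> where "\<delta> = min d ((r - s) / 2)"
  have \<delta>: "0 < \<delta>" "\<delta> \<le> d" "s + \<delta> < r" using d(1) s by (auto simp: \<delta>_def min_def field_simps)
  have "\<bar>conv w (moll \<delta>) a - conv w (moll \<delta>) y\<bar> \<le> 1 * norm (a - y)"
  proof (rule lipschitz_if_grad_bounded[OF smooth_conv[OF w_integrable moll_test[OF \<delta>(1)]] convex_cball])
    fix z assume z: "z \<in> cball a s"
    have "cball z \<delta> \<subseteq> ball a r"
    proof
      fix t assume "t \<in> cball z \<delta>"
      then show "t \<in> ball a r" using z \<delta>(3) dist_triangle[of a t z] by (simp add: dist_commute)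
    qed
    then have "cball z \<delta> \<subseteq> \<Omega>" using assms(1) by blast
    then show "norm (grad (conv w (moll \<delta>)) z) \<le> 1"
      by (simp add: grad_conv[OF \<delta>(1)] conv_vec_norm_le[OF \<delta>(1) component_integrable gradient_bound])
  qed (use s in \<open>auto simp: s_def dist_norm\<close>)
  then show "\<bar>w a - w y\<bar> \<le> norm (a - y) + e"
    using d(2)[OF \<delta>(1,2), of a] d(2)[OF \<delta>(1,2), of y] by linarith
qed

text \<open>
  The largest ball around \<open>x\<close> inside \<open>\<Omega>\<close> touches the boundary, where \<open>w\<close> vanishes; its diameter
  is at most that of \<open>\<Omega>\<close>.
\<close>

lemma abs_le_half_diameter: "\<bar>w x\<bar> \<le> diameter \<Omega> / 2"
proof (cases "x \<in> \<Omega>")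
  case False
  then show ?thesis using outside diameter_ge_0[OF bounded_domain] by simp
next
  case True
  then have "frontier \<Omega> \<noteq> {}"
    using bounded_domain not_bounded_UNIV frontier_eq_empty[of \<Omega>] by auto
  then obtain p where p: "p \<in> frontier \<Omega>" "\<And>y. y \<in> frontier \<Omega> \<Longrightarrow> dist x p \<le> dist x y"
    using distance_attains_inf[OF frontier_closed, of \<Omega> x] by metis
  define r where "r = dist x p"
  have pn: "p \<notin> \<Omega>" using p(1) open_domain by (simp add: frontier_def interior_open)
  have r: "r > 0" using pn True by (auto simp: r_def)
  have "ball x r \<inter> frontier \<Omega> = {}" using p(2) by (force simp: r_def)
  moreover have "x \<in> ball x r \<inter> \<Omega>" using True r by simp
  ultimately have sub: "ball x r \<subseteq> \<Omega>"
    using connected_Int_frontier[OF connected_ball, of x r \<Omega>] by blast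
  have "closed {y. \<bar>w x - w y\<bar> \<le> r}"
    by (intro closed_Collect_le continuous_intros continuous)
  moreover have "ball x r \<subseteq> {y. \<bar>w x - w y\<bar> \<le> r}"
    using lipschitz_on_balls[OF sub] by (force simp: dist_norm)
  ultimately have "closure (ball x r) \<subseteq> {y. \<bar>w x - w y\<bar> \<le> r}" by (rule closure_minimal[rotated])
  moreover have "p \<in> closure (ball x r)" using r by (simp add: r_def)
  ultimately have "\<bar>w x - w p\<bar> \<le> r" by blast
  moreover have "2 * r \<le> diameter \<Omega>"
    using diameter_subset[OF sub bounded_domain] r by simp
  ultimately show ?thesis using outside[OF pn] by simp
qed

end

section \<open>Approximation by test functions\<close>

text \<open>A smooth truncation: it vanishes on \<open>[-\<epsilon>, \<epsilon>]\<close> and approaches the identity as \<open>\<epsilon> \<rightarrow> 0\<close>.\<close>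

definition trunc :: "real \<Rightarrow> real \<Rightarrow> real"
  where "trunc \<epsilon> s = s * flat_exp 0 (s\<^sup>2 / \<epsilon>\<^sup>2 - 1)"

definition trunc_deriv :: "real \<Rightarrow> real \<Rightarrow> real"
  where "trunc_deriv \<epsilon> s = flat_exp 0 (s\<^sup>2 / \<epsilon>\<^sup>2 - 1) + 2 * (s\<^sup>2 / \<epsilon>\<^sup>2) * flat_exp 2 (s\<^sup>2 / \<epsilon>\<^sup>2 - 1)"

lemma smooth_trunc: "smooth (trunc \<epsilon>)"
proof -
  have "smooth (\<lambda>s::real. s)" by (rule smooth_bounded_linear) (rule bounded_linear_ident)
  then have "smooth (\<lambda>s. s * flat_exp 0 (inverse (\<epsilon>\<^sup>2) * (s * s) - 1))"
    by (intro smooth_mult smooth_compose[OF smooth_flat_exp] smooth_diff smooth_cmult smooth_const)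
  then show ?thesis by (simp add: trunc_def[abs_def] power2_eq_square divide_inverse mult_ac)
qed

lemma trunc_has_derivative: "(trunc \<epsilon> has_real_derivative trunc_deriv \<epsilon> s) (at s)"
proof -
  have "((\<lambda>s. inverse (\<epsilon>\<^sup>2) * s\<^sup>2 - 1) has_real_derivative inverse (\<epsilon>\<^sup>2) * (2 * s)) (at s)"
    by (auto intro!: derivative_eq_intros)
  then have "((\<lambda>s. s\<^sup>2 / \<epsilon>\<^sup>2 - 1) has_real_derivative 2 * s / \<epsilon>\<^sup>2) (at s)"
    by (simp add: divide_inverse mult.commute)
  from DERIV_chain2[OF flat_exp_has_derivative this, of 0]
  have "((\<lambda>s. flat_exp 0 (s\<^sup>2 / \<epsilon>\<^sup>2 - 1)) has_real_derivative flat_exp 2 (s\<^sup>2 / \<epsilon>\<^sup>2 - 1) * (2 * s / \<epsilon>\<^sup>2)) (at s)"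
    by (simp add: numeral_2_eq_2)
  from DERIV_mult[OF DERIV_ident this] show ?thesis
    unfolding trunc_def[abs_def] trunc_deriv_def by (simp add: power2_eq_square mult_ac add.commute)
qed

lemma trunc_zero:
  assumes "\<bar>s\<bar> \<le> \<epsilon>" shows "trunc \<epsilon> s = 0" "trunc_deriv \<epsilon> s = 0"
proof -
  have "s\<^sup>2 \<le> \<epsilon>\<^sup>2" using power_mono[OF assms, of 2] by simp
  then have "\<not> s\<^sup>2 / \<epsilon>\<^sup>2 - 1 > 0" by (cases "\<epsilon> = 0") (auto simp: divide_le_eq_1)
  then show "trunc \<epsilon> s = 0" "trunc_deriv \<epsilon> s = 0" by (auto simp: trunc_def trunc_deriv_def flat_exp_def)
qed

lemma trunc_abs_le: "\<bar>trunc \<epsilon> s\<bar> \<le> \<bar>s\<bar>"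
  unfolding trunc_def abs_mult using flat_exp_0_bounds[of "s\<^sup>2 / \<epsilon>\<^sup>2 - 1"] by (simp add: mult_left_le)

lemma flat_exp_2_le: "flat_exp 2 t \<le> 2" "t > 0 \<Longrightarrow> flat_exp 2 t \<le> 1 / t\<^sup>2"
proof -
  show le: "flat_exp 2 t \<le> 1 / t\<^sup>2" if "t > 0" for t
    using that by (simp add: flat_exp_def divide_right_mono)
  show "flat_exp 2 t \<le> 2"
  proof (cases "t > 0")
    case True
    have "(1 / t)\<^sup>2 / 2 \<le> exp (1 / t)"
      using exp_lower_Taylor_quadratic[of "1 / t"] True zero_less_divide_1_iff[of t] by linarith
    then have "(1 / t)\<^sup>2 \<le> 2 * exp (1 / t)" by linarith
    then have "(1 / t)\<^sup>2 / exp (1 / t) \<le> 2" by (subst pos_divide_le_eq) auto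
    then show ?thesis using True by (simp add: flat_exp_def exp_minus power_divide divide_simps mult.commute)
  qed (simp add: flat_exp_def)
qed

text \<open>
  The bound does not depend on \<open>\<epsilon>\<close>, so that dominated convergence applies as \<open>\<epsilon> \<rightarrow> 0\<close>.
\<close>

lemma trunc_deriv_abs_le: "\<bar>trunc_deriv \<epsilon> s\<bar> \<le> 9"
proof -
  define t where "t = s\<^sup>2 / \<epsilon>\<^sup>2 - 1"
  have f0: "0 \<le> flat_exp 2 t" by (simp add: flat_exp_def)
  have "(t + 1) * flat_exp 2 t \<le> 4"
  proof (cases "t \<le> 1")
    case True
    have "(t + 1) * flat_exp 2 t \<le> 2 * 2"
      using True f0 flat_exp_2_le(1)[of t] by (intro mult_mono) auto
    then show ?thesis by simp
  next
    case False
    have "(t + 1) * flat_exp 2 t \<le> (t + 1) * (1 / t\<^sup>2)"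
      using False by (intro mult_left_mono flat_exp_2_le) auto
    also have "\<dots> \<le> (2 * t\<^sup>2) * (1 / t\<^sup>2)"
    proof (rule mult_right_mono)
      have "t * 1 \<le> t * t" using False by (intro mult_left_mono) auto
      then show "t + 1 \<le> 2 * t\<^sup>2" using False unfolding power2_eq_square by linarith
    qed simp
    also have "\<dots> = 2" using False by simp
    finally show ?thesis by simp
  qed
  moreover have "0 \<le> (t + 1) * flat_exp 2 t" using f0 by (intro mult_nonneg_nonneg) (auto simp: t_def)
  moreover have "trunc_deriv \<epsilon> s = flat_exp 0 t + 2 * ((t + 1) * flat_exp 2 t)" by (simp add: trunc_deriv_def t_def)
  ultimately show ?thesis using flat_exp_0_bounds[of t] by linarith
qed

lemma trunc_tendsto:
  assumes \<epsilon>: "\<And>n. \<epsilon> n > 0" "\<epsilon> \<longlonglongrightarrow> 0"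
  shows "(\<lambda>n. trunc (\<epsilon> n) s) \<longlonglongrightarrow> s" "(\<lambda>n. trunc_deriv (\<epsilon> n) s) \<longlonglongrightarrow> (if s = 0 then 0 else 1)"
proof -
  have main: "(\<lambda>n. trunc (\<epsilon> n) s) \<longlonglongrightarrow> s * 1 \<and> (\<lambda>n. trunc_deriv (\<epsilon> n) s) \<longlonglongrightarrow> 1 + 0" if s: "s \<noteq> 0"
  proof -
    have inv: "filterlim (\<lambda>x. inverse x) at_top (at_right (0::real))" by (rule filterlim_inverse_at_top_right)
    have e0: "filterlim (\<lambda>n. (\<epsilon> n)\<^sup>2 / s\<^sup>2) (at_right 0) sequentially"
    proof -
      have pos: "(\<epsilon> n)\<^sup>2 / s\<^sup>2 > 0" for n using \<epsilon>(1)[of n] s by simp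
      have lim: "(\<lambda>n. (\<epsilon> n)\<^sup>2 / s\<^sup>2) \<longlonglongrightarrow> 0"
        using s tendsto_divide[OF tendsto_power[OF \<epsilon>(2), of 2] tendsto_const[of "s\<^sup>2"]] by simp
      have "(\<epsilon> n)\<^sup>2 / s\<^sup>2 \<in> {0<..}" "(\<epsilon> n)\<^sup>2 / s\<^sup>2 \<noteq> 0" for n
        unfolding greaterThan_iff by (rule pos, rule less_imp_neq[OF pos, symmetric])
      then show ?thesis
        unfolding filterlim_at using lim by (intro conjI always_eventually allI)
    qed
    have y: "filterlim (\<lambda>n. s\<^sup>2 / (\<epsilon> n)\<^sup>2) at_top sequentially"
      using filterlim_compose[OF inv e0] by simp
    then have t: "filterlim (\<lambda>n. s\<^sup>2 / (\<epsilon> n)\<^sup>2 - 1) at_top sequentially"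
      using filterlim_tendsto_add_at_top[OF tendsto_const[of "-1"] y] by simp
    have inv0: "((\<lambda>t::real. inverse t) \<longlongrightarrow> 0) at_top" by (rule tendsto_inverse_0_at_top) (rule filterlim_ident)
    have f0: "(flat_exp 0 \<longlongrightarrow> 1) at_top"
    proof (rule Lim_transform_eventually)
      show "((\<lambda>t::real. exp (- inverse t)) \<longlongrightarrow> 1) at_top"
        using tendsto_exp[OF tendsto_minus[OF inv0]] by simp
      show "\<forall>\<^sub>F t in at_top. exp (- inverse t) = flat_exp 0 t"
        using eventually_gt_at_top[of 0] by eventually_elim (simp add: flat_exp_def divide_inverse)
    qed
    have f2: "((\<lambda>t. 2 * (t + 1) * flat_exp 2 t) \<longlongrightarrow> 0) at_top"
    proof (rule tendsto_sandwich[of "\<lambda>_. 0"])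
      show "\<forall>\<^sub>F t::real in at_top. 0 \<le> 2 * (t + 1) * flat_exp 2 t"
        using eventually_gt_at_top[of 0] by eventually_elim (simp add: flat_exp_def)
      show "\<forall>\<^sub>F t::real in at_top. 2 * (t + 1) * flat_exp 2 t \<le> 4 * inverse t"
        using eventually_gt_at_top[of 1]
      proof eventually_elim
        case (elim t)
        have "2 * (t + 1) * flat_exp 2 t \<le> (4 * t) * (1 / t\<^sup>2)"
          using elim flat_exp_2_le(2)[of t] by (intro mult_mono[of "2 * (t + 1)" "4 * t"]) (auto simp: flat_exp_def)
        also have "\<dots> = 4 * inverse t" using elim by (simp add: power2_eq_square field_simps)
        finally show ?case .
      qed
      show "((\<lambda>t::real. 4 * inverse t) \<longlongrightarrow> 0) at_top" using tendsto_mult_left[OF inv0, of 4] by simp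
    qed simp
    have "(\<lambda>n. trunc (\<epsilon> n) s) \<longlonglongrightarrow> s * 1"
      unfolding trunc_def by (intro tendsto_mult tendsto_const filterlim_compose[OF f0 t])
    moreover have "(\<lambda>n. flat_exp 0 (s\<^sup>2 / (\<epsilon> n)\<^sup>2 - 1) + 2 * ((s\<^sup>2 / (\<epsilon> n)\<^sup>2 - 1) + 1) * flat_exp 2 (s\<^sup>2 / (\<epsilon> n)\<^sup>2 - 1)) \<longlonglongrightarrow> 1 + 0"
      by (intro tendsto_add filterlim_compose[OF f0 t] filterlim_compose[OF f2 t])
    then have "(\<lambda>n. trunc_deriv (\<epsilon> n) s) \<longlonglongrightarrow> 1 + 0" by (simp add: trunc_deriv_def)
    ultimately show ?thesis by blast
  qed
  have zero: "(\<lambda>n. trunc (\<epsilon> n) s) \<longlonglongrightarrow> s \<and> (\<lambda>n. trunc_deriv (\<epsilon> n) s) \<longlonglongrightarrow> (if s = 0 then 0 else 1)" if "s = 0"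
    using \<epsilon>(1) by (simp add: that trunc_def trunc_deriv_def flat_exp_def)
  show "(\<lambda>n. trunc (\<epsilon> n) s) \<longlonglongrightarrow> s" "(\<lambda>n. trunc_deriv (\<epsilon> n) s) \<longlonglongrightarrow> (if s = 0 then 0 else 1)"
    using main zero by (cases "s = 0"; simp)+
qed

context zero_boundary_values
begin

text \<open>
  Convergence in the mean of all components at once gives one subsequence for the whole field.
\<close>

lemma conv_vec_tendsto_AE:
  obtains s where "strict_mono (s :: nat \<Rightarrow> nat)"
    "AE x in lborel. (\<lambda>n. conv_vec g (moll (inverse (real (Suc (s n))))) x) \<longlonglongrightarrow> g x"
proof -
  define D where "D n x = (\<Sum>i\<in>Basis. \<bar>conv (\<lambda>y. g y \<bullet> i) (moll (inverse (real (Suc n)))) x - g x \<bullet> i\<bar>)" for n x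
  obtain r where r: "\<Omega> \<subseteq> cball 0 r"
    using bounded_subset_ballD[OF bounded_domain, of 0] ball_subset_cball by blast
  have pos: "inverse (real (Suc n)) > 0" for n by simp
  have ci: "integrable lborel (\<lambda>x. \<bar>conv (\<lambda>y. g y \<bullet> i) (moll (inverse (real (Suc n)))) x - g x \<bullet> i\<bar>)" if "i \<in> Basis" for i n
    using conv_moll_L1_le(1)[OF pos component_integrable[OF that]] component_integrable[OF that]
    by (intro integrable_abs Bochner_Integration.integrable_diff)
  have Di: "integrable lborel (D n)" for n
    unfolding D_def[abs_def] using ci by (intro Bochner_Integration.integrable_sum)
  have "(\<lambda>n. \<Sum>i\<in>Basis. \<integral>x. \<bar>conv (\<lambda>y. g y \<bullet> i) (moll (inverse (real (Suc n)))) x - g x \<bullet> i\<bar> \<partial>lborel) \<longlonglongrightarrow> (\<Sum>i\<in>(Basis :: 'a set). 0)"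
  proof (intro tendsto_sum conv_moll_tendsto_L1)
    fix i :: 'a assume i: "i \<in> Basis"
    show "\<bar>g x \<bullet> i\<bar> \<le> 1" for x by (rule component_bound[OF i])
    show "g x \<bullet> i = 0" if "x \<notin> cball 0 r" for x
    proof -
      have "x \<notin> \<Omega>" using that r by blast
      then show ?thesis by (simp add: gradient_outside)
    qed
  qed measurable
  moreover have "(\<integral>x. norm (D n x) \<partial>lborel) = (\<Sum>i\<in>Basis. \<integral>x. \<bar>conv (\<lambda>y. g y \<bullet> i) (moll (inverse (real (Suc n)))) x - g x \<bullet> i\<bar> \<partial>lborel)" for n
    unfolding D_def using ci by (simp add: Bochner_Integration.integral_sum abs_of_nonneg sum_nonneg del: of_nat_Suc)
  ultimately have "(\<lambda>n. \<integral>x. norm (D n x) \<partial>lborel) \<longlonglongrightarrow> 0" by simp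
  then obtain s where s: "strict_mono (s :: nat \<Rightarrow> nat)" "AE x in lborel. (\<lambda>n. D (s n) x) \<longlonglongrightarrow> 0"
    using tendsto_L1_AE_subseq[of lborel D, OF Di] by blast
  show thesis
  proof (rule that[OF s(1)])
    show "AE x in lborel. (\<lambda>n. conv_vec g (moll (inverse (real (Suc (s n))))) x) \<longlonglongrightarrow> g x"
      using s(2)
    proof eventually_elim
      case (elim x)
      have "(\<lambda>n. conv (\<lambda>y. g y \<bullet> i) (moll (inverse (real (Suc (s n))))) x) \<longlonglongrightarrow> g x \<bullet> i" if i: "i \<in> Basis" for i
      proof -
        have "\<bar>conv (\<lambda>y. g y \<bullet> i) (moll (inverse (real (Suc (s n))))) x - g x \<bullet> i\<bar> \<le> D (s n) x" for n
          unfolding D_def using i by (intro member_le_sum) auto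
        then have "(\<lambda>n. conv (\<lambda>y. g y \<bullet> i) (moll (inverse (real (Suc (s n))))) x - g x \<bullet> i) \<longlonglongrightarrow> 0"
          by (intro Lim_null_comparison[OF _ elim] always_eventually) simp
        then show ?thesis by (simp add: LIM_zero_iff)
      qed
      then have "(\<lambda>n. conv_vec g (moll (inverse (real (Suc (s n))))) x) \<longlonglongrightarrow> (\<Sum>i\<in>Basis. (g x \<bullet> i) *\<^sub>R i)"
        unfolding conv_vec_def by (intro tendsto_intros)
      then show ?case by (simp add: euclidean_representation)
    qed
  qed
qed

text \<open>
  Where \<open>\<bar>w\<bar> < \<epsilon> / 2\<close> the mollification is eventually below \<open>\<epsilon>\<close> in absolute value and is truncated to
  zero. The rest is a compact subset of \<open>\<Omega>\<close>, near which the kernel is supported in \<open>\<Omega>\<close>, so that there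
  the mollification has the mollified weak gradient.
\<close>

lemma truncated_test_functions:
  assumes \<epsilon>: "\<epsilon> > 0"
  obtains \<phi> :: "nat \<Rightarrow> 'a \<Rightarrow> real" and C where "\<And>n. \<phi> n \<in> test_functions \<Omega>"
    "\<And>n x. \<bar>\<phi> n x\<bar> \<le> C" "\<And>n x. norm (grad (\<phi> n) x) \<le> C"
    "AE x in lborel. (\<lambda>n. \<phi> n x) \<longlonglongrightarrow> trunc \<epsilon> (w x)"
    "AE x in lborel. (\<lambda>n. grad (\<phi> n) x) \<longlonglongrightarrow> trunc_deriv \<epsilon> (w x) *\<^sub>R g x"
proof -
  obtain s where s: "strict_mono (s :: nat \<Rightarrow> nat)"
    "AE x in lborel. (\<lambda>n. conv_vec g (moll (inverse (real (Suc (s n))))) x) \<longlonglongrightarrow> g x"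
    by (rule conv_vec_tendsto_AE) (rule that)
  obtain W where W: "0 \<le> W" "\<And>x. \<bar>w x\<bar> \<le> W" by (rule w_bounded) (rule that)
  \<comment> \<open>Off \<open>K\<close> an error of at most \<open>\<epsilon> / 3\<close> keeps the mollification below \<open>\<epsilon> / 2 + \<epsilon> / 3 < \<epsilon>\<close>.\<close>
  define K where "K = {x. \<epsilon> / 2 \<le> \<bar>w x\<bar>}"
  have Ksub: "K \<subseteq> \<Omega>" using outside \<epsilon> by (force simp: K_def)
  have "closed K" unfolding K_def by (intro closed_Collect_le continuous_intros continuous)
  then have Kc: "compact K" using Ksub bounded_domain by (auto simp: compact_eq_bounded_closed intro: bounded_subset)
  obtain d1 where d1: "d1 > 0" "(\<Union>x\<in>K. cball x d1) \<subseteq> \<Omega>"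
    using compact_subset_open_imp_cball_epsilon_subset[OF Kc open_domain Ksub] by blast
  have e3: "\<epsilon> / 3 > 0" using \<epsilon> by simp
  obtain d2 where d2: "d2 > 0" "\<And>\<delta> x. 0 < \<delta> \<Longrightarrow> \<delta> \<le> d2 \<Longrightarrow> \<bar>conv w (moll \<delta>) x - w x\<bar> \<le> \<epsilon> / 3"
    by (rule conv_uniformly_close[OF e3]) (rule that)
  obtain N where N: "inverse (real (Suc N)) < min d1 d2" using reals_Archimedean[of "min d1 d2"] d1(1) d2(1) by auto
  define \<delta> where "\<delta> n = inverse (real (Suc (s (n + N))))" for n
  have \<delta>: "\<delta> n > 0" "\<delta> n \<le> d1" "\<delta> n \<le> d2" for n
  proof -
    have "\<delta> n \<le> inverse (real (Suc N))"
      unfolding \<delta>_def using seq_suble[OF s(1), of "n + N"] by (intro le_imp_inverse_le) auto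
    then show "\<delta> n \<le> d1" "\<delta> n \<le> d2" using N by auto
    show "\<delta> n > 0" by (simp add: \<delta>_def)
  qed
  have \<delta>0: "\<delta> \<longlonglongrightarrow> 0"
  proof (rule tendsto_sandwich[OF _ _ tendsto_const LIMSEQ_inverse_real_of_nat])
    have "\<delta> n \<le> inverse (real (Suc n))" for n
      unfolding \<delta>_def using seq_suble[OF s(1), of "n + N"] by (intro le_imp_inverse_le) auto
    then show "\<forall>\<^sub>F n in sequentially. \<delta> n \<le> inverse (real (Suc n))" by (intro always_eventually) simp
    show "\<forall>\<^sub>F n in sequentially. 0 \<le> \<delta> n" using \<delta>(1) by (intro always_eventually) (simp add: less_imp_le)
  qed
  define v where "v n = conv w (moll (\<delta> n))" for n
  have vs: "smooth (v n)" for n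
    unfolding v_def by (rule smooth_conv[OF w_integrable moll_test[OF \<delta>(1)]])
  have vW: "\<bar>v n x\<bar> \<le> W" for n x
    unfolding v_def by (rule conv_moll_abs_le[OF \<delta>(1) w_integrable W(2)])
  have vK: "\<bar>v n x\<bar> \<le> \<epsilon>" if "x \<notin> K" for n x
    using that d2(2)[OF \<delta>(1,3), of n x] \<epsilon> unfolding K_def v_def mem_Collect_eq by linarith
  have vlim: "(\<lambda>n. v n x) \<longlonglongrightarrow> w x" for x
  proof (rule LIMSEQ_I)
    fix e :: real assume "e > 0"
    then have e2: "e / 2 > 0" by simp
    obtain d where d: "d > 0" "\<And>\<delta> x. 0 < \<delta> \<Longrightarrow> \<delta> \<le> d \<Longrightarrow> \<bar>conv w (moll \<delta>) x - w x\<bar> \<le> e / 2"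
      by (rule conv_uniformly_close[OF e2]) (rule that)
    obtain M where M: "\<And>n. n \<ge> M \<Longrightarrow> \<delta> n < d"
      using order_tendstoD(2)[OF \<delta>0 d(1)] by (auto simp: eventually_sequentially)
    have "norm (v n x - w x) < e" if "n \<ge> M" for n
      using d(2)[OF \<delta>(1) less_imp_le[OF M[OF that]], of x] \<open>e > 0\<close> by (simp add: v_def)
    then show "\<exists>M. \<forall>n\<ge>M. norm (v n x - w x) < e" by blast
  qed
  define \<phi> where "\<phi> n x = trunc \<epsilon> (v n x)" for n x
  have \<phi>t: "\<phi> n \<in> test_functions \<Omega>" for n
    unfolding \<phi>_def
    by (rule test_functionsI[OF smooth_compose[OF smooth_trunc vs] Kc Ksub]) (rule trunc_zero(1)[OF vK])
  have grad: "grad (\<phi> n) x = trunc_deriv \<epsilon> (v n x) *\<^sub>R conv_vec g (moll (\<delta> n)) x" for n x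
  proof -
    have "((\<lambda>x. trunc \<epsilon> (v n x)) has_derivative (\<lambda>h. trunc_deriv \<epsilon> (v n x) * (h \<bullet> grad (v n) x))) (at x)"
      by (rule has_derivative_compose[OF smooth_has_derivative_grad[OF vs]
            trunc_has_derivative[unfolded has_field_derivative_def]])
    then have "grad (\<phi> n) x = trunc_deriv \<epsilon> (v n x) *\<^sub>R grad (v n) x"
      unfolding \<phi>_def by (intro grad_eqI) (simp add: inner_scaleR_right)
    also have "\<dots> = trunc_deriv \<epsilon> (v n x) *\<^sub>R conv_vec g (moll (\<delta> n)) x"
    proof (cases "x \<in> K")
      case True
      then have "cball x (\<delta> n) \<subseteq> \<Omega>" using d1(2) \<delta>(2)[of n] subset_cball[of "\<delta> n" d1 x] by blast
      then show ?thesis unfolding v_def by (simp add: grad_conv[OF \<delta>(1)])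
    next
      case False
      then show ?thesis by (simp add: trunc_zero(2)[OF vK])
    qed
    finally show ?thesis .
  qed
  have dcont: "continuous_on UNIV (trunc_deriv \<epsilon>)"
    unfolding trunc_deriv_def[abs_def] divide_inverse
    by (intro continuous_intros continuous_on_compose2[OF smooth_continuous[OF smooth_flat_exp]]) auto
  show thesis
  proof (rule that[of \<phi> "W + 9"])
    show "\<phi> n \<in> test_functions \<Omega>" for n by (rule \<phi>t)
    show "\<bar>\<phi> n x\<bar> \<le> W + 9" for n x
      using order_trans[OF trunc_abs_le vW, of \<epsilon> n x] by (simp add: \<phi>_def)
    show "norm (grad (\<phi> n) x) \<le> W + 9" for n x
    proof -
      have "norm (grad (\<phi> n) x) \<le> 9 * 1"
        unfolding grad norm_scaleR
        by (intro mult_mono trunc_deriv_abs_le conv_vec_norm_le[OF \<delta>(1) component_integrable gradient_bound]) auto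
      then show ?thesis using W(1) by simp
    qed
    have "isCont (trunc \<epsilon>) y" "isCont (trunc_deriv \<epsilon>) y" for y
      using smooth_continuous[OF smooth_trunc, of \<epsilon>] dcont by (auto simp: continuous_on_eq_continuous_at)
    then have lims: "(\<lambda>n. trunc \<epsilon> (v n x)) \<longlonglongrightarrow> trunc \<epsilon> (w x)" "(\<lambda>n. trunc_deriv \<epsilon> (v n x)) \<longlonglongrightarrow> trunc_deriv \<epsilon> (w x)" for x
      using isCont_tendsto_compose[OF _ vlim] by blast+
    show "AE x in lborel. (\<lambda>n. \<phi> n x) \<longlonglongrightarrow> trunc \<epsilon> (w x)" using lims by (simp add: \<phi>_def)
    show "AE x in lborel. (\<lambda>n. grad (\<phi> n) x) \<longlonglongrightarrow> trunc_deriv \<epsilon> (w x) *\<^sub>R g x"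
      using s(2)
    proof eventually_elim
      case (elim x)
      have "(\<lambda>n. conv_vec g (moll (\<delta> n)) x) \<longlonglongrightarrow> g x"
        unfolding \<delta>_def using LIMSEQ_ignore_initial_segment[OF elim, of N] .
      then show ?case unfolding grad by (intro tendsto_scaleR lims)
    qed
  qed
qed

end

section \<open>Testing the equation with the solution\<close>

context zero_boundary_values
begin

text \<open>
  The weak equation and the Rayleigh inequality are stable under bounded almost everywhere
  convergence. They pass from test functions to truncations of \<open>w\<close>, and then to \<open>w\<close> itself,
  whose gradient only enters where \<open>w \<noteq> 0\<close>.
\<close>

definition admissible :: "('a \<Rightarrow> 'a) \<Rightarrow> ('a \<Rightarrow> real) \<Rightarrow> real \<Rightarrow> ('a \<Rightarrow> real) \<Rightarrow> ('a \<Rightarrow> 'a) \<Rightarrow> bool"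
  where "admissible F f R p P \<longleftrightarrow> p \<in> borel_measurable borel \<and> P \<in> borel_measurable borel \<and>
    (\<integral>x. F x \<bullet> P x \<partial>lborel) = (\<integral>x. f x * p x \<partial>lborel) \<and>
    R * (\<integral>x. (p x)\<^sup>2 \<partial>lborel) \<le> (\<integral>x. (norm (P x))\<^sup>2 \<partial>lborel)"

lemma admissible_limit:
  assumes adm: "\<And>n. admissible F f R (p n) (P n)"
    and bd: "\<And>n x. \<bar>p n x\<bar> \<le> C * indicator \<Omega> x" "\<And>n x. norm (P n x) \<le> C * indicator \<Omega> x"
    and lim: "AE x in lborel. (\<lambda>n. p n x) \<longlonglongrightarrow> q x" "AE x in lborel. (\<lambda>n. P n x) \<longlonglongrightarrow> Q x"
    and meas [measurable]: "q \<in> borel_measurable borel" "Q \<in> borel_measurable borel"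
      "F \<in> borel_measurable borel" "f \<in> borel_measurable borel"
    and F: "AE x in lborel. norm (F x) \<le> B" and f: "AE x in lborel. \<bar>f x\<bar> \<le> B"
  shows "admissible F f R q Q"
proof -
  have [measurable]: "p n \<in> borel_measurable borel" "P n \<in> borel_measurable borel" for n
    using adm by (auto simp: admissible_def)
  have 1: "(\<lambda>n. \<integral>x. F x \<bullet> P n x \<partial>lborel) \<longlonglongrightarrow> (\<integral>x. F x \<bullet> Q x \<partial>lborel)"
  proof (rule integral_dominated_convergence[where w = "\<lambda>x. \<bar>B\<bar> * C * indicator \<Omega> x"])
    show "AE x in lborel. (\<lambda>n. F x \<bullet> P n x) \<longlonglongrightarrow> F x \<bullet> Q x"
      using lim(2) by eventually_elim (intro tendsto_intros)
    show "AE x in lborel. norm (F x \<bullet> P n x) \<le> \<bar>B\<bar> * C * indicator \<Omega> x" for n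
      using F
    proof eventually_elim
      case (elim x)
      have "norm (F x \<bullet> P n x) \<le> norm (F x) * norm (P n x)" by (simp add: Cauchy_Schwarz_ineq2)
      also have "\<dots> \<le> \<bar>B\<bar> * (C * indicator \<Omega> x)" using elim bd(2)[of n x] by (intro mult_mono) auto
      finally show ?case by (simp add: mult.assoc)
    qed
  qed (use indicator_integrable[of "\<bar>B\<bar> * C"] in measurable)
  have 2: "(\<lambda>n. \<integral>x. f x * p n x \<partial>lborel) \<longlonglongrightarrow> (\<integral>x. f x * q x \<partial>lborel)"
  proof (rule integral_dominated_convergence[where w = "\<lambda>x. \<bar>B\<bar> * C * indicator \<Omega> x"])
    show "AE x in lborel. (\<lambda>n. f x * p n x) \<longlonglongrightarrow> f x * q x"
      using lim(1) by eventually_elim (intro tendsto_intros)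
    show "AE x in lborel. norm (f x * p n x) \<le> \<bar>B\<bar> * C * indicator \<Omega> x" for n
      using f
    proof eventually_elim
      case (elim x)
      have "norm (f x * p n x) \<le> \<bar>B\<bar> * (C * indicator \<Omega> x)"
        unfolding real_norm_def abs_mult using elim bd(1)[of n x] by (intro mult_mono) auto
      then show ?case by (simp add: mult.assoc)
    qed
  qed (use indicator_integrable[of "\<bar>B\<bar> * C"] in measurable)
  have 3: "(\<lambda>n. \<integral>x. (p n x)\<^sup>2 \<partial>lborel) \<longlonglongrightarrow> (\<integral>x. (q x)\<^sup>2 \<partial>lborel)"
  proof (rule integral_dominated_convergence[where w = "\<lambda>x. C\<^sup>2 * indicator \<Omega> x"])
    show "AE x in lborel. (\<lambda>n. (p n x)\<^sup>2) \<longlonglongrightarrow> (q x)\<^sup>2"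
      using lim(1) by eventually_elim (intro tendsto_intros)
    show "AE x in lborel. norm ((p n x)\<^sup>2) \<le> C\<^sup>2 * indicator \<Omega> x" for n
    proof (intro AE_I2)
      fix x show "norm ((p n x)\<^sup>2) \<le> C\<^sup>2 * indicator \<Omega> x"
        using power_mono[OF bd(1)[of n x], of 2] by (cases "x \<in> \<Omega>") auto
    qed
  qed (use indicator_integrable[of "C\<^sup>2"] in measurable)
  have 4: "(\<lambda>n. \<integral>x. (norm (P n x))\<^sup>2 \<partial>lborel) \<longlonglongrightarrow> (\<integral>x. (norm (Q x))\<^sup>2 \<partial>lborel)"
  proof (rule integral_dominated_convergence[where w = "\<lambda>x. C\<^sup>2 * indicator \<Omega> x"])
    show "AE x in lborel. (\<lambda>n. (norm (P n x))\<^sup>2) \<longlonglongrightarrow> (norm (Q x))\<^sup>2"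
      using lim(2) by eventually_elim (intro tendsto_intros)
    show "AE x in lborel. norm ((norm (P n x))\<^sup>2) \<le> C\<^sup>2 * indicator \<Omega> x" for n
    proof (intro AE_I2)
      fix x show "norm ((norm (P n x))\<^sup>2) \<le> C\<^sup>2 * indicator \<Omega> x"
        using power_mono[OF bd(2)[of n x], of 2] by (cases "x \<in> \<Omega>") auto
    qed
  qed (use indicator_integrable[of "C\<^sup>2"] in measurable)
  have eq: "(\<integral>x. F x \<bullet> P n x \<partial>lborel) = (\<integral>x. f x * p n x \<partial>lborel)"
    and le: "R * (\<integral>x. (p n x)\<^sup>2 \<partial>lborel) \<le> (\<integral>x. (norm (P n x))\<^sup>2 \<partial>lborel)" for n
    using adm[of n] by (auto simp: admissible_def)
  have "(\<integral>x. F x \<bullet> Q x \<partial>lborel) = (\<integral>x. f x * q x \<partial>lborel)"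
    by (rule LIMSEQ_unique[OF 1[unfolded eq] 2])
  moreover have "R * (\<integral>x. (q x)\<^sup>2 \<partial>lborel) \<le> (\<integral>x. (norm (Q x))\<^sup>2 \<partial>lborel)"
    by (rule LIMSEQ_le[OF tendsto_mult_left[OF 3] 4]) (use le in auto)
  ultimately show ?thesis using meas by (simp add: admissible_def)
qed

lemma admissible_self:
  assumes R: "\<And>\<phi>. \<phi> \<in> test_functions \<Omega> \<Longrightarrow> R * sq_norm \<phi> \<le> energy \<phi>"
    and eq: "\<And>\<phi>. \<phi> \<in> test_functions \<Omega> \<Longrightarrow> (\<integral>x. F x \<bullet> grad \<phi> x \<partial>lborel) = (\<integral>x. f x * \<phi> x \<partial>lborel)"
    and meas [measurable]: "F \<in> borel_measurable borel" "f \<in> borel_measurable borel"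
    and F: "AE x in lborel. norm (F x) \<le> B" and f: "AE x in lborel. \<bar>f x\<bar> \<le> B"
  shows "admissible F f R w (\<lambda>x. if w x = 0 then 0 else g x)"
proof -
  have tm [measurable]: "trunc \<epsilon> \<in> borel_measurable borel" "trunc_deriv \<epsilon> \<in> borel_measurable borel" for \<epsilon>
  proof -
    show "trunc \<epsilon> \<in> borel_measurable borel" by (rule smooth_measurable[OF smooth_trunc])
    have [measurable]: "flat_exp m \<in> borel_measurable borel" for m by (rule smooth_measurable[OF smooth_flat_exp])
    show "trunc_deriv \<epsilon> \<in> borel_measurable borel" unfolding trunc_deriv_def[abs_def] by measurable
  qed
  have truncated: "admissible F f R (\<lambda>x. trunc \<epsilon> (w x)) (\<lambda>x. trunc_deriv \<epsilon> (w x) *\<^sub>R g x)" if \<epsilon>: "\<epsilon> > 0" for \<epsilon>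
  proof -
    obtain \<phi> :: "nat \<Rightarrow> 'a \<Rightarrow> real" and C where \<phi>: "\<And>n. \<phi> n \<in> test_functions \<Omega>"
      "\<And>n x. \<bar>\<phi> n x\<bar> \<le> C" "\<And>n x. norm (grad (\<phi> n) x) \<le> C"
      "AE x in lborel. (\<lambda>n. \<phi> n x) \<longlonglongrightarrow> trunc \<epsilon> (w x)"
      "AE x in lborel. (\<lambda>n. grad (\<phi> n) x) \<longlonglongrightarrow> trunc_deriv \<epsilon> (w x) *\<^sub>R g x"
      by (rule truncated_test_functions[OF \<epsilon>]) (rule that)
    show ?thesis
    proof (rule admissible_limit[where p = \<phi> and P = "\<lambda>n. grad (\<phi> n)", OF _ _ _ \<phi>(4,5) _ _ meas F f])
      show "admissible F f R (\<phi> n) (grad (\<phi> n))" for n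
        using eq[OF \<phi>(1)[of n]] R[OF \<phi>(1)[of n]] smooth_measurable[OF test_smooth[OF \<phi>(1)[of n]]]
          grad_measurable[OF test_smooth[OF \<phi>(1)[of n]]]
        by (simp add: admissible_def sq_norm_def energy_def)
      show "\<bar>\<phi> n x\<bar> \<le> C * indicator \<Omega> x" "norm (grad (\<phi> n) x) \<le> C * indicator \<Omega> x" for n x
        using \<phi>(2,3)[of n x] test_outside[OF \<phi>(1), of x n] grad_outside[OF \<phi>(1), of x n] by (auto split: split_indicator)
    qed measurable
  qed
  obtain W where W: "0 \<le> W" "\<And>x. \<bar>w x\<bar> \<le> W" by (rule w_bounded) (rule that)
  define \<epsilon> where "\<epsilon> n = inverse (real (Suc n))" for n
  have \<epsilon>: "\<epsilon> n > 0" "\<epsilon> \<longlonglongrightarrow> 0" for n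
    using LIMSEQ_inverse_real_of_nat by (auto simp: \<epsilon>_def[abs_def])
  show ?thesis
  proof (rule admissible_limit[where p = "\<lambda>n x. trunc (\<epsilon> n) (w x)" and P = "\<lambda>n x. trunc_deriv (\<epsilon> n) (w x) *\<^sub>R g x"
        and C = "W + 9", OF truncated[OF \<epsilon>(1)] _ _ _ _ _ _ meas F f])
    show "\<bar>trunc (\<epsilon> n) (w x)\<bar> \<le> (W + 9) * indicator \<Omega> x" for n x
      using order_trans[OF trunc_abs_le W(2), of "\<epsilon> n" x] outside[of x] by (auto simp: trunc_def split: split_indicator)
    show "norm (trunc_deriv (\<epsilon> n) (w x) *\<^sub>R g x) \<le> (W + 9) * indicator \<Omega> x" for n x
    proof (cases "x \<in> \<Omega>")
      case True
      have "norm (trunc_deriv (\<epsilon> n) (w x) *\<^sub>R g x) \<le> 9 * 1"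
        unfolding norm_scaleR by (intro mult_mono trunc_deriv_abs_le gradient_bound) auto
      then show ?thesis using True W(1) by simp
    qed (simp add: gradient_outside)
    show "AE x in lborel. (\<lambda>n. trunc (\<epsilon> n) (w x)) \<longlonglongrightarrow> w x"
      by (intro AE_I2 trunc_tendsto \<epsilon>)
    show "AE x in lborel. (\<lambda>n. trunc_deriv (\<epsilon> n) (w x) *\<^sub>R g x) \<longlonglongrightarrow> (if w x = 0 then 0 else g x)"
    proof (intro AE_I2)
      fix x
      have "(\<lambda>n. trunc_deriv (\<epsilon> n) (w x) *\<^sub>R g x) \<longlonglongrightarrow> (if w x = 0 then 0 else 1) *\<^sub>R g x"
        by (intro tendsto_scaleR tendsto_const trunc_tendsto \<epsilon>)
      then show "(\<lambda>n. trunc_deriv (\<epsilon> n) (w x) *\<^sub>R g x) \<longlonglongrightarrow> (if w x = 0 then 0 else g x)"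
        by (cases "w x = 0") auto
    qed
  qed measurable
qed

text \<open>
  The flux satisfies \<open>F \<bullet> g \<ge> \<bar>g\<bar>\<^sup>2\<close>, strictly unless \<open>g = 0\<close>, so that a right hand side
  dominated by the Rayleigh constant leaves no room for a nonzero gradient where \<open>w \<noteq> 0\<close>.
\<close>

lemma vanishes:
  assumes R: "R > 0" "\<And>\<phi>. \<phi> \<in> test_functions \<Omega> \<Longrightarrow> R * sq_norm \<phi> \<le> energy \<phi>"
    and L: "L < 1" "\<And>x. norm (g x) \<le> L"
    and eq: "\<And>\<phi>. \<phi> \<in> test_functions \<Omega> \<Longrightarrow>
      (\<integral>x. (g x /\<^sub>R sqrt (1 - (norm (g x))\<^sup>2)) \<bullet> grad \<phi> x \<partial>lborel) = (\<integral>x. f x * \<phi> x \<partial>lborel)"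
    and f: "f \<in> borel_measurable borel" "AE x in lborel. \<bar>f x\<bar> \<le> B" "AE x in lborel. f x * w x \<le> R * (w x)\<^sup>2"
  shows "w x = 0"
proof -
  note [measurable] = f(1)
  define F where "F x = g x /\<^sub>R sqrt (1 - (norm (g x))\<^sup>2)" for x
  define P where "P x = (if w x = 0 then 0 else g x)" for x
  have L0: "L \<ge> 0" using L(2)[of 0] by (rule order_trans[OF norm_ge_zero])
  have root: "sqrt (1 - L\<^sup>2) > 0" using L(1) L0 by (simp add: power_less_one_iff abs_square_less_1)
  have mono: "sqrt (1 - L\<^sup>2) \<le> sqrt (1 - (norm (g x))\<^sup>2)" "sqrt (1 - (norm (g x))\<^sup>2) \<le> 1" for x
    using power_mono[OF L(2) norm_ge_zero, of x 2] by auto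
  have Fb: "norm (F x) \<le> 1 / sqrt (1 - L\<^sup>2)" for x
  proof -
    have "norm (F x) = norm (g x) / sqrt (1 - (norm (g x))\<^sup>2)"
      using root mono(1)[of x] by (simp add: F_def divide_inverse mult.commute)
    also have "\<dots> \<le> 1 / sqrt (1 - L\<^sup>2)"
      using root mono(1)[of x] gradient_bound[of x] by (intro frac_le) auto
    finally show ?thesis .
  qed
  have [measurable]: "F \<in> borel_measurable borel" "P \<in> borel_measurable borel"
    unfolding F_def[abs_def] P_def[abs_def] by measurable
  have adm: "admissible F f R w P"
    unfolding P_def[abs_def]
  proof (rule admissible_self[where B = "max B (1 / sqrt (1 - L\<^sup>2))", OF R(2)])
    show "(\<integral>x. F x \<bullet> grad \<phi> x \<partial>lborel) = (\<integral>x. f x * \<phi> x \<partial>lborel)" if "\<phi> \<in> test_functions \<Omega>" for \<phi>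
      using eq[OF that] by (simp add: F_def)
    show "AE x in lborel. norm (F x) \<le> max B (1 / sqrt (1 - L\<^sup>2))"
      using Fb by (intro AE_I2) (simp add: le_max_iff_disj)
    show "AE x in lborel. \<bar>f x\<bar> \<le> max B (1 / sqrt (1 - L\<^sup>2))"
      using f(2) by eventually_elim simp
  qed measurable
  have P0: "P x = 0" if "x \<notin> \<Omega>" for x using outside[OF that] by (simp add: P_def)
  have P1: "norm (P x) \<le> 1" for x using gradient_bound[of x] by (simp add: P_def)
  have FP: "F x \<bullet> P x = (norm (P x))\<^sup>2 / sqrt (1 - (norm (g x))\<^sup>2)" for x
    by (simp add: P_def F_def power2_norm_eq_inner divide_inverse mult.commute)
  have ge: "F x \<bullet> P x \<ge> (norm (P x))\<^sup>2" for x
    unfolding FP using root mono[of x] by (simp add: pos_le_divide_eq mult_left_le)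
  have iP: "integrable lborel (\<lambda>x. (norm (P x))\<^sup>2)"
  proof (rule Bochner_Integration.integrable_bound[OF indicator_integrable[of 1]])
    show "AE x in lborel. norm ((norm (P x))\<^sup>2) \<le> norm (1 * indicator \<Omega> x :: real)"
      using P0 P1 by (intro AE_I2) (auto split: split_indicator simp: power_le_one)
  qed measurable
  have iFP: "integrable lborel (\<lambda>x. F x \<bullet> P x)"
  proof (rule Bochner_Integration.integrable_bound[OF indicator_integrable[of "1 / sqrt (1 - L\<^sup>2)"]])
    show "AE x in lborel. norm (F x \<bullet> P x) \<le> norm (1 / sqrt (1 - L\<^sup>2) * indicator \<Omega> x :: real)"
    proof (intro AE_I2)
      fix x
      have "norm (F x \<bullet> P x) \<le> norm (F x) * norm (P x)" by (simp add: Cauchy_Schwarz_ineq2)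
      also have "\<dots> \<le> 1 / sqrt (1 - L\<^sup>2) * 1" using root by (intro mult_mono Fb P1) auto
      finally show "norm (F x \<bullet> P x) \<le> norm (1 / sqrt (1 - L\<^sup>2) * indicator \<Omega> x :: real)"
        using P0[of x] root by (auto split: split_indicator)
    qed
  qed measurable
  have w2: "integrable lborel (\<lambda>x. (w x)\<^sup>2)"
    by (rule integrable_compact_support[OF _ closure_compact])
       (auto intro!: continuous_intros continuous simp: outside_closure)
  have fw: "integrable lborel (\<lambda>x. f x * w x)"
  proof (rule Bochner_Integration.integrable_bound[OF integrable_mult_right[OF w_integrable, of B]])
    show "AE x in lborel. norm (f x * w x) \<le> norm (B * w x)"
      using f(2) by eventually_elim (auto simp: abs_mult intro: mult_right_mono)
  qed measurable
  have "(\<integral>x. F x \<bullet> P x \<partial>lborel) = (\<integral>x. f x * w x \<partial>lborel)" using adm by (simp add: admissible_def)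
  also have "\<dots> \<le> (\<integral>x. R * (w x)\<^sup>2 \<partial>lborel)"
    by (rule integral_mono_AE[OF fw]) (use w2 f(3) in auto)
  also have "\<dots> \<le> (\<integral>x. (norm (P x))\<^sup>2 \<partial>lborel)" using adm by (simp add: admissible_def)
  finally have "(\<integral>x. F x \<bullet> P x - (norm (P x))\<^sup>2 \<partial>lborel) \<le> 0" using iP iFP by simp
  moreover have "(\<integral>x. F x \<bullet> P x - (norm (P x))\<^sup>2 \<partial>lborel) \<ge> 0" using ge by (intro integral_nonneg_AE) simp
  ultimately have "(\<integral>x. F x \<bullet> P x - (norm (P x))\<^sup>2 \<partial>lborel) = 0" by linarith
  then have "AE x in lborel. F x \<bullet> P x - (norm (P x))\<^sup>2 = 0"
    by (subst (asm) integral_nonneg_eq_0_iff_AE) (use iP iFP ge in auto)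
  then have "AE x in lborel. (norm (P x))\<^sup>2 = 0"
  proof eventually_elim
    case (elim x)
    show ?case
    proof (rule ccontr)
      assume n: "(norm (P x))\<^sup>2 \<noteq> 0"
      then have "g x \<noteq> 0" by (auto simp: P_def split: if_splits)
      then have lt: "sqrt (1 - (norm (g x))\<^sup>2) < 1" by simp
      have pos: "sqrt (1 - (norm (g x))\<^sup>2) > 0" using root mono(1)[of x] by linarith
      have "(norm (P x))\<^sup>2 > 0" using n by (simp add: zero_less_power2)
      then have "(norm (P x))\<^sup>2 < (norm (P x))\<^sup>2 / sqrt (1 - (norm (g x))\<^sup>2)"
        using lt pos by (simp add: pos_less_divide_eq)
      then show False using elim by (simp add: FP)
    qed
  qed
  then have "(\<integral>x. (norm (P x))\<^sup>2 \<partial>lborel) = 0"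
    by (subst integral_nonneg_eq_0_iff_AE) (use iP in auto)
  then have "R * (\<integral>x. (w x)\<^sup>2 \<partial>lborel) \<le> 0" using adm by (simp add: admissible_def)
  then have "(\<integral>x. (w x)\<^sup>2 \<partial>lborel) \<le> 0" using R(1) by (simp add: mult_le_0_iff)
  moreover have "(\<integral>x. (w x)\<^sup>2 \<partial>lborel) \<ge> 0" by simp
  ultimately have "(\<integral>x. (w x)\<^sup>2 \<partial>lborel) = 0" by linarith
  then have AE0: "AE x in lborel. (w x)\<^sup>2 = 0"
    by (subst (asm) integral_nonneg_eq_0_iff_AE) (use w2 in auto)
  show "w x = 0"
  proof (rule ccontr)
    assume "w x \<noteq> 0"
    have "open {x. w x \<noteq> 0}" by (intro open_Collect_neq continuous continuous_on_const)
    then have "\<exists>y\<in>{x. w x \<noteq> 0}. w y = 0"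
      using \<open>w x \<noteq> 0\<close> AE0 by (intro open_AE_ex) (auto elim: eventually_mono)
    then show False by simp
  qed
qed

end

section \<open>From solutions to functions on the whole space\<close>

lemma AE_lebesgue_on:
  "open \<Omega> \<Longrightarrow> (AE x in lebesgue_on \<Omega>. P x) \<longleftrightarrow> (AE x in lborel. x \<in> \<Omega> \<longrightarrow> P x)"
  by (subst AE_restrict_space_iff) (auto simp: AE_completion_iff)

lemma lebesgue_on_borel_representative:
  fixes f :: "'a::euclidean_space \<Rightarrow> real"
  assumes "open \<Omega>" "f \<in> borel_measurable (lebesgue_on \<Omega>)"
  obtains f' where "f' \<in> borel_measurable borel" "AE x in lborel. x \<in> \<Omega> \<longrightarrow> f x = f' x" "\<And>x. x \<notin> \<Omega> \<Longrightarrow> f' x = 0"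
proof -
  have "(\<lambda>x. indicator \<Omega> x *\<^sub>R f x) \<in> borel_measurable lebesgue"
    using assms by (subst borel_measurable_restrict_space_iff[symmetric]) auto
  then obtain h where h: "h \<in> borel_measurable lborel" "AE x in lborel. indicator \<Omega> x *\<^sub>R f x = h x"
    using completion_ex_borel_measurable_real by blast
  have m: "h \<in> borel_measurable borel" "\<Omega> \<in> sets borel" using h(1) assms(1) by auto
  show thesis
  proof (rule that[of "\<lambda>x. indicator \<Omega> x * h x"])
    show "(\<lambda>x. indicator \<Omega> x * h x) \<in> borel_measurable borel" using m by measurable
    show "AE x in lborel. x \<in> \<Omega> \<longrightarrow> f x = indicator \<Omega> x * h x"
      using h(2) by eventually_elim auto
  qed simp
qed

text \<open>
  On the compact support of \<open>\<phi>\<close> an integrable function is multiplied by a bounded one.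
\<close>

lemma locally_integrable_mult_test:
  fixes f :: "'a::euclidean_space \<Rightarrow> real"
  assumes "open \<Omega>" "locally_integrable \<Omega> f" "\<phi> \<in> test_functions \<Omega>"
  shows "integrable (lebesgue_on \<Omega>) (\<lambda>x. f x * \<phi> x)"
proof -
  obtain K where K: "smooth \<phi>" "compact K" "K \<subseteq> \<Omega>" "\<And>x. x \<notin> K \<Longrightarrow> \<phi> x = 0"
    using test_functionsE[OF assms(3)] by metis
  obtain B where B: "\<And>x. \<bar>\<phi> x\<bar> \<le> B" using test_bounded[OF assms(3)] by blast
  have Ks: "K \<inter> space lebesgue \<in> sets lebesgue" "\<Omega> \<inter> space lebesgue \<in> sets lebesgue"
    using K(2) assms(1) by (auto simp: borel_compact)
  have "integrable (lebesgue_on K) f" using assms(2) K(2,3) by (auto simp: locally_integrable_def)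
  then have "integrable lebesgue (\<lambda>x. indicator K x *\<^sub>R f x)"
    by (rule integrable_restrict_space[OF Ks(1), THEN iffD1])
  then have "integrable lebesgue (\<lambda>x. (indicator K x *\<^sub>R f x) * \<phi> x)"
    by (rule integrable_mult_bounded[OF _ _ B]) (use smooth_measurable[OF K(1)] in \<open>simp add: measurable_completion\<close>)
  moreover have "(\<lambda>x. (indicator K x *\<^sub>R f x) * \<phi> x) = (\<lambda>x. indicator \<Omega> x *\<^sub>R (f x * \<phi> x))"
  proof
    fix x show "(indicator K x *\<^sub>R f x) * \<phi> x = indicator \<Omega> x *\<^sub>R (f x * \<phi> x)"
      using K(3,4) by (cases "x \<in> K") (auto split: split_indicator)
  qed
  ultimately have "integrable lebesgue (\<lambda>x. indicator \<Omega> x *\<^sub>R (f x * \<phi> x))" by simp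
  then show ?thesis by (rule integrable_restrict_space[OF Ks(2), THEN iffD2])
qed

lemma integral_lebesgue_on_cong_AE:
  fixes f f' \<phi> :: "'a::euclidean_space \<Rightarrow> real"
  assumes "open \<Omega>" and [measurable]: "f \<in> borel_measurable (lebesgue_on \<Omega>)" and f': "f' \<in> borel_measurable borel"
    and eq: "AE x in lborel. x \<in> \<Omega> \<longrightarrow> f x = f' x"
    and \<phi>: "\<phi> \<in> borel_measurable borel" "\<And>x. x \<notin> \<Omega> \<Longrightarrow> \<phi> x = 0"
  shows "(LINT x|lebesgue_on \<Omega>. f x * \<phi> x) = (\<integral>x. f' x * \<phi> x \<partial>lborel)"
proof -
  have [measurable]: "f' \<in> borel_measurable (lebesgue_on \<Omega>)" "\<phi> \<in> borel_measurable (lebesgue_on \<Omega>)"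
    by (intro lebesgue_on_measurable f' \<phi>)+
  have "(LINT x|lebesgue_on \<Omega>. f x * \<phi> x) = (LINT x|lebesgue_on \<Omega>. f' x * \<phi> x)"
  proof (rule integral_cong_AE)
    show "AE x in lebesgue_on \<Omega>. f x * \<phi> x = f' x * \<phi> x"
      using eq unfolding AE_lebesgue_on[OF assms(1)] by eventually_elim simp
  qed measurable
  also have "\<dots> = (\<integral>x. f' x * \<phi> x \<partial>lborel)"
    by (rule integral_lebesgue_on(1)[OF assms(1)]) (use f' \<phi> in auto)
  finally show ?thesis .
qed

text \<open>
  The two closed sets \<open>closure \<Omega>\<close> and \<open>- \<Omega>\<close> meet in the frontier, where \<open>u\<close> is zero.
\<close>

lemma zero_extension_continuous:
  fixes u :: "'a::euclidean_space \<Rightarrow> real"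
  assumes "open \<Omega>" "continuous_on (closure \<Omega>) u" "\<And>x. x \<in> frontier \<Omega> \<Longrightarrow> u x = 0"
  shows "continuous_on UNIV (\<lambda>x. if x \<in> \<Omega> then u x else 0)"
proof -
  have "continuous_on (closure \<Omega> \<union> - \<Omega>) (\<lambda>x. if x \<in> \<Omega> then u x else 0)"
  proof (rule continuous_on_closed_Un)
    show "continuous_on (closure \<Omega>) (\<lambda>x. if x \<in> \<Omega> then u x else 0)"
      by (rule continuous_on_eq[OF assms(2)]) (use assms in \<open>auto simp: frontier_def interior_open\<close>)
    show "continuous_on (- \<Omega>) (\<lambda>x. if x \<in> \<Omega> then u x else 0)"
      by (rule continuous_on_eq[OF continuous_on_const[of _ 0]]) auto
  qed (use assms(1) in auto)
  moreover have "closure \<Omega> \<union> - \<Omega> = UNIV" using closure_subset by auto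
  ultimately show ?thesis by simp
qed

lemma bound_if_esssup_abs_less_1:
  assumes "esssup_abs \<Omega> f < 1"
  obtains L where "0 \<le> L" "L < 1" "AE x in lebesgue_on \<Omega>. \<bar>f x\<bar> \<le> L"
proof -
  obtain z where z: "esssup_abs \<Omega> f < ereal z" "ereal z < 1"
    using ereal_dense2[OF assms] by blast
  have "AE x in lebesgue_on \<Omega>. ereal \<bar>f x\<bar> \<le> esssup_abs \<Omega> f"
    unfolding esssup_abs_def by (rule esssup_AE)
  then have "AE x in lebesgue_on \<Omega>. \<bar>f x\<bar> \<le> max z 0"
  proof eventually_elim
    case (elim x)
    then have "ereal \<bar>f x\<bar> < ereal z" using z(1) by (rule le_less_trans)
    then show ?case by simp
  qed
  moreover have "max z 0 < 1" using z(2) by (simp add: one_ereal_def)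
  ultimately show thesis using that[of "max z 0"] by simp
qed

text \<open>
  Pointwise, \<open>\<bar>f x\<bar> \<le> esssup < \<infinity>\<close> forces the essential supremum to be a real number, so that nothing is
  lost in the conversion.
\<close>

lemma AE_le_Linf_norm:
  assumes "in_Linf \<Omega> f" shows "AE x in lebesgue_on \<Omega>. \<bar>f x\<bar> \<le> Linf_norm \<Omega> f"
proof -
  have "AE x in lebesgue_on \<Omega>. ereal \<bar>f x\<bar> \<le> esssup_abs \<Omega> f"
    unfolding esssup_abs_def by (rule esssup_AE)
  then show ?thesis
  proof eventually_elim
    case (elim x)
    then show ?case using assms unfolding in_Linf_def Linf_norm_def
      by (cases "esssup_abs \<Omega> f") auto
  qed
qed

text \<open>
  On a null set the representative is changed to zero, which makes the bound by \<open>L\<close> valid everywhere.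
\<close>

lemma borel_weak_gradient:
  fixes u :: "'a::euclidean_space \<Rightarrow> real"
  assumes "open \<Omega>" "has_weak_gradient \<Omega> u G" "esssup_abs \<Omega> (\<lambda>x. norm (G x)) < 1"
  obtains g L where "g \<in> borel_measurable borel" "\<And>x. x \<notin> \<Omega> \<Longrightarrow> g x = 0" "0 \<le> L" "L < 1"
    "\<And>x. norm (g x) \<le> L" "AE x in lborel. x \<in> \<Omega> \<longrightarrow> G x = g x"
proof -
  have Gm: "(\<lambda>x. G x \<bullet> i) \<in> borel_measurable (lebesgue_on \<Omega>)" if "i \<in> Basis" for i
    using assms(2) that by (auto simp: has_weak_gradient_def has_weak_partial_def locally_integrable_def)
  have "\<forall>i\<in>Basis. \<exists>h. h \<in> borel_measurable borel \<and> (AE x in lborel. x \<in> \<Omega> \<longrightarrow> G x \<bullet> i = h x) \<and> (\<forall>x. x \<notin> \<Omega> \<longrightarrow> h x = 0)"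
  proof
    fix i :: 'a assume "i \<in> Basis"
    show "\<exists>h. h \<in> borel_measurable borel \<and> (AE x in lborel. x \<in> \<Omega> \<longrightarrow> G x \<bullet> i = h x) \<and> (\<forall>x. x \<notin> \<Omega> \<longrightarrow> h x = 0)"
      by (rule lebesgue_on_borel_representative[OF assms(1) Gm[OF \<open>i \<in> Basis\<close>]]) blast
  qed
  from bchoice[OF this] obtain h where
    "\<forall>i\<in>Basis. h i \<in> borel_measurable borel \<and> (AE x in lborel. x \<in> \<Omega> \<longrightarrow> G x \<bullet> i = h i x) \<and> (\<forall>x. x \<notin> \<Omega> \<longrightarrow> h i x = 0)" ..
  then have h: "\<And>i. i \<in> Basis \<Longrightarrow> h i \<in> borel_measurable borel"
    "\<And>i. i \<in> Basis \<Longrightarrow> AE x in lborel. x \<in> \<Omega> \<longrightarrow> G x \<bullet> i = h i x" "\<And>i x. i \<in> Basis \<Longrightarrow> x \<notin> \<Omega> \<Longrightarrow> h i x = 0"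
    by blast+
  obtain L where L: "0 \<le> L" "L < 1" "AE x in lebesgue_on \<Omega>. \<bar>norm (G x)\<bar> \<le> L"
    by (rule bound_if_esssup_abs_less_1[OF assms(3)]) (rule that)
  define g0 where "g0 x = (\<Sum>i\<in>Basis. h i x *\<^sub>R i)" for x
  define g where "g x = (if norm (g0 x) \<le> L then g0 x else 0)" for x
  have g0m [measurable]: "g0 \<in> borel_measurable borel"
    unfolding g0_def[abs_def] using h(1) by (intro borel_measurable_sum borel_measurable_scaleR) auto
  have "AE x in lborel. \<forall>i\<in>Basis. x \<in> \<Omega> \<longrightarrow> G x \<bullet> i = h i x"
    using h(2) by (intro AE_finite_allI) auto
  moreover have "AE x in lborel. x \<in> \<Omega> \<longrightarrow> norm (G x) \<le> L"
    using L(3) unfolding AE_lebesgue_on[OF assms(1)] by simp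
  ultimately have eq: "AE x in lborel. x \<in> \<Omega> \<longrightarrow> G x = g x"
  proof eventually_elim
    case (elim x)
    show ?case
    proof
      assume x: "x \<in> \<Omega>"
      have "G x = (\<Sum>i\<in>Basis. (G x \<bullet> i) *\<^sub>R i)" by (simp add: euclidean_representation)
      also have "\<dots> = g0 x" unfolding g0_def using elim(1) x by (intro sum.cong) auto
      finally show "G x = g x" using elim(2) x by (simp add: g_def)
    qed
  qed
  show thesis
  proof (rule that[OF _ _ L(1,2) _ eq])
    show "g \<in> borel_measurable borel" unfolding g_def[abs_def] by measurable
    show "g x = 0" if "x \<notin> \<Omega>" for x using that by (simp add: g_def g0_def h(3))
    show "norm (g x) \<le> L" for x using L(1) by (simp add: g_def)
  qed
qed

section \<open>Uniqueness of the trivial solution\<close>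

text \<open>
  The solution only takes values with \<open>\<bar>s\<bar> \<le> diameter \<Omega> / 2\<close>. The two bounds make the right hand side bounded and let the eigenvalue control it after multiplication by
  the solution.
\<close>

lemma mc_solution_trivial:
  fixes \<Omega> :: "'a::euclidean_space set"
  assumes \<Omega>: "open \<Omega>" "\<Omega> \<noteq> {}" "bounded \<Omega>"
    and sol: "mc_solution \<Omega> f u"
    and f: "AE x in lebesgue_on \<Omega>. \<forall>s. \<bar>s\<bar> \<le> diameter \<Omega> / 2 \<longrightarrow>
      \<bar>f x s\<bar> \<le> C * \<bar>s\<bar> \<and> f x s * s \<le> first_dirichlet_eigenvalue \<Omega> * s\<^sup>2"
    and x: "x \<in> closure \<Omega>"
  shows "u x = 0"
proof -
  define R where "R = first_dirichlet_eigenvalue \<Omega>"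
  have R: "R > 0" "\<And>\<phi>. \<phi> \<in> test_functions \<Omega> \<Longrightarrow> R * sq_norm \<phi> \<le> energy \<phi>"
    using first_eigenvalue_rayleigh[OF \<Omega>] by (auto simp: R_def)
  have cont: "continuous_on (closure \<Omega>) u" and bdry: "\<And>x. x \<in> frontier \<Omega> \<Longrightarrow> u x = 0"
    using sol by (auto simp: mc_solution_def)
  obtain G d where G: "has_weak_gradient \<Omega> u G" "esssup_abs \<Omega> (\<lambda>x. norm (G x)) < 1"
    and div: "has_weak_divergence \<Omega> (\<lambda>x. G x /\<^sub>R sqrt (1 - (norm (G x))\<^sup>2)) d"
    and eqn: "AE x in lebesgue_on \<Omega>. - d x = f x (u x)"
    using sol unfolding mc_solution_def by blast
  obtain g L where g: "g \<in> borel_measurable borel" "\<And>x. x \<notin> \<Omega> \<Longrightarrow> g x = 0" "0 \<le> L" "L < 1"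
    "\<And>x. norm (g x) \<le> L" "AE x in lborel. x \<in> \<Omega> \<longrightarrow> G x = g x"
    by (rule borel_weak_gradient[OF \<Omega>(1) G]) (rule that)
  define w where "w x = (if x \<in> \<Omega> then u x else 0)" for x
  have wc: "continuous_on UNIV w"
    unfolding w_def[abs_def] by (rule zero_extension_continuous[OF \<Omega>(1) cont bdry])
  have wm: "w \<in> borel_measurable borel" using wc by (rule borel_measurable_continuous_onI)
  have tm: "\<phi> \<in> borel_measurable borel" if "\<phi> \<in> test_functions \<Omega>" for \<phi>
    by (rule smooth_measurable[OF test_smooth[OF that]])
  have weak: "(\<integral>x. w x * partial i \<phi> x \<partial>lborel) = - (\<integral>x. (g x \<bullet> i) * \<phi> x \<partial>lborel)"
    if \<phi>: "\<phi> \<in> test_functions \<Omega>" and i: "i \<in> Basis" for \<phi> i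
  proof -
    have wp: "has_weak_partial \<Omega> i u (\<lambda>x. G x \<bullet> i)" using G(1) i by (simp add: has_weak_gradient_def)
    have p: "partial i \<phi> \<in> test_functions \<Omega>" by (rule test_partial[OF \<phi> i])
    have gm: "(\<lambda>x. g x \<bullet> i) \<in> borel_measurable borel" using g(1) by measurable
    have um: "u \<in> borel_measurable (lebesgue_on \<Omega>)" and Gm: "(\<lambda>x. G x \<bullet> i) \<in> borel_measurable (lebesgue_on \<Omega>)"
      using wp by (auto simp: has_weak_partial_def locally_integrable_def)
    have Gg: "AE x in lborel. x \<in> \<Omega> \<longrightarrow> G x \<bullet> i = g x \<bullet> i"
      using g(6) by eventually_elim auto
    have "(LINT x|lebesgue_on \<Omega>. u x * partial i \<phi> x) = (\<integral>x. w x * partial i \<phi> x \<partial>lborel)"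
      by (rule integral_lebesgue_on_cong_AE[OF \<Omega>(1) um wm _ tm[OF p]])
         (auto simp: w_def test_outside[OF p])
    moreover have "(LINT x|lebesgue_on \<Omega>. (G x \<bullet> i) * \<phi> x) = (\<integral>x. (g x \<bullet> i) * \<phi> x \<partial>lborel)"
      by (rule integral_lebesgue_on_cong_AE[OF \<Omega>(1) Gm gm Gg tm[OF \<phi>]])
         (simp add: test_outside[OF \<phi>])
    moreover have "(LINT x|lebesgue_on \<Omega>. u x * partial i \<phi> x) = - (LINT x|lebesgue_on \<Omega>. (G x \<bullet> i) * \<phi> x)"
      using wp \<phi> by (simp add: has_weak_partial_def)
    ultimately show ?thesis by simp
  qed
  interpret zero_boundary_values \<Omega> w g
    using \<Omega> wc g weak order_trans[OF g(5) less_imp_le[OF g(4)]] by unfold_locales (auto simp: w_def)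
  define F where "F x = g x /\<^sub>R sqrt (1 - (norm (g x))\<^sup>2)" for x
  have Fm [measurable]: "F \<in> borel_measurable borel" unfolding F_def[abs_def] by measurable
  define H where "H x = G x /\<^sub>R sqrt (1 - (norm (G x))\<^sup>2)" for x
  have HF: "AE x in lborel. x \<in> \<Omega> \<longrightarrow> H x = F x"
    using g(6) by eventually_elim (simp add: H_def F_def)
  obtain D where D: "\<And>i. i \<in> Basis \<Longrightarrow> has_weak_partial \<Omega> i (\<lambda>x. H x \<bullet> i) (D i)"
    "AE x in lebesgue_on \<Omega>. d x = (\<Sum>i\<in>Basis. D i x)"
    using div unfolding has_weak_divergence_def H_def by blast
  define S where "S x = - (\<Sum>i\<in>Basis. D i x)" for x
  have Sm: "S \<in> borel_measurable (lebesgue_on \<Omega>)"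
    unfolding S_def[abs_def] using D(1)
    by (intro borel_measurable_uminus borel_measurable_sum) (auto simp: has_weak_partial_def locally_integrable_def)
  obtain s where s: "s \<in> borel_measurable borel" "AE x in lborel. x \<in> \<Omega> \<longrightarrow> S x = s x" "\<And>x. x \<notin> \<Omega> \<Longrightarrow> s x = 0"
    by (rule lebesgue_on_borel_representative[OF \<Omega>(1) Sm]) (rule that)
  have weak_eq: "(\<integral>x. F x \<bullet> grad \<phi> x \<partial>lborel) = (\<integral>x. s x * \<phi> x \<partial>lborel)" if \<phi>: "\<phi> \<in> test_functions \<Omega>" for \<phi>
  proof -
    have comp: "(\<integral>x. (F x \<bullet> i) * partial i \<phi> x \<partial>lborel) = - (LINT x|lebesgue_on \<Omega>. D i x * \<phi> x)"
      "integrable lborel (\<lambda>x. (F x \<bullet> i) * partial i \<phi> x)" if i: "i \<in> Basis" for i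
    proof -
      have p: "partial i \<phi> \<in> test_functions \<Omega>" by (rule test_partial[OF \<phi> i])
      have Hm: "(\<lambda>x. H x \<bullet> i) \<in> borel_measurable (lebesgue_on \<Omega>)"
        using D(1)[OF i] by (simp add: has_weak_partial_def locally_integrable_def)
      have Fi: "(\<lambda>x. F x \<bullet> i) \<in> borel_measurable borel" by measurable
      have HFi: "AE x in lborel. x \<in> \<Omega> \<longrightarrow> H x \<bullet> i = F x \<bullet> i" using HF by eventually_elim auto
      have "(\<integral>x. (F x \<bullet> i) * partial i \<phi> x \<partial>lborel) = (LINT x|lebesgue_on \<Omega>. (H x \<bullet> i) * partial i \<phi> x)"
        by (rule integral_lebesgue_on_cong_AE[symmetric, OF \<Omega>(1) Hm Fi HFi tm[OF p]]) (simp add: test_outside[OF p])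
      also have "\<dots> = - (LINT x|lebesgue_on \<Omega>. D i x * \<phi> x)"
        using D(1)[OF i] \<phi> by (simp add: has_weak_partial_def)
      finally show "(\<integral>x. (F x \<bullet> i) * partial i \<phi> x \<partial>lborel) = - (LINT x|lebesgue_on \<Omega>. D i x * \<phi> x)" .
      have "integrable (lebesgue_on \<Omega>) (\<lambda>x. (H x \<bullet> i) * partial i \<phi> x)"
        using D(1)[OF i] by (intro locally_integrable_mult_test[OF \<Omega>(1) _ p]) (simp add: has_weak_partial_def)
      moreover have "integrable (lebesgue_on \<Omega>) (\<lambda>x. (H x \<bullet> i) * partial i \<phi> x)
          \<longleftrightarrow> integrable (lebesgue_on \<Omega>) (\<lambda>x. (F x \<bullet> i) * partial i \<phi> x)"
      proof (rule integrable_cong_AE)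
        have "partial i \<phi> \<in> borel_measurable (lebesgue_on \<Omega>)" by (rule lebesgue_on_measurable[OF tm[OF p]])
        then show "(\<lambda>x. (H x \<bullet> i) * partial i \<phi> x) \<in> borel_measurable (lebesgue_on \<Omega>)"
          "(\<lambda>x. (F x \<bullet> i) * partial i \<phi> x) \<in> borel_measurable (lebesgue_on \<Omega>)"
          using Hm lebesgue_on_measurable[OF Fi] by (auto intro!: borel_measurable_times)
        show "AE x in lebesgue_on \<Omega>. (H x \<bullet> i) * partial i \<phi> x = (F x \<bullet> i) * partial i \<phi> x"
          unfolding AE_lebesgue_on[OF \<Omega>(1)] using HFi by eventually_elim auto
      qed
      moreover have "integrable (lebesgue_on \<Omega>) (\<lambda>x. (F x \<bullet> i) * partial i \<phi> x)
          \<longleftrightarrow> integrable lborel (\<lambda>x. (F x \<bullet> i) * partial i \<phi> x)"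
        by (rule integral_lebesgue_on(2)[OF \<Omega>(1)]) (use Fi tm[OF p] test_outside[OF p] in auto)
      ultimately show "integrable lborel (\<lambda>x. (F x \<bullet> i) * partial i \<phi> x)" by blast
    qed
    have "(\<integral>x. F x \<bullet> grad \<phi> x \<partial>lborel) = (\<integral>x. (\<Sum>i\<in>Basis. (F x \<bullet> i) * partial i \<phi> x) \<partial>lborel)"
      by (intro Bochner_Integration.integral_cong refl) (simp add: grad_def inner_sum_right mult.commute)
    also have "\<dots> = (\<Sum>i\<in>Basis. - (LINT x|lebesgue_on \<Omega>. D i x * \<phi> x))"
      using comp by (subst Bochner_Integration.integral_sum) auto
    also have "\<dots> = (LINT x|lebesgue_on \<Omega>. (\<Sum>i\<in>Basis. - (D i x * \<phi> x)))"
      using locally_integrable_mult_test[OF \<Omega>(1) _ \<phi>] D(1)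
      by (subst Bochner_Integration.integral_sum) (auto simp: has_weak_partial_def)
    also have "\<dots> = (LINT x|lebesgue_on \<Omega>. S x * \<phi> x)"
      by (simp add: S_def sum_distrib_right sum_negf)
    also have "\<dots> = (\<integral>x. s x * \<phi> x \<partial>lborel)"
      by (rule integral_lebesgue_on_cong_AE[OF \<Omega>(1) Sm s(1,2) tm[OF \<phi>]]) (simp add: test_outside[OF \<phi>])
    finally show ?thesis .
  qed
  obtain W where W: "0 \<le> W" "\<And>x. \<bar>w x\<bar> \<le> W" by (rule w_bounded) (rule that)
  have "AE x in lborel. x \<in> \<Omega> \<longrightarrow> (\<forall>s. \<bar>s\<bar> \<le> diameter \<Omega> / 2 \<longrightarrow> \<bar>f x s\<bar> \<le> C * \<bar>s\<bar> \<and> f x s * s \<le> R * s\<^sup>2)"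
    using f unfolding AE_lebesgue_on[OF \<Omega>(1)] R_def .
  moreover have "AE x in lborel. x \<in> \<Omega> \<longrightarrow> d x = (\<Sum>i\<in>Basis. D i x)" using D(2) unfolding AE_lebesgue_on[OF \<Omega>(1)] .
  moreover have "AE x in lborel. x \<in> \<Omega> \<longrightarrow> - d x = f x (u x)" using eqn unfolding AE_lebesgue_on[OF \<Omega>(1)] .
  ultimately have rhs: "AE x in lborel. \<bar>s x\<bar> \<le> C * \<bar>w x\<bar> \<and> s x * w x \<le> R * (w x)\<^sup>2"
    using s(2)
  proof eventually_elim
    case (elim x)
    show ?case
    proof (cases "x \<in> \<Omega>")
      case True
      then have "s x = f x (w x)" using elim by (simp add: S_def w_def)
      then show ?thesis using elim(1) True abs_le_half_diameter[of x] by simp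
    next
      case False
      then show ?thesis by (simp add: s(3) w_def)
    qed
  qed
  have "w x = 0"
  proof (rule vanishes[OF R g(4,5) _ s(1)])
    show "(\<integral>x. (g x /\<^sub>R sqrt (1 - (norm (g x))\<^sup>2)) \<bullet> grad \<phi> x \<partial>lborel) = (\<integral>x. s x * \<phi> x \<partial>lborel)"
      if "\<phi> \<in> test_functions \<Omega>" for \<phi>
      using weak_eq[OF that] by (simp add: F_def)
    show "AE x in lborel. \<bar>s x\<bar> \<le> \<bar>C\<bar> * W"
      using rhs
    proof eventually_elim
      case (elim x)
      then have "\<bar>s x\<bar> \<le> C * \<bar>w x\<bar>" by simp
      also have "\<dots> \<le> \<bar>C\<bar> * W" using W(2)[of x] by (intro mult_mono) auto
      finally show ?case .
    qed
    show "AE x in lborel. s x * w x \<le> R * (w x)\<^sup>2" using rhs by eventually_elim simp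
  qed
  then show "u x = 0"
    using x bdry[of x] \<Omega>(1) by (cases "x \<in> \<Omega>") (auto simp: w_def frontier_def interior_open)
qed

lemma vanishing_in_Lp:
  assumes "\<And>x. x \<in> \<Omega> \<Longrightarrow> f x = 0" shows "in_Lp p \<Omega> f"
proof -
  have z: "\<And>x. x \<in> space (lebesgue_on \<Omega>) \<Longrightarrow> f x = 0" using assms by (simp add: space_restrict_space)
  have "f \<in> borel_measurable (lebesgue_on \<Omega>)"
    using z by (subst measurable_cong[where g = "\<lambda>_. 0"]) auto
  moreover have "integrable (lebesgue_on \<Omega>) (\<lambda>x. \<bar>f x\<bar> powr p)"
    using z by (subst Bochner_Integration.integrable_cong[where g = "\<lambda>_. 0"]) auto
  ultimately show ?thesis by (simp add: in_Lp_def)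
qed

lemma vanishing_weak_partial:
  assumes "\<And>x. x \<in> \<Omega> \<Longrightarrow> f x = 0" shows "has_weak_partial \<Omega> i f (\<lambda>_. 0)"
proof -
  have z: "f x = 0" if "x \<in> space (lebesgue_on A)" "A \<subseteq> \<Omega>" for x A
    using assms that by (auto simp: space_restrict_space)
  have "f \<in> borel_measurable (lebesgue_on \<Omega>)"
    using z by (subst measurable_cong[where g = "\<lambda>_. 0"]) auto
  moreover have "integrable (lebesgue_on A) f" if "A \<subseteq> \<Omega>" for A
    using z that by (subst Bochner_Integration.integrable_cong[where g = "\<lambda>_. 0"]) auto
  moreover have "(LINT x|lebesgue_on \<Omega>. f x * \<psi> x) = 0" for \<psi>
    using z by (subst Bochner_Integration.integral_cong[where g = "\<lambda>_. 0"]) auto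
  ultimately show ?thesis
    by (simp add: has_weak_partial_def locally_integrable_def)
qed

lemma mc_solution_zero:
  fixes \<Omega> :: "'a::euclidean_space set"
  assumes u: "\<And>x. x \<in> closure \<Omega> \<Longrightarrow> u x = 0" and f: "AE x in lebesgue_on \<Omega>. f x 0 = 0"
  shows "mc_solution \<Omega> f u"
  unfolding mc_solution_def
proof (intro conjI)
  have z: "u x = 0" if "x \<in> \<Omega>" for x using u closure_subset that by blast
  have "in_sobolev (Suc (Suc 0)) q \<Omega> u" for q
    unfolding in_sobolev.simps
    by (auto intro!: vanishing_in_Lp z exI[of _ "\<lambda>_. 0"] vanishing_weak_partial)
  then show "\<exists>q>real DIM('a). in_sobolev 2 q \<Omega> u"
    unfolding numeral_2_eq_2 by (intro exI[of _ "real DIM('a) + 1"]) simp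
  show "continuous_on (closure \<Omega>) u"
    by (rule continuous_on_eq[OF continuous_on_const[of _ 0]]) (simp add: u)
  show "\<forall>x\<in>frontier \<Omega>. u x = 0" using u by (simp add: frontier_def)
  show "\<exists>G d. has_weak_gradient \<Omega> u G \<and> esssup_abs \<Omega> (\<lambda>x. norm (G x)) < 1 \<and>
      has_weak_divergence \<Omega> (\<lambda>x. G x /\<^sub>R sqrt (1 - (norm (G x))\<^sup>2)) d \<and> (AE x in lebesgue_on \<Omega>. - d x = f x (u x))"
  proof (intro exI conjI)
    show "has_weak_gradient \<Omega> u (\<lambda>_. 0)"
      by (simp add: has_weak_gradient_def vanishing_weak_partial z)
    have "esssup_abs \<Omega> (\<lambda>x. norm (0::'a)) \<le> 0"
      unfolding esssup_abs_def by (rule esssup_I) auto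
    then show "esssup_abs \<Omega> (\<lambda>x. norm (0::'a)) < 1" by (rule le_less_trans) simp
    show "has_weak_divergence \<Omega> (\<lambda>x. 0 /\<^sub>R sqrt (1 - (norm (0::'a))\<^sup>2)) (\<lambda>_. 0)"
      unfolding has_weak_divergence_def
      by (intro exI[of _ "\<lambda>_ _. 0"]) (simp add: vanishing_weak_partial)
    show "AE x in lebesgue_on \<Omega>. - 0 = f x (u x)"
      using f AE_space by eventually_elim (simp add: space_restrict_space z)
  qed
qed

lemma diameter_pos:
  fixes \<Omega> :: "'a::euclidean_space set"
  assumes "open \<Omega>" "\<Omega> \<noteq> {}" "bounded \<Omega>" shows "diameter \<Omega> > 0"
proof -
  obtain a r where "r > 0" "ball a r \<subseteq> \<Omega>" using assms(1,2) open_contains_ball by blast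
  then show ?thesis using diameter_subset[of "ball a r" \<Omega>] assms(3) by simp
qed

theorem theorem2p9:
  fixes \<Omega> :: "(real ^ 'n) set"
    and lam \<mu> \<xi> K :: real
    and h :: "real ^ 'n \<Rightarrow> real \<Rightarrow> real"
    and \<alpha> :: "real \<Rightarrow> real ^ 'n \<Rightarrow> real"
    and u :: "real ^ 'n \<Rightarrow> real"
  assumes "CARD('n) \<ge> 2"
    and "domain_set \<Omega>" and "bounded \<Omega>" and "C2_boundary \<Omega>"
    and "\<mu> \<ge> 0"
    and "caratheodory \<Omega> h"
    and "\<And>\<rho>. \<rho> > 0 \<Longrightarrow> in_Linf \<Omega> (\<alpha> \<rho>)"
    and "\<And>\<rho>. \<rho> > 0 \<Longrightarrow> AE x in lebesgue_on \<Omega>. \<forall>s. \<bar>s\<bar> \<le> \<rho> \<longrightarrow> \<bar>h x s\<bar> \<le> \<alpha> \<rho> x"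
    and "\<xi> > 0"
    and "AE x in lebesgue_on \<Omega>. \<forall>s. \<bar>s\<bar> \<le> \<xi> \<longrightarrow> \<bar>h x s\<bar> \<le> \<bar>s\<bar>"
    and "K = diameter \<Omega> / 2"
    and "lam + \<mu> * (1 + Linf_norm \<Omega> (\<alpha> K) / \<xi>) \<le> first_dirichlet_eigenvalue \<Omega>"
  shows "mc_solution \<Omega> (\<lambda>x s. lam * s + \<mu> * h x s) u \<longleftrightarrow> (\<forall>x\<in>closure \<Omega>. u x = 0)"
proof
  have \<Omega>: "open \<Omega>" "\<Omega> \<noteq> {}" "bounded \<Omega>" using assms(2,3) by (auto simp: domain_set_def)
  define c where "c = 1 + Linf_norm \<Omega> (\<alpha> K) / \<xi>"
  have K: "K > 0" using diameter_pos[OF \<Omega>] assms(11) by simp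
  have bound: "AE x in lebesgue_on \<Omega>. \<forall>s. \<bar>s\<bar> \<le> K \<longrightarrow> \<bar>h x s\<bar> \<le> c * \<bar>s\<bar>"
    using AE_le_Linf_norm[OF assms(7)[OF K]] assms(8)[OF K] assms(10)
  proof eventually_elim
    case (elim x)
    define A where "A = Linf_norm \<Omega> (\<alpha> K)"
    have A: "\<bar>\<alpha> K x\<bar> \<le> A" "A \<ge> 0" using elim(1) by (auto simp: A_def)
    show ?case
    proof (intro allI impI)
      fix s :: real assume s: "\<bar>s\<bar> \<le> K"
      show "\<bar>h x s\<bar> \<le> c * \<bar>s\<bar>"
      proof (cases "\<bar>s\<bar> \<le> \<xi>")
        case True
        then have "\<bar>h x s\<bar> \<le> 1 * \<bar>s\<bar>" using elim(3) by simp
        also have "\<dots> \<le> c * \<bar>s\<bar>" using A assms(9) by (intro mult_right_mono) (auto simp: c_def A_def)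
        finally show ?thesis .
      next
        case False
        have "\<bar>h x s\<bar> \<le> A" using elim(2) s A(1) by (meson abs_le_D1 order_trans)
        also have "\<dots> = A / \<xi> * \<xi>" using assms(9) by simp
        also have "\<dots> \<le> c * \<bar>s\<bar>" using False A assms(9) by (intro mult_mono) (auto simp: c_def A_def)
        finally show ?thesis .
      qed
    qed
  qed
  show "\<forall>x\<in>closure \<Omega>. u x = 0" if sol: "mc_solution \<Omega> (\<lambda>x s. lam * s + \<mu> * h x s) u"
  proof
    fix x assume x: "x \<in> closure \<Omega>"
    show "u x = 0"
    proof (rule mc_solution_trivial[OF \<Omega> sol _ x])
      show "AE x in lebesgue_on \<Omega>. \<forall>s. \<bar>s\<bar> \<le> diameter \<Omega> / 2 \<longrightarrow>
          \<bar>lam * s + \<mu> * h x s\<bar> \<le> (\<bar>lam\<bar> + \<mu> * c) * \<bar>s\<bar> \<and>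
          (lam * s + \<mu> * h x s) * s \<le> first_dirichlet_eigenvalue \<Omega> * s\<^sup>2"
        using bound
      proof eventually_elim
        case (elim x)
        show ?case
        proof (intro allI impI)
          fix s :: real assume "\<bar>s\<bar> \<le> diameter \<Omega> / 2"
          then have h: "\<mu> * \<bar>h x s\<bar> \<le> \<mu> * (c * \<bar>s\<bar>)" using elim assms(5,11) by (intro mult_left_mono) auto
          have "\<bar>lam * s + \<mu> * h x s\<bar> \<le> \<bar>lam\<bar> * \<bar>s\<bar> + \<mu> * \<bar>h x s\<bar>"
            using assms(5) abs_triangle_ineq[of "lam * s" "\<mu> * h x s"] by (simp add: abs_mult)
          also have "\<dots> \<le> (\<bar>lam\<bar> + \<mu> * c) * \<bar>s\<bar>" using h by (simp add: algebra_simps)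
          finally have 1: "\<bar>lam * s + \<mu> * h x s\<bar> \<le> (\<bar>lam\<bar> + \<mu> * c) * \<bar>s\<bar>" .
          have "h x s * s \<le> \<bar>h x s\<bar> * \<bar>s\<bar>" by (simp add: abs_mult[symmetric])
          then have "\<mu> * (h x s * s) \<le> \<mu> * (\<bar>h x s\<bar> * \<bar>s\<bar>)" using assms(5) by (rule mult_left_mono)
          also have "\<dots> \<le> \<mu> * c * s\<^sup>2"
            using mult_right_mono[OF h, of "\<bar>s\<bar>"] by (simp add: power2_eq_square mult.assoc abs_mult_self_eq)
          finally have "(lam * s + \<mu> * h x s) * s \<le> (lam + \<mu> * c) * s\<^sup>2"
            by (simp add: algebra_simps power2_eq_square)
          also have "\<dots> \<le> first_dirichlet_eigenvalue \<Omega> * s\<^sup>2"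
            using assms(12) by (intro mult_right_mono) (auto simp: c_def)
          finally show "\<bar>lam * s + \<mu> * h x s\<bar> \<le> (\<bar>lam\<bar> + \<mu> * c) * \<bar>s\<bar> \<and>
              (lam * s + \<mu> * h x s) * s \<le> first_dirichlet_eigenvalue \<Omega> * s\<^sup>2" using 1 by blast
        qed
      qed
    qed
  qed
  show "mc_solution \<Omega> (\<lambda>x s. lam * s + \<mu> * h x s) u" if "\<forall>x\<in>closure \<Omega>. u x = 0"
  proof (rule mc_solution_zero)
    show "u x = 0" if "x \<in> closure \<Omega>" for x using \<open>\<forall>x\<in>closure \<Omega>. u x = 0\<close> that by blast
    show "AE x in lebesgue_on \<Omega>. lam * 0 + \<mu> * h x 0 = 0"
      using assms(10)
    proof eventually_elim
      case (elim x)
      then have "\<bar>h x 0\<bar> \<le> \<bar>0\<bar>" using assms(9) by (metis abs_zero less_imp_le)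
      then show ?case by simp
    qed
  qed
qed

end
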